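(* The 2-monad $\mathrm{T}_d:\mathbf{ED}\to\mathbf{ED}$ of the comprehensive diagonal completion, on the 2-category $\mathbf{ED}$ of elementary doctrines, is pseudo-idempotent.
   Context: $\mathbf{InfSL}$ is the category of posets with finite meets and functions preserving finite meets. Let $\mathcal C$ be a category with binary products. An elementary doctrine on $\mathcal C$ is a functor $P:\mathcal C^{\mathrm{op}}\to\mathbf{InfSL}$ (write $P_f=P(f)$) such that for every object $A$ there is $\delta_A\in P(A\times A)$ with: (1) $\alpha\mapsto P_{\mathrm{pr}_1}(\alpha)\wedge\delta_A$ is left adjoint to $P_{\langle \mathrm{id}_A,\mathrm{id}_A\rangle}:P(A\times A)\to P(A)$; (2) for every $e=\langle \mathrm{pr}_1,\mathrm{pr}_2,\mathrm{pr}_2\rangle:X\times A\to X\times A\times A$, the assignment $\alpha\mapsto P_{\langle \mathrm{pr}_1,\mathrm{pr}_2\rangle}(\alpha)\wedge P_{\langle \mathrm{pr}_2,\mathrm{pr}_3\rangle}(\delta_A)$ is left adjoint to $P_e:P(X\times A\times A)\to P(X\times A)$. The 2-category $\mathbf{ED}$: 0-cells are elementary doctrines; a 1-cell $(F,b):P\to R$ (with $P$ on $\mathcal C$, $R$ on $\mathcal D$) is a product-preserving functor $F:\mathcal C\to\mathcal D$ with a natural transformation $b:P\Rightarrow R\circ F^{\mathrm{op}}$ such that each $b_A$ preserves finite meets and $b_{A\times A}(\delta_A)=R_{\langle F\mathrm{pr}_1,F\mathrm{pr}_2\rangle}(\delta_{FA})$; a 2-cell $(F,b)\Rightarrow(G,c)$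 is a natural transformation $\theta:F\Rightarrow G$ with $b_A(\alpha)\le R_{\theta_A}(c_A(\alpha))$ for all $A$ and $\alpha\in P(A)$. The 2-monad $\mathrm T_d$: for $P$ on $\mathcal C$, the extensional collapse $\mathcal X_P$ has the objects of $\mathcal C$; a morphism $[f]:A\to B$ is an equivalence class of arrows $f:A\to B$ of $\mathcal C$ with $\delta_A\le P_{f\times f}(\delta_B)$, where $f\sim f'$ when $\delta_A\le P_{f\times f'}(\delta_B)$. $\mathrm T_d(P)=P_x:\mathcal X_P^{\mathrm{op}}\to\mathbf{InfSL}$ is given by $P_x(A)=P(A)$, $P_x([f])=P_f$ (well defined); it is an elementary doctrine. On a 1-cell, $\mathrm T_d(F,b)=(\widetilde F,b)$ with $\widetilde F(A)=F(A)$, $\widetilde F([f])=[F(f)]$; on a 2-cell, $\widetilde\theta_A=[\theta_A]$. The unit $\eta_P:P\to P_x$ is the quotient functor $\mathcal C\to\mathcal X_P$, $f\mapsto[f]$, with identity on elements. The multiplication $\mu_P:(P_x)_x\to P_x$ is identity on objects, sends $[[f]]$ to $[f]$, and is the identity on elements. A 2-monad $(\mathrm T,\mu,\eta)$ is pseudo-idempotent if its multiplication $\mu:\mathrm T^2\to\mathrm T$ is invertible, in the sense that each component $\mu_A:\mathrm T^2A\to\mathrm TA$ is an equivalence (in particular this holds if it is an isomorphism). *)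

theory Defs
  imports "HOL-Algebra.Galois_Connection"
begin

section \<open>Strict 2-categories, 2-monads and pseudo-idempotency\<close>

record ('c0, 'c1, 'c2) two_category =
  cells0 :: "'c0 set"
  cells1 :: "'c1 set"
  cells2 :: "'c2 set"
  src1 :: "'c1 \<Rightarrow> 'c0"
  tgt1 :: "'c1 \<Rightarrow> 'c0"
  src2 :: "'c2 \<Rightarrow> 'c1"
  tgt2 :: "'c2 \<Rightarrow> 'c1"
  id1 :: "'c0 \<Rightarrow> 'c1"
  comp1 :: "'c1 \<Rightarrow> 'c1 \<Rightarrow> 'c1"
  id2 :: "'c1 \<Rightarrow> 'c2"
  vcomp :: "'c2 \<Rightarrow> 'c2 \<Rightarrow> 'c2"
  hcomp :: "'c2 \<Rightarrow> 'c2 \<Rightarrow> 'c2"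

text \<open>All compositions are written in applicative order: \<open>comp1 g f\<close>, \<open>vcomp b a\<close> and
  \<open>hcomp b a\<close> apply their second argument first.\<close>

locale two_category =
  fixes K :: "('c0, 'c1, 'c2) two_category"
  assumes src1_closed: "f \<in> cells1 K \<Longrightarrow> src1 K f \<in> cells0 K"
    and tgt1_closed: "f \<in> cells1 K \<Longrightarrow> tgt1 K f \<in> cells0 K"
    and id1: "A \<in> cells0 K \<Longrightarrow>
      id1 K A \<in> cells1 K \<and> src1 K (id1 K A) = A \<and> tgt1 K (id1 K A) = A"
    and comp1: "\<lbrakk>f \<in> cells1 K; g \<in> cells1 K; src1 K g = tgt1 K f\<rbrakk> \<Longrightarrow>
      comp1 K g f \<in> cells1 K \<and> src1 K (comp1 K g f) = src1 K f \<and> tgt1 K (comp1 K g f) = tgt1 K g"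
    and comp1_assoc: "\<lbrakk>f \<in> cells1 K; g \<in> cells1 K; h \<in> cells1 K;
      src1 K g = tgt1 K f; src1 K h = tgt1 K g\<rbrakk> \<Longrightarrow>
      comp1 K h (comp1 K g f) = comp1 K (comp1 K h g) f"
    and comp1_id_left: "f \<in> cells1 K \<Longrightarrow> comp1 K (id1 K (tgt1 K f)) f = f"
    and comp1_id_right: "f \<in> cells1 K \<Longrightarrow> comp1 K f (id1 K (src1 K f)) = f"
    and src2_closed: "a \<in> cells2 K \<Longrightarrow> src2 K a \<in> cells1 K"
    and tgt2_closed: "a \<in> cells2 K \<Longrightarrow> tgt2 K a \<in> cells1 K"
    and globular: "a \<in> cells2 K \<Longrightarrow>
      src1 K (src2 K a) = src1 K (tgt2 K a) \<and> tgt1 K (src2 K a) = tgt1 K (tgt2 K a)"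
    and id2: "f \<in> cells1 K \<Longrightarrow>
      id2 K f \<in> cells2 K \<and> src2 K (id2 K f) = f \<and> tgt2 K (id2 K f) = f"
    and vcomp: "\<lbrakk>a \<in> cells2 K; b \<in> cells2 K; src2 K b = tgt2 K a\<rbrakk> \<Longrightarrow>
      vcomp K b a \<in> cells2 K \<and> src2 K (vcomp K b a) = src2 K a \<and> tgt2 K (vcomp K b a) = tgt2 K b"
    and vcomp_assoc: "\<lbrakk>a \<in> cells2 K; b \<in> cells2 K; c \<in> cells2 K;
      src2 K b = tgt2 K a; src2 K c = tgt2 K b\<rbrakk> \<Longrightarrow>
      vcomp K c (vcomp K b a) = vcomp K (vcomp K c b) a"
    and vcomp_id_left: "a \<in> cells2 K \<Longrightarrow> vcomp K (id2 K (tgt2 K a)) a = a"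
    and vcomp_id_right: "a \<in> cells2 K \<Longrightarrow> vcomp K a (id2 K (src2 K a)) = a"
    and hcomp: "\<lbrakk>a \<in> cells2 K; b \<in> cells2 K; src1 K (src2 K b) = tgt1 K (src2 K a)\<rbrakk> \<Longrightarrow>
      hcomp K b a \<in> cells2 K
      \<and> src2 K (hcomp K b a) = comp1 K (src2 K b) (src2 K a)
      \<and> tgt2 K (hcomp K b a) = comp1 K (tgt2 K b) (tgt2 K a)"
    and hcomp_assoc: "\<lbrakk>a \<in> cells2 K; b \<in> cells2 K; c \<in> cells2 K;
      src1 K (src2 K b) = tgt1 K (src2 K a); src1 K (src2 K c) = tgt1 K (src2 K b)\<rbrakk> \<Longrightarrow>
      hcomp K c (hcomp K b a) = hcomp K (hcomp K c b) a"
    and hcomp_id_left: "a \<in> cells2 K \<Longrightarrow> hcomp K (id2 K (id1 K (tgt1 K (src2 K a)))) a = a"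
    and hcomp_id_right: "a \<in> cells2 K \<Longrightarrow> hcomp K a (id2 K (id1 K (src1 K (src2 K a)))) = a"
    and hcomp_id2: "\<lbrakk>f \<in> cells1 K; g \<in> cells1 K; src1 K g = tgt1 K f\<rbrakk> \<Longrightarrow>
      hcomp K (id2 K g) (id2 K f) = id2 K (comp1 K g f)"
    and interchange: "\<lbrakk>a \<in> cells2 K; a' \<in> cells2 K; b \<in> cells2 K; b' \<in> cells2 K;
      src2 K a' = tgt2 K a; src2 K b' = tgt2 K b; src1 K (src2 K b) = tgt1 K (src2 K a)\<rbrakk> \<Longrightarrow>
      hcomp K (vcomp K b' b) (vcomp K a' a) = vcomp K (hcomp K b' a') (hcomp K b a)"

definition invertible_2cell :: "('c0, 'c1, 'c2) two_category \<Rightarrow> 'c2 \<Rightarrow> bool" where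
  "invertible_2cell K a \<longleftrightarrow> a \<in> cells2 K \<and>
    (\<exists>b\<in>cells2 K. src2 K b = tgt2 K a \<and> tgt2 K b = src2 K a \<and>
      vcomp K b a = id2 K (src2 K a) \<and> vcomp K a b = id2 K (tgt2 K a))"

definition equivalence_1cell :: "('c0, 'c1, 'c2) two_category \<Rightarrow> 'c1 \<Rightarrow> bool" where
  "equivalence_1cell K f \<longleftrightarrow> f \<in> cells1 K \<and>
    (\<exists>g\<in>cells1 K. src1 K g = tgt1 K f \<and> tgt1 K g = src1 K f \<and>
      (\<exists>a. invertible_2cell K a \<and> src2 K a = comp1 K g f \<and> tgt2 K a = id1 K (src1 K f)) \<and>
      (\<exists>b. invertible_2cell K b \<and> src2 K b = comp1 K f g \<and> tgt2 K b = id1 K (tgt1 K f)))"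

record ('c0, 'c1, 'c2, 'd0, 'd1, 'd2) two_functor =
  on0 :: "'c0 \<Rightarrow> 'd0"
  on1 :: "'c1 \<Rightarrow> 'd1"
  on2 :: "'c2 \<Rightarrow> 'd2"

locale two_functor = K: two_category K + L: two_category L
  for K :: "('c0, 'c1, 'c2) two_category" and L :: "('d0, 'd1, 'd2) two_category" +
  fixes F :: "('c0, 'c1, 'c2, 'd0, 'd1, 'd2) two_functor"
  assumes on0: "A \<in> cells0 K \<Longrightarrow> on0 F A \<in> cells0 L"
    and on1: "f \<in> cells1 K \<Longrightarrow> on1 F f \<in> cells1 L
      \<and> src1 L (on1 F f) = on0 F (src1 K f) \<and> tgt1 L (on1 F f) = on0 F (tgt1 K f)"
    and on2: "a \<in> cells2 K \<Longrightarrow> on2 F a \<in> cells2 L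
      \<and> src2 L (on2 F a) = on1 F (src2 K a) \<and> tgt2 L (on2 F a) = on1 F (tgt2 K a)"
    and on_id1: "A \<in> cells0 K \<Longrightarrow> on1 F (id1 K A) = id1 L (on0 F A)"
    and on_comp1: "\<lbrakk>f \<in> cells1 K; g \<in> cells1 K; src1 K g = tgt1 K f\<rbrakk> \<Longrightarrow>
      on1 F (comp1 K g f) = comp1 L (on1 F g) (on1 F f)"
    and on_id2: "f \<in> cells1 K \<Longrightarrow> on2 F (id2 K f) = id2 L (on1 F f)"
    and on_vcomp: "\<lbrakk>a \<in> cells2 K; b \<in> cells2 K; src2 K b = tgt2 K a\<rbrakk> \<Longrightarrow>
      on2 F (vcomp K b a) = vcomp L (on2 F b) (on2 F a)"
    and on_hcomp: "\<lbrakk>a \<in> cells2 K; b \<in> cells2 K; src1 K (src2 K b) = tgt1 K (src2 K a)\<rbrakk> \<Longrightarrow>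
      on2 F (hcomp K b a) = hcomp L (on2 F b) (on2 F a)"

definition id_two_functor :: "('c0, 'c1, 'c2, 'c0, 'c1, 'c2) two_functor" where
  "id_two_functor = \<lparr>on0 = id, on1 = id, on2 = id\<rparr>"

definition comp_two_functor ::
  "('d0, 'd1, 'd2, 'e0, 'e1, 'e2) two_functor \<Rightarrow> ('c0, 'c1, 'c2, 'd0, 'd1, 'd2) two_functor \<Rightarrow>
   ('c0, 'c1, 'c2, 'e0, 'e1, 'e2) two_functor" where
  "comp_two_functor G F = \<lparr>on0 = on0 G \<circ> on0 F, on1 = on1 G \<circ> on1 F, on2 = on2 G \<circ> on2 F\<rparr>"

locale two_natural_transformation = F: two_functor K L F + G: two_functor K L G
  for K :: "('c0, 'c1, 'c2) two_category" and L :: "('d0, 'd1, 'd2) two_category"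
    and F :: "('c0, 'c1, 'c2, 'd0, 'd1, 'd2) two_functor"
    and G :: "('c0, 'c1, 'c2, 'd0, 'd1, 'd2) two_functor" +
  fixes t :: "'c0 \<Rightarrow> 'd1"
  assumes component: "A \<in> cells0 K \<Longrightarrow>
      t A \<in> cells1 L \<and> src1 L (t A) = on0 F A \<and> tgt1 L (t A) = on0 G A"
    and natural1: "f \<in> cells1 K \<Longrightarrow>
      comp1 L (t (tgt1 K f)) (on1 F f) = comp1 L (on1 G f) (t (src1 K f))"
    and natural2: "a \<in> cells2 K \<Longrightarrow>
      hcomp L (id2 L (t (tgt1 K (src2 K a)))) (on2 F a)
        = hcomp L (on2 G a) (id2 L (t (src1 K (src2 K a))))"

record ('c0, 'c1, 'c2) two_monad =
  endo :: "('c0, 'c1, 'c2, 'c0, 'c1, 'c2) two_functor"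
  mult :: "'c0 \<Rightarrow> 'c1"
  unit :: "'c0 \<Rightarrow> 'c1"

locale two_monad =
  endo: two_functor K K "endo M" +
  mult: two_natural_transformation K K "comp_two_functor (endo M) (endo M)" "endo M" "mult M" +
  unit: two_natural_transformation K K id_two_functor "endo M" "unit M"
  for K :: "('c0, 'c1, 'c2) two_category" and M :: "('c0, 'c1, 'c2) two_monad" +
  assumes mult_assoc: "A \<in> cells0 K \<Longrightarrow>
      comp1 K (mult M A) (on1 (endo M) (mult M A)) = comp1 K (mult M A) (mult M (on0 (endo M) A))"
    and mult_unit_left: "A \<in> cells0 K \<Longrightarrow>
      comp1 K (mult M A) (unit M (on0 (endo M) A)) = id1 K (on0 (endo M) A)"
    and mult_unit_right: "A \<in> cells0 K \<Longrightarrow>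
      comp1 K (mult M A) (on1 (endo M) (unit M A)) = id1 K (on0 (endo M) A)"

locale pseudo_idempotent_two_monad = two_monad +
  assumes mult_equivalence: "A \<in> cells0 K \<Longrightarrow> equivalence_1cell K (mult M A)"


section \<open>Categories with binary products\<close>

record ('o, 'a) category =
  Ob :: "'o set"
  Arr :: "'a set"
  Dom :: "'a \<Rightarrow> 'o"
  Cod :: "'a \<Rightarrow> 'o"
  Ident :: "'o \<Rightarrow> 'a"
  Comp :: "'a \<Rightarrow> 'a \<Rightarrow> 'a"  (infixr \<open>\<cdot>\<index>\<close> 75)

definition Hom :: "('o, 'a, 'm) category_scheme \<Rightarrow> 'o \<Rightarrow> 'o \<Rightarrow> 'a set" where
  "Hom C A B = {f \<in> Arr C. Dom C f = A \<and> Cod C f = B}"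

locale category =
  fixes C :: "('o, 'a, 'm) category_scheme" (structure)
  assumes dom_closed: "f \<in> Arr C \<Longrightarrow> Dom C f \<in> Ob C"
    and cod_closed: "f \<in> Arr C \<Longrightarrow> Cod C f \<in> Ob C"
    and ident_in_hom: "A \<in> Ob C \<Longrightarrow> Ident C A \<in> Hom C A A"
    and comp_in_hom: "\<lbrakk>f \<in> Hom C A B; g \<in> Hom C B D\<rbrakk> \<Longrightarrow> g \<cdot> f \<in> Hom C A D"
    and comp_assoc: "\<lbrakk>f \<in> Hom C A B; g \<in> Hom C B D; h \<in> Hom C D E\<rbrakk> \<Longrightarrow> h \<cdot> (g \<cdot> f) = (h \<cdot> g) \<cdot> f"
    and ident_left: "f \<in> Hom C A B \<Longrightarrow> Ident C B \<cdot> f = f"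
    and ident_right: "f \<in> Hom C A B \<Longrightarrow> f \<cdot> Ident C A = f"

definition is_product ::
  "('o, 'a, 'm) category_scheme \<Rightarrow> 'o \<Rightarrow> 'o \<Rightarrow> 'o \<Rightarrow> 'a \<Rightarrow> 'a \<Rightarrow> bool" where
  "is_product C A B Z p q \<longleftrightarrow> Z \<in> Ob C \<and> p \<in> Hom C Z A \<and> q \<in> Hom C Z B \<and>
    (\<forall>X\<in>Ob C. \<forall>f\<in>Hom C X A. \<forall>g\<in>Hom C X B.
      \<exists>!h. h \<in> Hom C X Z \<and> p \<cdot>\<^bsub>C\<^esub> h = f \<and> q \<cdot>\<^bsub>C\<^esub> h = g)"

text \<open>A category with binary products carries a choice of products; the choice only fixes what
  \<open>A \<times> B\<close> denotes, and functors are not required to preserve it.\<close>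

record ('o, 'a) product_category = "('o, 'a) category" +
  Prod :: "'o \<Rightarrow> 'o \<Rightarrow> 'o"
  Pr1 :: "'o \<Rightarrow> 'o \<Rightarrow> 'a"
  Pr2 :: "'o \<Rightarrow> 'o \<Rightarrow> 'a"

locale product_category = category C
  for C :: "('o, 'a, 'm) product_category_scheme" (structure) +
  assumes products: "\<lbrakk>A \<in> Ob C; B \<in> Ob C\<rbrakk> \<Longrightarrow> is_product C A B (Prod C A B) (Pr1 C A B) (Pr2 C A B)"

definition pairing :: "('o, 'a, 'm) product_category_scheme \<Rightarrow> 'a \<Rightarrow> 'a \<Rightarrow> 'a" where
  "pairing C f g = (THE h. h \<in> Hom C (Dom C f) (Prod C (Cod C f) (Cod C g))
    \<and> Pr1 C (Cod C f) (Cod C g) \<cdot>\<^bsub>C\<^esub> h = f \<and> Pr2 C (Cod C f) (Cod C g) \<cdot>\<^bsub>C\<^esub> h = g)"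

definition prod_arr :: "('o, 'a, 'm) product_category_scheme \<Rightarrow> 'a \<Rightarrow> 'a \<Rightarrow> 'a" where
  "prod_arr C f g =
    pairing C (f \<cdot>\<^bsub>C\<^esub> Pr1 C (Dom C f) (Dom C g)) (g \<cdot>\<^bsub>C\<^esub> Pr2 C (Dom C f) (Dom C g))"


section \<open>Elementary doctrines\<close>

locale finite_meet_poset = partial_order L for L (structure) +
  assumes finite_meets: "\<lbrakk>finite S; S \<subseteq> carrier L\<rbrakk> \<Longrightarrow> \<exists>m. greatest L m (Lower L S)"

definition finite_meet_hom :: "'e gorder \<Rightarrow> 'f gorder \<Rightarrow> ('e \<Rightarrow> 'f) \<Rightarrow> bool" where
  "finite_meet_hom L M h \<longleftrightarrow> h \<in> carrier L \<rightarrow> carrier M \<and>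
    (\<forall>S. finite S \<and> S \<subseteq> carrier L \<longrightarrow> h (\<Sqinter>\<^bsub>L\<^esub>S) = \<Sqinter>\<^bsub>M\<^esub>(h ` S))"

text \<open>\<open>Fib P A\<close> is the poset \<open>P(A)\<close>, and \<open>Reidx P f\<close> is \<open>P\<^sub>f\<close>, from \<open>P(Cod f)\<close> to \<open>P(Dom f)\<close>.\<close>

record ('o, 'a, 'e) doctrine = "('o, 'a) product_category" +
  Fib :: "'o \<Rightarrow> 'e gorder"
  Reidx :: "'a \<Rightarrow> 'e \<Rightarrow> 'e"

locale doctrine = product_category P
  for P :: "('o, 'a, 'e) doctrine" (structure) +
  assumes fib: "A \<in> Ob P \<Longrightarrow> finite_meet_poset (Fib P A)"
    and reidx_hom: "f \<in> Hom P A B \<Longrightarrow> finite_meet_hom (Fib P B) (Fib P A) (Reidx P f)"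
    and reidx_ident: "\<lbrakk>A \<in> Ob P; x \<in> carrier (Fib P A)\<rbrakk> \<Longrightarrow> Reidx P (Ident P A) x = x"
    and reidx_comp: "\<lbrakk>f \<in> Hom P A B; g \<in> Hom P B D; x \<in> carrier (Fib P D)\<rbrakk> \<Longrightarrow>
      Reidx P (g \<cdot> f) x = Reidx P f (Reidx P g x)"

definition left_adjoint :: "'e gorder \<Rightarrow> 'f gorder \<Rightarrow> ('e \<Rightarrow> 'f) \<Rightarrow> ('f \<Rightarrow> 'e) \<Rightarrow> bool" where
  "left_adjoint L M l u \<longleftrightarrow>
    galois_connection \<lparr>orderA = L, orderB = M, lower = l, upper = u\<rparr>"

text \<open>The triple product \<open>X \<times> A \<times> A\<close> is read as \<open>(X \<times> A) \<times> A\<close>, with projections \<open>p1\<close>, \<open>p2\<close>, \<open>p3\<close>.\<close>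

definition is_equality :: "('o, 'a, 'e) doctrine \<Rightarrow> 'o \<Rightarrow> 'e \<Rightarrow> bool" where
  "is_equality P A d \<longleftrightarrow> d \<in> carrier (Fib P (Prod P A A)) \<and>
    left_adjoint (Fib P A) (Fib P (Prod P A A))
      (\<lambda>x. Reidx P (Pr1 P A A) x \<sqinter>\<^bsub>Fib P (Prod P A A)\<^esub> d)
      (Reidx P (pairing P (Ident P A) (Ident P A))) \<and>
    (\<forall>X\<in>Ob P.
      let XA = Prod P X A; XAA = Prod P XA A;
          p1 = Pr1 P X A \<cdot>\<^bsub>P\<^esub> Pr1 P XA A; p2 = Pr2 P X A \<cdot>\<^bsub>P\<^esub> Pr1 P XA A; p3 = Pr2 P XA A;
          e = pairing P (pairing P (Pr1 P X A) (Pr2 P X A)) (Pr2 P X A)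
      in left_adjoint (Fib P XA) (Fib P XAA)
          (\<lambda>x. Reidx P (pairing P p1 p2) x \<sqinter>\<^bsub>Fib P XAA\<^esub> Reidx P (pairing P p2 p3) d)
          (Reidx P e))"

locale elementary_doctrine = doctrine +
  assumes equality_exists: "A \<in> Ob P \<Longrightarrow> \<exists>d. is_equality P A d"

text \<open>The first adjunction already determines \<open>\<delta>\<^sub>A\<close>, as the image of the top element of \<open>P(A)\<close>.\<close>

definition delta :: "('o, 'a, 'e) doctrine \<Rightarrow> 'o \<Rightarrow> 'e" where
  "delta P A = (THE d. is_equality P A d)"


section \<open>The 2-category of elementary doctrines\<close>

text \<open>1-cells and 2-cells record their source and target, and their component functions are
  extensional, so that HOL equality of cells is the intended equality.\<close>

record ('o, 'a, 'e) doctrine_map =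
  Src :: "('o, 'a, 'e) doctrine"
  Tgt :: "('o, 'a, 'e) doctrine"
  FOb :: "'o \<Rightarrow> 'o"
  FArr :: "'a \<Rightarrow> 'a"
  FEl :: "'o \<Rightarrow> 'e \<Rightarrow> 'e"

locale elementary_doctrine_map =
  fixes F :: "('o, 'a, 'e) doctrine_map"
  fixes P R
  defines "P \<equiv> Src F" and "R \<equiv> Tgt F"
  assumes src: "elementary_doctrine P"
    and tgt: "elementary_doctrine R"
    and ob: "FOb F \<in> Ob P \<rightarrow>\<^sub>E Ob R"
    and arr_ext: "FArr F \<in> extensional (Arr P)"
    and arr: "f \<in> Hom P A B \<Longrightarrow> FArr F f \<in> Hom R (FOb F A) (FOb F B)"
    and arr_ident: "A \<in> Ob P \<Longrightarrow> FArr F (Ident P A) = Ident R (FOb F A)"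
    and arr_comp: "\<lbrakk>f \<in> Hom P A B; g \<in> Hom P B D\<rbrakk> \<Longrightarrow>
      FArr F (g \<cdot>\<^bsub>P\<^esub> f) = FArr F g \<cdot>\<^bsub>R\<^esub> FArr F f"
    and preserves_products: "\<lbrakk>A \<in> Ob P; B \<in> Ob P; is_product P A B Z p q\<rbrakk> \<Longrightarrow>
      is_product R (FOb F A) (FOb F B) (FOb F Z) (FArr F p) (FArr F q)"
    and el_ext: "FEl F \<in> extensional (Ob P)"
    and el_ext_fib: "A \<in> Ob P \<Longrightarrow> FEl F A \<in> extensional (carrier (Fib P A))"
    and el_hom: "A \<in> Ob P \<Longrightarrow> finite_meet_hom (Fib P A) (Fib R (FOb F A)) (FEl F A)"
    and el_natural: "\<lbrakk>f \<in> Hom P A B; x \<in> carrier (Fib P B)\<rbrakk> \<Longrightarrow>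
      FEl F A (Reidx P f x) = Reidx R (FArr F f) (FEl F B x)"
    and el_delta: "A \<in> Ob P \<Longrightarrow> FEl F (Prod P A A) (delta P A)
      = Reidx R (pairing R (FArr F (Pr1 P A A)) (FArr F (Pr2 P A A))) (delta R (FOb F A))"

record ('o, 'a, 'e) doctrine_transf =
  Src2 :: "('o, 'a, 'e) doctrine_map"
  Tgt2 :: "('o, 'a, 'e) doctrine_map"
  Cpt :: "'o \<Rightarrow> 'a"

locale elementary_doctrine_transf =
  fixes t :: "('o, 'a, 'e) doctrine_transf"
  fixes F G P R
  defines "F \<equiv> Src2 t" and "G \<equiv> Tgt2 t" and "P \<equiv> Src F" and "R \<equiv> Tgt F"
  assumes src2: "elementary_doctrine_map F"
    and tgt2: "elementary_doctrine_map G"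
    and parallel: "Src G = P" "Tgt G = R"
    and cpt_ext: "Cpt t \<in> extensional (Ob P)"
    and cpt: "A \<in> Ob P \<Longrightarrow> Cpt t A \<in> Hom R (FOb F A) (FOb G A)"
    and natural: "f \<in> Hom P A B \<Longrightarrow> Cpt t B \<cdot>\<^bsub>R\<^esub> FArr F f = FArr G f \<cdot>\<^bsub>R\<^esub> Cpt t A"
    and el_le: "\<lbrakk>A \<in> Ob P; x \<in> carrier (Fib P A)\<rbrakk> \<Longrightarrow>
      FEl F A x \<sqsubseteq>\<^bsub>Fib R (FOb F A)\<^esub> Reidx R (Cpt t A) (FEl G A x)"

definition id_map :: "('o, 'a, 'e) doctrine \<Rightarrow> ('o, 'a, 'e) doctrine_map" where
  "id_map P = \<lparr>Src = P, Tgt = P, FOb = \<lambda>A\<in>Ob P. A, FArr = \<lambda>f\<in>Arr P. f,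
    FEl = \<lambda>A\<in>Ob P. \<lambda>x\<in>carrier (Fib P A). x\<rparr>"

definition comp_map ::
  "('o, 'a, 'e) doctrine_map \<Rightarrow> ('o, 'a, 'e) doctrine_map \<Rightarrow> ('o, 'a, 'e) doctrine_map" where
  "comp_map G F = \<lparr>Src = Src F, Tgt = Tgt G,
    FOb = \<lambda>A\<in>Ob (Src F). FOb G (FOb F A),
    FArr = \<lambda>f\<in>Arr (Src F). FArr G (FArr F f),
    FEl = \<lambda>A\<in>Ob (Src F). \<lambda>x\<in>carrier (Fib (Src F) A). FEl G (FOb F A) (FEl F A x)\<rparr>"

definition id_transf :: "('o, 'a, 'e) doctrine_map \<Rightarrow> ('o, 'a, 'e) doctrine_transf" where
  "id_transf F = \<lparr>Src2 = F, Tgt2 = F, Cpt = \<lambda>A\<in>Ob (Src F). Ident (Tgt F) (FOb F A)\<rparr>"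

definition vcomp_transf ::
  "('o, 'a, 'e) doctrine_transf \<Rightarrow> ('o, 'a, 'e) doctrine_transf \<Rightarrow> ('o, 'a, 'e) doctrine_transf" where
  "vcomp_transf s t = \<lparr>Src2 = Src2 t, Tgt2 = Tgt2 s,
    Cpt = \<lambda>A\<in>Ob (Src (Src2 t)). Cpt s A \<cdot>\<^bsub>Tgt (Src2 t)\<^esub> Cpt t A\<rparr>"

definition hcomp_transf ::
  "('o, 'a, 'e) doctrine_transf \<Rightarrow> ('o, 'a, 'e) doctrine_transf \<Rightarrow> ('o, 'a, 'e) doctrine_transf" where
  "hcomp_transf s t = \<lparr>Src2 = comp_map (Src2 s) (Src2 t), Tgt2 = comp_map (Tgt2 s) (Tgt2 t),
    Cpt = \<lambda>A\<in>Ob (Src (Src2 t)).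
      Cpt s (FOb (Tgt2 t) A) \<cdot>\<^bsub>Tgt (Src2 s)\<^esub> FArr (Src2 s) (Cpt t A)\<rparr>"

text \<open>
  The arrow type \<open>'a\<close> plays the part of the class of all sets: \<open>small\<close> singles out the subsets that
  are sets, and \<open>code\<close> turns a set of elements of \<open>'a\<close> into an element of \<open>'a\<close>. This is what makes
  equivalence classes of arrows available as arrows again, so that the extensional collapse stays
  inside a single 2-category. As usual, hom-collections are required to be sets.
\<close>

locale set_coding =
  fixes small :: "'a set \<Rightarrow> bool" and code :: "'a set \<Rightarrow> 'a"
  assumes small_subset: "\<lbrakk>small S; T \<subseteq> S\<rbrakk> \<Longrightarrow> small T"
    and small_image: "small S \<Longrightarrow> small (f ` S)"
    and code_inj: "inj_on code {S. small S}"

definition locally_small :: "('a set \<Rightarrow> bool) \<Rightarrow> ('o, 'a, 'm) category_scheme \<Rightarrow> bool" where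
  "locally_small small C \<longleftrightarrow> (\<forall>A\<in>Ob C. \<forall>B\<in>Ob C. small (Hom C A B))"

text \<open>
  Such codings exist with arbitrarily large sets counted as small: over every infinite type \<open>'k\<close>,
  the type \<open>'k set\<close> has one for which all families indexed by \<open>'k\<close> are small. Hence every doctrine,
  whatever its types, is covered up to renaming its arrows.
\<close>

lemma set_coding_exists:
  assumes inf: "infinite (UNIV :: 'k set)"
  shows "\<exists>code. set_coding (\<lambda>S :: 'k set set. \<exists>g :: 'k \<Rightarrow> 'k set. S \<subseteq> range g) code"
proof -
  let ?small = "\<lambda>S :: 'k set set. \<exists>g :: 'k \<Rightarrow> 'k set. S \<subseteq> range g"
  obtain p :: "'k \<times> 'k \<Rightarrow> 'k" where p: "inj p"
    using card_of_Times_same_infinite[OF inf, folded card_of_ordIso]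
    by (auto simp: bij_betw_def)
  obtain n :: "nat \<Rightarrow> 'k" where n: "inj n"
    using infinite_countable_subset[OF inf] by auto
  define q where "q = (\<lambda>x. p (n 1, p x))"
  define z where "z = p (n 0, n 0)"
  have q: "inj q" and z: "z \<notin> range q"
    using inj_eq[OF p] inj_eq[OF n] by (auto simp: q_def z_def intro!: injI)
  define G where "G S = (SOME g :: 'k \<Rightarrow> 'k set. S = range g)" for S
  have G: "range (G S) = S" if small: "?small S" and nonempty: "S \<noteq> {}" for S
  proof -
    obtain g :: "'k \<Rightarrow> 'k set" where g: "S \<subseteq> range g"
      using small by (rule exE)
    obtain x where x: "x \<in> S" using nonempty by blast
    define h where "h = (\<lambda>i. if g i \<in> S then g i else x)"
    have "S = range h"
    proof (intro equalityI subsetI)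
      fix y assume y: "y \<in> S"
      then obtain i where "y = g i" using g by blast
      with y show "y \<in> range h" unfolding h_def by force
    qed (use x in \<open>auto simp: h_def split: if_splits\<close>)
    then have "\<exists>h :: 'k \<Rightarrow> 'k set. S = range h" by (rule exI[of _ h])
    then have "S = range (G S)" unfolding G_def by (rule someI_ex)
    then show ?thesis by (rule sym)
  qed
  define code where "code S = (if S = {} then {} else insert z (q ` {(i, x). x \<in> G S i}))" for S
  have "S = T" if "?small S" "?small T" "code S = code T" for S T
  proof (cases "S = {} \<or> T = {}")
    case True
    then show ?thesis using that(3) by (auto simp: code_def split: if_splits)
  next
    case False
    then have "q ` {(i, x). x \<in> G S i} = q ` {(i, x). x \<in> G T i}"
      using that(3) insert_ident[of z "q ` {(i, x). x \<in> G S i}" "q ` {(i, x). x \<in> G T i}"] z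
      by (auto simp: code_def)
    then have "{(i, x). x \<in> G S i} = {(i, x). x \<in> G T i}"
      using q by (simp add: inj_image_eq_iff)
    then have "G S = G T" by (auto simp: fun_eq_iff set_eq_iff)
    then have "range (G S) = range (G T)" by (rule arg_cong)
    moreover have "range (G S) = S" "range (G T) = T"
      using G[OF that(1)] G[OF that(2)] False by simp_all
    ultimately show ?thesis by (simp only:)
  qed
  then have "inj_on code {S. ?small S}"
    by (intro inj_onI) (simp only: mem_Collect_eq)
  moreover have "?small (f ` S)" if small: "?small S" for f S
  proof -
    obtain g :: "'k \<Rightarrow> 'k set" where "S \<subseteq> range g" using small by (rule exE)
    then have "f ` S \<subseteq> range (f \<circ> g)" by auto
    then show ?thesis by (rule exI[of _ "f \<circ> g"])
  qed
  ultimately have "set_coding ?small code"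
    by unfold_locales (meson subset_trans)
  then show ?thesis by (rule exI[of _ code])
qed

definition ED :: "('a set \<Rightarrow> bool) \<Rightarrow>
    (('o, 'a, 'e) doctrine, ('o, 'a, 'e) doctrine_map, ('o, 'a, 'e) doctrine_transf) two_category" where
  "ED small =
   (let ob = {P. elementary_doctrine P \<and> locally_small small P};
        mor = {F. elementary_doctrine_map F \<and> Src F \<in> ob \<and> Tgt F \<in> ob}
    in \<lparr>cells0 = ob, cells1 = mor,
        cells2 = {t. elementary_doctrine_transf t \<and> Src2 t \<in> mor \<and> Tgt2 t \<in> mor},
        src1 = Src, tgt1 = Tgt, src2 = Src2, tgt2 = Tgt2,
        id1 = id_map, comp1 = comp_map,
        id2 = id_transf, vcomp = vcomp_transf, hcomp = hcomp_transf\<rparr>)"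


section \<open>The comprehensive diagonal completion\<close>

text \<open>\<open>ext_eq P f f'\<close> is \<open>f \<sim> f'\<close>; the arrows of the extensional collapse are the classes of the
  arrows \<open>f\<close> with \<open>f \<sim> f\<close>.\<close>

definition ext_eq :: "('o, 'a, 'e) doctrine \<Rightarrow> 'a \<Rightarrow> 'a \<Rightarrow> bool" where
  "ext_eq P f f' \<longleftrightarrow> f \<in> Arr P \<and> f' \<in> Arr P \<and> Dom P f = Dom P f' \<and> Cod P f = Cod P f' \<and>
    delta P (Dom P f) \<sqsubseteq>\<^bsub>Fib P (Prod P (Dom P f) (Dom P f))\<^esub>
      Reidx P (prod_arr P f f') (delta P (Cod P f))"

definition ext_class :: "('a set \<Rightarrow> 'a) \<Rightarrow> ('o, 'a, 'e) doctrine \<Rightarrow> 'a \<Rightarrow> 'a" where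
  "ext_class code P f = code {f'. ext_eq P f' f' \<and> ext_eq P f f'}"

definition ext_arrows :: "('a set \<Rightarrow> 'a) \<Rightarrow> ('o, 'a, 'e) doctrine \<Rightarrow> 'a set" where
  "ext_arrows code P = ext_class code P ` {f. ext_eq P f f}"

definition ext_rep :: "('a set \<Rightarrow> 'a) \<Rightarrow> ('o, 'a, 'e) doctrine \<Rightarrow> 'a \<Rightarrow> 'a" where
  "ext_rep code P u = (SOME f. ext_eq P f f \<and> ext_class code P f = u)"

definition Td0 :: "('a set \<Rightarrow> 'a) \<Rightarrow> ('o, 'a, 'e) doctrine \<Rightarrow> ('o, 'a, 'e) doctrine" where
  "Td0 code P =
    \<lparr>Ob = Ob P,
     Arr = ext_arrows code P,
     Dom = \<lambda>u. Dom P (ext_rep code P u),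
     Cod = \<lambda>u. Cod P (ext_rep code P u),
     Ident = \<lambda>A. ext_class code P (Ident P A),
     Comp = \<lambda>v u. ext_class code P (ext_rep code P v \<cdot>\<^bsub>P\<^esub> ext_rep code P u),
     Prod = Prod P,
     Pr1 = \<lambda>A B. ext_class code P (Pr1 P A B),
     Pr2 = \<lambda>A B. ext_class code P (Pr2 P A B),
     Fib = Fib P,
     Reidx = \<lambda>u. Reidx P (ext_rep code P u)\<rparr>"

definition Td1 :: "('a set \<Rightarrow> 'a) \<Rightarrow> ('o, 'a, 'e) doctrine_map \<Rightarrow> ('o, 'a, 'e) doctrine_map" where
  "Td1 code F =
    \<lparr>Src = Td0 code (Src F), Tgt = Td0 code (Tgt F),
     FOb = FOb F,
     FArr = \<lambda>u\<in>ext_arrows code (Src F). ext_class code (Tgt F) (FArr F (ext_rep code (Src F) u)),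
     FEl = FEl F\<rparr>"

definition Td2 :: "('a set \<Rightarrow> 'a) \<Rightarrow> ('o, 'a, 'e) doctrine_transf \<Rightarrow> ('o, 'a, 'e) doctrine_transf" where
  "Td2 code t =
    \<lparr>Src2 = Td1 code (Src2 t), Tgt2 = Td1 code (Tgt2 t),
     Cpt = \<lambda>A\<in>Ob (Src (Src2 t)). ext_class code (Tgt (Src2 t)) (Cpt t A)\<rparr>"

definition Td_unit :: "('a set \<Rightarrow> 'a) \<Rightarrow> ('o, 'a, 'e) doctrine \<Rightarrow> ('o, 'a, 'e) doctrine_map" where
  "Td_unit code P =
    \<lparr>Src = P, Tgt = Td0 code P,
     FOb = \<lambda>A\<in>Ob P. A,
     FArr = \<lambda>f\<in>Arr P. ext_class code P f,
     FEl = \<lambda>A\<in>Ob P. \<lambda>x\<in>carrier (Fib P A). x\<rparr>"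

definition Td_mult :: "('a set \<Rightarrow> 'a) \<Rightarrow> ('o, 'a, 'e) doctrine \<Rightarrow> ('o, 'a, 'e) doctrine_map" where
  "Td_mult code P =
    \<lparr>Src = Td0 code (Td0 code P), Tgt = Td0 code P,
     FOb = \<lambda>A\<in>Ob P. A,
     FArr = \<lambda>u\<in>ext_arrows code (Td0 code P).
       ext_class code P (ext_rep code P (ext_rep code (Td0 code P) u)),
     FEl = \<lambda>A\<in>Ob P. \<lambda>x\<in>carrier (Fib P A). x\<rparr>"

definition Td :: "('a set \<Rightarrow> 'a) \<Rightarrow>
    (('o, 'a, 'e) doctrine, ('o, 'a, 'e) doctrine_map, ('o, 'a, 'e) doctrine_transf) two_monad" where
  "Td code = \<lparr>endo = \<lparr>on0 = Td0 code, on1 = Td1 code, on2 = Td2 code\<rparr>,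
    mult = Td_mult code, unit = Td_unit code\<rparr>"

end

theory Submission
  imports Defs
begin

text \<open>
  The collapse \<open>P\<^sub>x\<close> identifies two parallel arrows \<open>f\<close>, \<open>f'\<close> when \<open>\<delta>\<^sub>A \<le> P\<^bsub>f \<times> f'\<^esub>(\<delta>\<^sub>B)\<close>. As \<open>\<delta>\<^sub>A\<close> is the
  least predicate on \<open>A \<times> A\<close> that is true on the diagonal, this says that \<open>P\<^bsub>\<langle>f, f'\<rangle>\<^esub>(\<delta>\<^sub>B)\<close> is the top
  element of \<open>P(A)\<close>: the arrows are internally equal (\<open>ext_eq_iff\<close>). Every arrow is internally equal to
  itself, so the collapse is a quotient of the whole category.

  Idempotency comes from the fact that the collapse changes neither the fibres nor \<open>\<delta>\<close>. Internal
  equality in \<open>P\<^sub>x\<close> of the classes of \<open>f\<close> and \<open>f'\<close> is therefore internal equality of \<open>f\<close> and \<open>f'\<close> in \<open>P\<close>,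
  which is equality of the two classes (\<open>ext_eq_Td0_iff\<close>). A second collapse only replaces each
  arrow by its singleton class; the multiplication removes the singleton, the unit of \<open>P\<^sub>x\<close> puts it
  back, and the two are mutually inverse 1-cells (\<open>mult_unit_left\<close>, \<open>unit_mult\<close>). The multiplication
  is thus an isomorphism, in particular an equivalence.

  Most of the work is to see that all of this takes place in a 2-category. The essential point is
  the indiscernibility of internally equal arrows (\<open>leibniz\<close>), which follows from the second
  adjunction defining \<open>\<delta>\<close>. It makes internal equality a congruence for composition and pairing,
  makes reindexing along a class of arrows well defined, and shows that the products of \<open>P\<close> remain
  products after the collapse: an arrow into a product is determined, up to internal equality, by
  its components up to internal equality. Since 1-cells preserve \<open>\<delta>\<close> and top elements, they preserve
  internal equality and descend to the collapses (\<open>ext_eq_map\<close>); every further law of the 2-monad is an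
  equation between 1-cells or 2-cells that is checked on classes of arrows.
\<close>

section \<open>Binary products\<close>

lemma (in category) hom_arr:
  assumes "f \<in> Hom C A B"
  shows "f \<in> Arr C" "Dom C f = A" "Cod C f = B" "A \<in> Ob C" "B \<in> Ob C"
  using assms dom_closed cod_closed by (auto simp: Hom_def)

lemma (in category) arr_hom: "f \<in> Arr C \<Longrightarrow> f \<in> Hom C (Dom C f) (Cod C f)"
  by (simp add: Hom_def)

lemma is_productD:
  assumes "is_product C A B Z p q"
  shows "Z \<in> Ob C" "p \<in> Hom C Z A" "q \<in> Hom C Z B"
  using assms by (auto simp: is_product_def)

lemma is_product_lift:
  assumes "is_product C A B Z p q" "X \<in> Ob C" "f \<in> Hom C X A" "g \<in> Hom C X B"
  obtains h where "h \<in> Hom C X Z" "p \<cdot>\<^bsub>C\<^esub> h = f" "q \<cdot>\<^bsub>C\<^esub> h = g"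
  using assms unfolding is_product_def by (elim conjE) (drule (1) bspec, drule (1) bspec, drule (1) bspec, blast)

lemma (in category) is_product_joint_mono:
  assumes "is_product C A B Z p q" and h: "h \<in> Hom C X Z" and k: "k \<in> Hom C X Z"
    and "p \<cdot> h = p \<cdot> k" "q \<cdot> h = q \<cdot> k"
  shows "h = k"
proof -
  note pk = comp_in_hom[OF k is_productD(2)[OF assms(1)]]
    and qk = comp_in_hom[OF k is_productD(3)[OF assms(1)]]
  have "\<exists>!h. h \<in> Hom C X Z \<and> p \<cdot> h = p \<cdot> k \<and> q \<cdot> h = q \<cdot> k"
    using assms(1) hom_arr(4)[OF k] pk qk unfolding is_product_def by simp
  then obtain l where "\<And>h. h \<in> Hom C X Z \<Longrightarrow> p \<cdot> h = p \<cdot> k \<Longrightarrow> q \<cdot> h = q \<cdot> k \<Longrightarrow> h = l"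
    unfolding Ex1_def by auto
  from this[OF h assms(4,5)] this[OF k refl refl] show ?thesis by simp
qed

lemma (in category) is_product_unique_iso:
  assumes Z: "is_product C A B Z p q" and Z': "is_product C A B Z' p' q'"
  obtains i j where "i \<in> Hom C Z' Z" "j \<in> Hom C Z Z'" "p \<cdot> i = p'" "q \<cdot> i = q'"
    "i \<cdot> j = Ident C Z" "j \<cdot> i = Ident C Z'"
proof -
  note D = is_productD[OF Z] and D' = is_productD[OF Z']
  obtain i where i: "i \<in> Hom C Z' Z" "p \<cdot> i = p'" "q \<cdot> i = q'"
    using is_product_lift[OF Z D'] .
  obtain j where j: "j \<in> Hom C Z Z'" "p' \<cdot> j = p" "q' \<cdot> j = q"
    using is_product_lift[OF Z' D] .
  have "i \<cdot> j = Ident C Z"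
  proof (rule is_product_joint_mono[OF Z])
    show "i \<cdot> j \<in> Hom C Z Z" "Ident C Z \<in> Hom C Z Z"
      by (rule comp_in_hom[OF j(1) i(1)], rule ident_in_hom[OF D(1)])
    show "p \<cdot> (i \<cdot> j) = p \<cdot> Ident C Z" "q \<cdot> (i \<cdot> j) = q \<cdot> Ident C Z"
      using comp_assoc[OF j(1) i(1) D(2)] comp_assoc[OF j(1) i(1) D(3)] i j
        ident_right[OF D(2)] ident_right[OF D(3)] by simp_all
  qed
  moreover have "j \<cdot> i = Ident C Z'"
  proof (rule is_product_joint_mono[OF Z'])
    show "j \<cdot> i \<in> Hom C Z' Z'" "Ident C Z' \<in> Hom C Z' Z'"
      by (rule comp_in_hom[OF i(1) j(1)], rule ident_in_hom[OF D'(1)])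
    show "p' \<cdot> (j \<cdot> i) = p' \<cdot> Ident C Z'" "q' \<cdot> (j \<cdot> i) = q' \<cdot> Ident C Z'"
      using comp_assoc[OF i(1) j(1) D'(2)] comp_assoc[OF i(1) j(1) D'(3)] i j
        ident_right[OF D'(2)] ident_right[OF D'(3)] by simp_all
  qed
  ultimately show thesis by (rule that[OF i(1) j(1) i(2,3)])
qed

lemma (in category) is_product_precomp_iso:
  assumes Z: "is_product C A B Z p q"
    and i: "i \<in> Hom C Z' Z" and j: "j \<in> Hom C Z Z'"
    and ij: "i \<cdot> j = Ident C Z" and ji: "j \<cdot> i = Ident C Z'"
  shows "is_product C A B Z' (p \<cdot> i) (q \<cdot> i)"
  unfolding is_product_def
proof (intro conjI ballI)
  note D = is_productD[OF Z]
  show "Z' \<in> Ob C" by (rule hom_arr(4)[OF i])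
  show pi: "p \<cdot> i \<in> Hom C Z' A" and qi: "q \<cdot> i \<in> Hom C Z' B" by (rule comp_in_hom[OF i D(2)], rule comp_in_hom[OF i D(3)])
  fix X f g assume X: "X \<in> Ob C" and f: "f \<in> Hom C X A" and g: "g \<in> Hom C X B"
  obtain h where h: "h \<in> Hom C X Z" "p \<cdot> h = f" "q \<cdot> h = g"
    using is_product_lift[OF Z X f g] .
  have jh: "j \<cdot> h \<in> Hom C X Z'" by (rule comp_in_hom[OF h(1) j])
  have ijh: "i \<cdot> (j \<cdot> h) = h" using comp_assoc[OF h(1) j i] ij ident_left[OF h(1)] by simp
  show "\<exists>!h. h \<in> Hom C X Z' \<and> (p \<cdot> i) \<cdot> h = f \<and> (q \<cdot> i) \<cdot> h = g"
  proof (rule ex1I[of _ "j \<cdot> h"], intro conjI)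
    show "(p \<cdot> i) \<cdot> (j \<cdot> h) = f" "(q \<cdot> i) \<cdot> (j \<cdot> h) = g"
      using comp_assoc[OF jh i D(2)] comp_assoc[OF jh i D(3)] ijh h by simp_all
  next
    fix k assume k: "k \<in> Hom C X Z' \<and> (p \<cdot> i) \<cdot> k = f \<and> (q \<cdot> i) \<cdot> k = g"
    then have ik: "i \<cdot> k \<in> Hom C X Z" using comp_in_hom[OF _ i] by simp
    have "p \<cdot> (i \<cdot> k) = f" "q \<cdot> (i \<cdot> k) = g"
      using comp_assoc[of k X Z' i Z p A] comp_assoc[of k X Z' i Z q B] k i D by auto
    then have "i \<cdot> k = h" using is_product_joint_mono[OF Z ik h(1)] h by simp
    then have "j \<cdot> h = (j \<cdot> i) \<cdot> k" using comp_assoc[of k X Z' i Z j Z'] k i j by simp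
    then show "k = j \<cdot> h" using ji ident_left[of k X Z'] k by simp
  qed (rule jh)
qed

text \<open>A functor is asked to preserve every product cone, but all product cones over two objects
  are isomorphic to the chosen one, and functors preserve isomorphisms.\<close>

lemma preserves_products_if_preserves_chosen:
  assumes C: "product_category C" and D: "category D"
    and hom: "\<And>f A B. f \<in> Hom C A B \<Longrightarrow> Farr f \<in> Hom D (Fob A) (Fob B)"
    and ident: "\<And>A. A \<in> Ob C \<Longrightarrow> Farr (Ident C A) = Ident D (Fob A)"
    and comp: "\<And>f g A B E. f \<in> Hom C A B \<Longrightarrow> g \<in> Hom C B E \<Longrightarrow>
      Farr (g \<cdot>\<^bsub>C\<^esub> f) = Farr g \<cdot>\<^bsub>D\<^esub> Farr f"
    and chosen: "\<And>A B. A \<in> Ob C \<Longrightarrow> B \<in> Ob C \<Longrightarrow>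
      is_product D (Fob A) (Fob B) (Fob (Prod C A B)) (Farr (Pr1 C A B)) (Farr (Pr2 C A B))"
    and A: "A \<in> Ob C" and B: "B \<in> Ob C" and Z: "is_product C A B Z p q"
  shows "is_product D (Fob A) (Fob B) (Fob Z) (Farr p) (Farr q)"
proof -
  interpret C: product_category C by (rule C)
  interpret D: category D by (rule D)
  note prod = C.products[OF A B]
  obtain i j where ij: "i \<in> Hom C Z (Prod C A B)" "j \<in> Hom C (Prod C A B) Z"
      "Pr1 C A B \<cdot>\<^bsub>C\<^esub> i = p" "Pr2 C A B \<cdot>\<^bsub>C\<^esub> i = q"
      "i \<cdot>\<^bsub>C\<^esub> j = Ident C (Prod C A B)" "j \<cdot>\<^bsub>C\<^esub> i = Ident C Z"
    using C.is_product_unique_iso[OF prod Z] .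
  have "Farr i \<cdot>\<^bsub>D\<^esub> Farr j = Ident D (Fob (Prod C A B))" "Farr j \<cdot>\<^bsub>D\<^esub> Farr i = Ident D (Fob Z)"
    using ij comp[of i Z "Prod C A B" j Z] comp[of j "Prod C A B" Z i "Prod C A B"]
      ident is_productD(1)[OF prod] is_productD(1)[OF Z] by auto
  then have "is_product D (Fob A) (Fob B) (Fob Z)
      (Farr (Pr1 C A B) \<cdot>\<^bsub>D\<^esub> Farr i) (Farr (Pr2 C A B) \<cdot>\<^bsub>D\<^esub> Farr i)"
    by (intro D.is_product_precomp_iso[OF chosen[OF A B] hom[OF ij(1)] hom[OF ij(2)]])
  then show ?thesis
    using comp[OF ij(1) is_productD(2)[OF prod]] comp[OF ij(1) is_productD(3)[OF prod]] ij by simp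
qed

context product_category
begin

lemma prod_ob: "\<lbrakk>A \<in> Ob C; B \<in> Ob C\<rbrakk> \<Longrightarrow> Prod C A B \<in> Ob C"
  and pr1_hom: "\<lbrakk>A \<in> Ob C; B \<in> Ob C\<rbrakk> \<Longrightarrow> Pr1 C A B \<in> Hom C (Prod C A B) A"
  and pr2_hom: "\<lbrakk>A \<in> Ob C; B \<in> Ob C\<rbrakk> \<Longrightarrow> Pr2 C A B \<in> Hom C (Prod C A B) B"
  using is_productD[OF products] by auto

lemma pairing_props:
  assumes f: "f \<in> Hom C X A" and g: "g \<in> Hom C X B"
  shows "pairing C f g \<in> Hom C X (Prod C A B) \<and>
    Pr1 C A B \<cdot> pairing C f g = f \<and> Pr2 C A B \<cdot> pairing C f g = g"
proof -
  note * = hom_arr[OF f] hom_arr[OF g]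
  have "\<exists>!h. h \<in> Hom C X (Prod C A B) \<and> Pr1 C A B \<cdot> h = f \<and> Pr2 C A B \<cdot> h = g"
    using products[of A B] * f g unfolding is_product_def by simp
  from theI'[OF this] show ?thesis unfolding pairing_def using * by simp
qed

lemma pairing_hom: "\<lbrakk>f \<in> Hom C X A; g \<in> Hom C X B\<rbrakk> \<Longrightarrow> pairing C f g \<in> Hom C X (Prod C A B)"
  and pr1_pairing: "\<lbrakk>f \<in> Hom C X A; g \<in> Hom C X B\<rbrakk> \<Longrightarrow> Pr1 C A B \<cdot> pairing C f g = f"
  and pr2_pairing: "\<lbrakk>f \<in> Hom C X A; g \<in> Hom C X B\<rbrakk> \<Longrightarrow> Pr2 C A B \<cdot> pairing C f g = g"
  using pairing_props by simp_all

lemma pairing_eqI: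
  assumes "A \<in> Ob C" "B \<in> Ob C" "h \<in> Hom C X (Prod C A B)"
    and "Pr1 C A B \<cdot> h = f" "Pr2 C A B \<cdot> h = g"
  shows "pairing C f g = h"
proof -
  have fg: "f \<in> Hom C X A" "g \<in> Hom C X B"
    using comp_in_hom[OF assms(3) pr1_hom] comp_in_hom[OF assms(3) pr2_hom] assms by simp_all
  show ?thesis
    using is_product_joint_mono[OF products[OF assms(1,2)] pairing_hom[OF fg] assms(3)]
      pr1_pairing[OF fg] pr2_pairing[OF fg] assms by simp
qed

lemma pairing_comp:
  assumes f: "f \<in> Hom C X A" and g: "g \<in> Hom C X B" and k: "k \<in> Hom C Y X"
  shows "pairing C f g \<cdot> k = pairing C (f \<cdot> k) (g \<cdot> k)"
proof -
  note ob = hom_arr(5)[OF f] hom_arr(5)[OF g]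
  note fg = pairing_hom[OF f g]
  show ?thesis
    using pairing_eqI[OF ob comp_in_hom[OF k fg] refl refl]
      comp_assoc[OF k fg pr1_hom[OF ob]] comp_assoc[OF k fg pr2_hom[OF ob]]
      pr1_pairing[OF f g] pr2_pairing[OF f g] by simp
qed

lemma pr1_pairing_comp:
  assumes f: "f \<in> Hom C X A" and g: "g \<in> Hom C X B" and h: "h \<in> Hom C A D"
  shows "(h \<cdot> Pr1 C A B) \<cdot> pairing C f g = h \<cdot> f"
  using comp_assoc[OF pairing_hom[OF f g] pr1_hom h] pr1_pairing[OF f g] hom_arr[OF f] hom_arr[OF g] by simp

lemma pr2_pairing_comp:
  assumes f: "f \<in> Hom C X A" and g: "g \<in> Hom C X B" and h: "h \<in> Hom C B D"
  shows "(h \<cdot> Pr2 C A B) \<cdot> pairing C f g = h \<cdot> g"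
  using comp_assoc[OF pairing_hom[OF f g] pr2_hom h] pr2_pairing[OF f g] hom_arr[OF f] hom_arr[OF g] by simp

lemma pairing_pr: "\<lbrakk>A \<in> Ob C; B \<in> Ob C\<rbrakk> \<Longrightarrow> pairing C (Pr1 C A B) (Pr2 C A B) = Ident C (Prod C A B)"
  by (rule pairing_eqI[OF _ _ ident_in_hom[OF prod_ob]])
    (simp_all add: ident_right[OF pr1_hom] ident_right[OF pr2_hom])

lemma prod_arr_hom:
  assumes f: "f \<in> Hom C A B" and g: "g \<in> Hom C A' B'"
  shows "prod_arr C f g \<in> Hom C (Prod C A A') (Prod C B B')"
proof -
  have "f \<cdot> Pr1 C A A' \<in> Hom C (Prod C A A') B" "g \<cdot> Pr2 C A A' \<in> Hom C (Prod C A A') B'"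
    using comp_in_hom[OF pr1_hom f] comp_in_hom[OF pr2_hom g] hom_arr[OF f] hom_arr[OF g] by simp_all
  then show ?thesis using hom_arr[OF f] hom_arr[OF g] pairing_hom by (simp add: prod_arr_def)
qed

lemma prod_arr_pairing:
  assumes f: "f \<in> Hom C A B" and g: "g \<in> Hom C A' B'" and h: "h \<in> Hom C X A" and k: "k \<in> Hom C X A'"
  shows "prod_arr C f g \<cdot> pairing C h k = pairing C (f \<cdot> h) (g \<cdot> k)"
proof -
  have fg: "f \<cdot> Pr1 C A A' \<in> Hom C (Prod C A A') B" "g \<cdot> Pr2 C A A' \<in> Hom C (Prod C A A') B'"
    using comp_in_hom[OF pr1_hom f] comp_in_hom[OF pr2_hom g] hom_arr[OF f] hom_arr[OF g] by simp_all
  show ?thesis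
    using hom_arr[OF f] hom_arr[OF g] pairing_comp[OF fg pairing_hom[OF h k]]
      pr1_pairing_comp[OF h k f] pr2_pairing_comp[OF h k g] by (simp add: prod_arr_def)
qed

end

section \<open>Finite meets\<close>

context finite_meet_poset
begin

lemma inf_greatest:
  assumes "finite S" "S \<subseteq> carrier L"
  shows "greatest L (\<Sqinter>S) (Lower L S)"
  unfolding inf_def using finite_meets[OF assms] by (rule someI_ex)

lemma inf_closed: "\<lbrakk>finite S; S \<subseteq> carrier L\<rbrakk> \<Longrightarrow> \<Sqinter>S \<in> carrier L"
  using inf_greatest by blast

lemma inf_empty: "greatest L (\<Sqinter>{}) (carrier L)"
  using inf_greatest[of "{}"] by simp

lemma meet_closed: "\<lbrakk>x \<in> carrier L; y \<in> carrier L\<rbrakk> \<Longrightarrow> x \<sqinter> y \<in> carrier L"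
  unfolding meet_def by (rule inf_closed) auto

lemma le_meet_iff:
  assumes x: "x \<in> carrier L" and y: "y \<in> carrier L" and z: "z \<in> carrier L"
  shows "z \<sqsubseteq> x \<sqinter> y \<longleftrightarrow> z \<sqsubseteq> x \<and> z \<sqsubseteq> y"
proof -
  have g: "greatest L (x \<sqinter> y) (Lower L {x, y})"
    unfolding meet_def by (rule inf_greatest) (use x y in auto)
  note m = meet_closed[OF x y]
  have "x \<sqinter> y \<sqsubseteq> x" "x \<sqinter> y \<sqsubseteq> y" using greatest_Lower_below[OF g] x y by auto
  then have "z \<sqsubseteq> x" "z \<sqsubseteq> y" if "z \<sqsubseteq> x \<sqinter> y"
    using le_trans[OF that _ z m x] le_trans[OF that _ z m y] by auto
  moreover have "z \<sqsubseteq> x \<sqinter> y" if "z \<sqsubseteq> x" "z \<sqsubseteq> y"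
    using greatest_le[OF g] that z by (auto simp: Lower_def)
  ultimately show ?thesis by auto
qed

lemma greatest_unique:
  assumes "greatest L x (carrier L)" "greatest L y (carrier L)"
  shows "x = y"
  using assms by (intro le_antisym) (auto simp: greatest_def)

lemma top_le_iff:
  assumes t: "greatest L t (carrier L)" and x: "x \<in> carrier L"
  shows "t \<sqsubseteq> x \<longleftrightarrow> greatest L x (carrier L)"
proof
  assume tx: "t \<sqsubseteq> x"
  have "y \<sqsubseteq> x" if y: "y \<in> carrier L" for y
    by (rule le_trans[OF greatest_le[OF t y] tx y greatest_closed[OF t] x])
  then show "greatest L x (carrier L)" using x by (simp add: greatest_def)
qed (rule greatest_le[OF _ greatest_closed[OF t]])

lemma meet_eq_left_iff:
  assumes x: "x \<in> carrier L" and y: "y \<in> carrier L"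
  shows "x \<sqinter> y = x \<longleftrightarrow> x \<sqsubseteq> y"
proof -
  note m = meet_closed[OF x y]
  have "x \<sqinter> y \<sqsubseteq> x" using le_meet_iff[OF x y m] le_refl[OF m] by simp
  moreover have "x \<sqsubseteq> x \<sqinter> y \<longleftrightarrow> x \<sqsubseteq> y" using le_meet_iff[OF x y x] le_refl[OF x] by simp
  ultimately show ?thesis using le_antisym[OF _ _ m x] le_refl[OF x] by auto
qed

lemma meet_top_left:
  assumes "greatest L t (carrier L)" "y \<in> carrier L"
  shows "t \<sqinter> y = y"
proof -
  have t: "t \<in> carrier L" and yt: "y \<sqsubseteq> t" using assms by (auto simp: greatest_def)
  note m = meet_closed[OF t assms(2)]
  have "t \<sqinter> y \<sqsubseteq> y" using le_meet_iff[OF t assms(2) m] le_refl[OF m] by simp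
  moreover have "y \<sqsubseteq> t \<sqinter> y" using le_meet_iff[OF t assms(2) assms(2)] yt le_refl[OF assms(2)] by simp
  ultimately show ?thesis using le_antisym m assms(2) by simp
qed

end

lemma finite_meet_hom_closed: "\<lbrakk>finite_meet_hom L M h; x \<in> carrier L\<rbrakk> \<Longrightarrow> h x \<in> carrier M"
  by (auto simp: finite_meet_hom_def)

lemma finite_meet_hom_inf:
  "\<lbrakk>finite_meet_hom L M h; finite S; S \<subseteq> carrier L\<rbrakk> \<Longrightarrow> h (\<Sqinter>\<^bsub>L\<^esub>S) = \<Sqinter>\<^bsub>M\<^esub>(h ` S)"
  by (simp add: finite_meet_hom_def)

lemma finite_meet_hom_meet:
  assumes "finite_meet_hom L M h" "x \<in> carrier L" "y \<in> carrier L"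
  shows "h (x \<sqinter>\<^bsub>L\<^esub> y) = h x \<sqinter>\<^bsub>M\<^esub> h y"
proof -
  show ?thesis using finite_meet_hom_inf[OF assms(1), of "{x, y}"] assms(2,3) by (simp add: meet_def)
qed

lemma finite_meet_hom_mono:
  assumes L: "finite_meet_poset L" and M: "finite_meet_poset M" and h: "finite_meet_hom L M h"
    and x: "x \<in> carrier L" and y: "y \<in> carrier L" and xy: "x \<sqsubseteq>\<^bsub>L\<^esub> y"
  shows "h x \<sqsubseteq>\<^bsub>M\<^esub> h y"
  using finite_meet_hom_meet[OF h x y] finite_meet_poset.meet_eq_left_iff[OF L x y] xy
    finite_meet_poset.meet_eq_left_iff[OF M finite_meet_hom_closed[OF h x] finite_meet_hom_closed[OF h y]]
  by simp

lemma finite_meet_hom_top: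
  assumes L: "finite_meet_poset L" and M: "finite_meet_poset M" and h: "finite_meet_hom L M h"
    and x: "greatest L x (carrier L)"
  shows "greatest M (h x) (carrier M)"
proof -
  have "x = \<Sqinter>\<^bsub>L\<^esub>{}"
    using finite_meet_poset.greatest_unique[OF L x] finite_meet_poset.inf_empty[OF L] by blast
  then have "h x = \<Sqinter>\<^bsub>M\<^esub>{}" using finite_meet_hom_inf[OF h, of "{}"] by simp
  then show ?thesis using finite_meet_poset.inf_empty[OF M] by simp
qed

lemma finite_meet_hom_comp:
  assumes h: "finite_meet_hom L M h" and k: "finite_meet_hom M N k"
  shows "finite_meet_hom L N (\<lambda>x. k (h x))"
  unfolding finite_meet_hom_def
proof (intro conjI allI impI)
  show "(\<lambda>x. k (h x)) \<in> carrier L \<rightarrow> carrier N" using assms by (auto simp: finite_meet_hom_def Pi_def)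
  fix S assume S: "finite S \<and> S \<subseteq> carrier L"
  then have "finite (h ` S)" "h ` S \<subseteq> carrier M" using finite_meet_hom_closed[OF h] by auto
  then have "k (\<Sqinter>\<^bsub>M\<^esub>(h ` S)) = \<Sqinter>\<^bsub>N\<^esub>(k ` h ` S)" by (rule finite_meet_hom_inf[OF k])
  moreover have "h (\<Sqinter>\<^bsub>L\<^esub>S) = \<Sqinter>\<^bsub>M\<^esub>(h ` S)" using finite_meet_hom_inf[OF h] S by simp
  ultimately show "k (h (\<Sqinter>\<^bsub>L\<^esub>S)) = \<Sqinter>\<^bsub>N\<^esub>((\<lambda>x. k (h x)) ` S)" by (simp add: image_image)
qed

lemma finite_meet_hom_cong:
  assumes L: "finite_meet_poset L" and eq: "\<And>x. x \<in> carrier L \<Longrightarrow> h x = k x"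
  shows "finite_meet_hom L M h \<longleftrightarrow> finite_meet_hom L M k"
proof -
  have "h ` S = k ` S" "finite S \<Longrightarrow> h (\<Sqinter>\<^bsub>L\<^esub>S) = k (\<Sqinter>\<^bsub>L\<^esub>S)" if "S \<subseteq> carrier L" for S
    using eq that by (auto intro!: image_cong eq finite_meet_poset.inf_closed[OF L])
  then have "(\<forall>S. finite S \<and> S \<subseteq> carrier L \<longrightarrow> h (\<Sqinter>\<^bsub>L\<^esub>S) = \<Sqinter>\<^bsub>M\<^esub>(h ` S)) \<longleftrightarrow>
      (\<forall>S. finite S \<and> S \<subseteq> carrier L \<longrightarrow> k (\<Sqinter>\<^bsub>L\<^esub>S) = \<Sqinter>\<^bsub>M\<^esub>(k ` S))"
    by simp
  moreover have "h \<in> carrier L \<rightarrow> carrier M \<longleftrightarrow> k \<in> carrier L \<rightarrow> carrier M"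
    using eq by (auto simp: Pi_def)
  ultimately show ?thesis unfolding finite_meet_hom_def by simp
qed

lemma finite_meet_hom_ident: "finite_meet_hom L L (\<lambda>x. x)"
  by (simp add: finite_meet_hom_def)

section \<open>Internal equality of arrows\<close>

context doctrine
begin

lemma reidx_closed: "\<lbrakk>f \<in> Hom P A B; x \<in> carrier (Fib P B)\<rbrakk> \<Longrightarrow> Reidx P f x \<in> carrier (Fib P A)"
  using finite_meet_hom_closed[OF reidx_hom] .

lemma reidx_mono:
  assumes f: "f \<in> Hom P A B" and "x \<in> carrier (Fib P B)" "y \<in> carrier (Fib P B)" "x \<sqsubseteq>\<^bsub>Fib P B\<^esub> y"
  shows "Reidx P f x \<sqsubseteq>\<^bsub>Fib P A\<^esub> Reidx P f y"
  using finite_meet_hom_mono[OF fib fib reidx_hom[OF f]] assms hom_arr[OF f] by simp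

lemma reidx_top:
  assumes f: "f \<in> Hom P A B" and "greatest (Fib P B) x (carrier (Fib P B))"
  shows "greatest (Fib P A) (Reidx P f x) (carrier (Fib P A))"
  using finite_meet_hom_top[OF fib fib reidx_hom[OF f]] assms hom_arr[OF f] by simp

lemma diag_hom: "A \<in> Ob P \<Longrightarrow> pairing P (Ident P A) (Ident P A) \<in> Hom P A (Prod P A A)"
  by (intro pairing_hom ident_in_hom)

text \<open>This is the first adjunction at the top element of \<open>P(A)\<close>: an equality predicate is the least
  predicate that is true on the diagonal.\<close>

lemma is_equality_least:
  assumes eq: "is_equality P A d" and A: "A \<in> Ob P" and x: "x \<in> carrier (Fib P (Prod P A A))"
  shows "d \<sqsubseteq>\<^bsub>Fib P (Prod P A A)\<^esub> x \<longleftrightarrow>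
    greatest (Fib P A) (Reidx P (pairing P (Ident P A) (Ident P A)) x) (carrier (Fib P A))"
proof -
  let ?D = "pairing P (Ident P A) (Ident P A)"
  interpret A: finite_meet_poset "Fib P A" by (rule fib[OF A])
  interpret AA: finite_meet_poset "Fib P (Prod P A A)" by (rule fib[OF prod_ob[OF A A]])
  obtain t where t: "greatest (Fib P A) t (carrier (Fib P A))" using A.inf_empty by blast
  have d: "d \<in> carrier (Fib P (Prod P A A))" using eq by (simp add: is_equality_def)
  have "galois_connection \<lparr>orderA = Fib P A, orderB = Fib P (Prod P A A),
      lower = \<lambda>x. Reidx P (Pr1 P A A) x \<sqinter>\<^bsub>Fib P (Prod P A A)\<^esub> d, upper = Reidx P ?D\<rparr>"
    using eq by (simp add: is_equality_def left_adjoint_def)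
  from galois_connection.galois_property[OF this, of t x]
  have "Reidx P (Pr1 P A A) t \<sqinter>\<^bsub>Fib P (Prod P A A)\<^esub> d \<sqsubseteq>\<^bsub>Fib P (Prod P A A)\<^esub> x \<longleftrightarrow>
      t \<sqsubseteq>\<^bsub>Fib P A\<^esub> Reidx P ?D x"
    using t x by simp
  moreover have "Reidx P (Pr1 P A A) t \<sqinter>\<^bsub>Fib P (Prod P A A)\<^esub> d = d"
    by (rule AA.meet_top_left[OF reidx_top[OF pr1_hom[OF A A] t] d])
  moreover have "Reidx P ?D x \<in> carrier (Fib P A)" using reidx_closed[OF diag_hom[OF A] x] .
  ultimately show ?thesis using A.top_le_iff[OF t] by simp
qed

lemma is_equality_unique:
  assumes A: "A \<in> Ob P" and d: "is_equality P A d" and d': "is_equality P A d'"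
  shows "d = d'"
proof -
  interpret AA: finite_meet_poset "Fib P (Prod P A A)" by (rule fib[OF prod_ob[OF A A]])
  have c: "d \<in> carrier (Fib P (Prod P A A))" "d' \<in> carrier (Fib P (Prod P A A))"
    using d d' by (simp_all add: is_equality_def)
  have "d \<sqsubseteq>\<^bsub>Fib P (Prod P A A)\<^esub> d'" "d' \<sqsubseteq>\<^bsub>Fib P (Prod P A A)\<^esub> d"
    using is_equality_least[OF d A c(1)] is_equality_least[OF d A c(2)]
      is_equality_least[OF d' A c(1)] is_equality_least[OF d' A c(2)] c AA.le_refl by simp_all
  then show ?thesis by (rule AA.le_antisym[OF _ _ c])
qed

text \<open>Indiscernibility of identicals: if \<open>a = a'\<close> holds under the hypothesis \<open>w\<close>, then \<open>a\<close> may be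
  replaced by \<open>a'\<close> in the predicate \<open>b\<close> with parameter \<open>x\<close>. Over \<open>X \<times> A \<times> A\<close>, the second adjunction
  bounds \<open>b(p1, p2) \<and> p2 = p3\<close> by \<open>b(p1, p3)\<close>, because \<open>b(p1, p3)\<close> restricts to \<open>b\<close> along \<open>e\<close>; the
  lemma is the pullback of that inequality along \<open>((x, a), a')\<close>.\<close>

lemma leibniz:
  assumes eq: "is_equality P A d"
    and x: "x \<in> Hom P Y X" and a: "a \<in> Hom P Y A" and a': "a' \<in> Hom P Y A"
    and b: "b \<in> carrier (Fib P (Prod P X A))" and w: "w \<in> carrier (Fib P Y)"
    and wb: "w \<sqsubseteq>\<^bsub>Fib P Y\<^esub> Reidx P (pairing P x a) b"
    and wd: "w \<sqsubseteq>\<^bsub>Fib P Y\<^esub> Reidx P (pairing P a a') d"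
  shows "w \<sqsubseteq>\<^bsub>Fib P Y\<^esub> Reidx P (pairing P x a') b"
proof -
  note X = hom_arr(5)[OF x] and A = hom_arr(5)[OF a] and Y = hom_arr(4)[OF a]
  define XA where "XA = Prod P X A"
  define XAA where "XAA = Prod P XA A"
  define p1 where "p1 = Pr1 P X A \<cdot> Pr1 P XA A"
  define p2 where "p2 = Pr2 P X A \<cdot> Pr1 P XA A"
  define p3 where "p3 = Pr2 P XA A"
  define e where "e = pairing P (pairing P (Pr1 P X A) (Pr2 P X A)) (Pr2 P X A)"
  have XA: "XA \<in> Ob P" and XAA: "XAA \<in> Ob P" using prod_ob X A by (auto simp: XA_def XAA_def)
  have pr: "Pr1 P XA A \<in> Hom P XAA XA" "Pr1 P X A \<in> Hom P XA X" "Pr2 P X A \<in> Hom P XA A"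
    using pr1_hom pr2_hom XA A X by (auto simp: XA_def XAA_def)
  have p: "p1 \<in> Hom P XAA X" "p2 \<in> Hom P XAA A" "p3 \<in> Hom P XAA A"
    using comp_in_hom[OF pr(1) pr(2)] comp_in_hom[OF pr(1) pr(3)] pr2_hom[OF XA A]
    by (simp_all add: p1_def p2_def p3_def XAA_def)
  have e: "e \<in> Hom P XA XAA"
    using pairing_hom[OF pairing_hom[OF pr(2,3)] pr(3)] by (simp add: e_def XA_def XAA_def)
  interpret XA: finite_meet_poset "Fib P XA" by (rule fib[OF XA])
  interpret XAA: finite_meet_poset "Fib P XAA" by (rule fib[OF XAA])
  interpret Y: finite_meet_poset "Fib P Y" by (rule fib[OF Y])
  have d: "d \<in> carrier (Fib P (Prod P A A))" using eq by (simp add: is_equality_def)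
  have b: "b \<in> carrier (Fib P XA)" using b by (simp add: XA_def)
  have hom: "pairing P p1 p2 \<in> Hom P XAA XA" "pairing P p1 p3 \<in> Hom P XAA XA"
      "pairing P p2 p3 \<in> Hom P XAA (Prod P A A)"
    using pairing_hom p by (auto simp: XA_def)
  have cl: "Reidx P (pairing P p1 p2) b \<in> carrier (Fib P XAA)"
      "Reidx P (pairing P p1 p3) b \<in> carrier (Fib P XAA)"
      "Reidx P (pairing P p2 p3) d \<in> carrier (Fib P XAA)"
    using reidx_closed[OF hom(1) b] reidx_closed[OF hom(2) b] reidx_closed[OF hom(3) d] by simp_all
  have "pairing P p1 p3 \<cdot> e = Ident P XA"
  proof -
    have "p1 \<cdot> e = Pr1 P X A"
      using pr1_pairing_comp[OF pairing_hom[OF pr(2,3)] pr(3), of "Pr1 P X A" X] pr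
        pr1_pairing[OF pr(2,3)] by (simp add: p1_def e_def XA_def)
    moreover have "p3 \<cdot> e = Pr2 P X A"
      using pr2_pairing[OF pairing_hom[OF pr(2,3)] pr(3)] by (simp add: p3_def e_def XA_def)
    ultimately show ?thesis
      using pairing_comp[OF p(1,3) e] pairing_pr[OF X A] by (simp add: XA_def)
  qed
  then have eb: "Reidx P e (Reidx P (pairing P p1 p3) b) = b"
    using reidx_comp[OF e hom(2) b] reidx_ident[OF XA b] by simp
  have "galois_connection \<lparr>orderA = Fib P XA, orderB = Fib P XAA,
      lower = \<lambda>x. Reidx P (pairing P p1 p2) x \<sqinter>\<^bsub>Fib P XAA\<^esub> Reidx P (pairing P p2 p3) d,
      upper = Reidx P e\<rparr>"
    using eq X unfolding is_equality_def left_adjoint_def Let_def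
      XA_def XAA_def p1_def p2_def p3_def e_def by blast
  from galois_connection.galois_property[OF this, of b "Reidx P (pairing P p1 p3) b"]
  have le: "Reidx P (pairing P p1 p2) b \<sqinter>\<^bsub>Fib P XAA\<^esub> Reidx P (pairing P p2 p3) d
      \<sqsubseteq>\<^bsub>Fib P XAA\<^esub> Reidx P (pairing P p1 p3) b"
    using b cl eb by simp
  define m where "m = pairing P (pairing P x a) a'"
  have xa: "pairing P x a \<in> Hom P Y XA" using pairing_hom[OF x a] by (simp add: XA_def)
  have m: "m \<in> Hom P Y XAA" using pairing_hom[OF xa a'] by (simp add: m_def XAA_def)
  have "p1 \<cdot> m = x" "p2 \<cdot> m = a" "p3 \<cdot> m = a'"
    using pr1_pairing_comp[OF xa a' pr(2)] pr1_pairing_comp[OF xa a' pr(3)]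
      pr1_pairing[OF x a] pr2_pairing[OF x a] pr2_pairing[OF xa a']
    by (simp_all add: p1_def p2_def p3_def m_def)
  then have pm: "pairing P p1 p2 \<cdot> m = pairing P x a" "pairing P p1 p3 \<cdot> m = pairing P x a'"
      "pairing P p2 p3 \<cdot> m = pairing P a a'"
    using pairing_comp[OF _ _ m] p by auto
  have "Reidx P m (Reidx P (pairing P p1 p2) b) \<sqinter>\<^bsub>Fib P Y\<^esub> Reidx P m (Reidx P (pairing P p2 p3) d)
      \<sqsubseteq>\<^bsub>Fib P Y\<^esub> Reidx P m (Reidx P (pairing P p1 p3) b)"
    using reidx_mono[OF m XAA.meet_closed[OF cl(1,3)] cl(2) le]
      finite_meet_hom_meet[OF reidx_hom[OF m] cl(1,3)] by simp
  then have "Reidx P (pairing P x a) b \<sqinter>\<^bsub>Fib P Y\<^esub> Reidx P (pairing P a a') d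
      \<sqsubseteq>\<^bsub>Fib P Y\<^esub> Reidx P (pairing P x a') b"
    using reidx_comp[OF m hom(1) b] reidx_comp[OF m hom(2) b] reidx_comp[OF m hom(3) d] pm by simp
  moreover have c: "Reidx P (pairing P x a) b \<in> carrier (Fib P Y)"
      "Reidx P (pairing P x a') b \<in> carrier (Fib P Y)" "Reidx P (pairing P a a') d \<in> carrier (Fib P Y)"
    using reidx_closed[OF xa b] reidx_closed[OF pairing_hom[OF x a']] b reidx_closed[OF pairing_hom[OF a a'] d]
    by (auto simp: XA_def)
  ultimately show ?thesis
    using Y.le_meet_iff[OF c(1,3) w] wb wd Y.le_trans[OF _ _ w Y.meet_closed[OF c(1,3)] c(2)] by simp
qed

end

context elementary_doctrine
begin

lemma delta_is_equality: "A \<in> Ob P \<Longrightarrow> is_equality P A (delta P A)"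
  unfolding delta_def by (rule theI') (use equality_exists is_equality_unique in blast)

lemma delta_closed: "A \<in> Ob P \<Longrightarrow> delta P A \<in> carrier (Fib P (Prod P A A))"
  using delta_is_equality unfolding is_equality_def by blast

text \<open>Since \<open>\<delta>\<^sub>A\<close> is the least reflexive predicate on \<open>A \<times> A\<close>, two arrows are identified by the
  collapse exactly when they are internally equal, that is, when the predicate \<open>f(x) = f'(x)\<close> on
  their domain is true.\<close>

lemma ext_eq_iff:
  assumes f: "f \<in> Hom P A B" and f': "f' \<in> Hom P A B"
  shows "ext_eq P f f' \<longleftrightarrow>
    greatest (Fib P A) (Reidx P (pairing P f f') (delta P B)) (carrier (Fib P A))"
proof -
  note * = hom_arr[OF f] hom_arr[OF f']
  note i = ident_in_hom[of A, OF *(4)]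
  have "ext_eq P f f' \<longleftrightarrow> delta P A \<sqsubseteq>\<^bsub>Fib P (Prod P A A)\<^esub> Reidx P (prod_arr P f f') (delta P B)"
    using * by (simp add: ext_eq_def)
  also have "\<dots> \<longleftrightarrow> greatest (Fib P A) (Reidx P (pairing P (Ident P A) (Ident P A))
      (Reidx P (prod_arr P f f') (delta P B))) (carrier (Fib P A))"
    by (rule is_equality_least[OF delta_is_equality])
      (use * reidx_closed[OF prod_arr_hom[OF f f']] delta_closed in auto)
  also have "Reidx P (pairing P (Ident P A) (Ident P A)) (Reidx P (prod_arr P f f') (delta P B))
      = Reidx P (pairing P f f') (delta P B)"
    using reidx_comp[OF pairing_hom[OF i i] prod_arr_hom[OF f f'] delta_closed[OF *(5)]]
      prod_arr_pairing[OF f f' i i] ident_right f f' by simp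
  finally show ?thesis .
qed

lemma ext_eqD:
  assumes "ext_eq P f f'" "f \<in> Hom P A B"
  shows "f' \<in> Hom P A B"
  using assms by (auto simp: ext_eq_def Hom_def)

text \<open>Equality is true on the diagonal of \<open>B\<close>, hence also after reindexing along \<open>f\<close>. Thus every arrow
  respects equality, and the collapse discards no arrows.\<close>

lemma ext_eq_refl:
  assumes f: "f \<in> Hom P A B"
  shows "ext_eq P f f"
proof -
  note B = hom_arr(5)[OF f]
  interpret finite_meet_poset "Fib P (Prod P B B)" using fib prod_ob B by blast
  note i = ident_in_hom[OF B]
  have "greatest (Fib P B) (Reidx P (pairing P (Ident P B) (Ident P B)) (delta P B)) (carrier (Fib P B))"
    using is_equality_least[OF delta_is_equality[OF B] B delta_closed[OF B]] delta_closed[OF B] by simp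
  then have "greatest (Fib P A) (Reidx P f (Reidx P (pairing P (Ident P B) (Ident P B)) (delta P B)))
      (carrier (Fib P A))"
    by (rule reidx_top[OF f])
  then show ?thesis
    using ext_eq_iff[OF f f] reidx_comp[OF f diag_hom[OF B] delta_closed[OF B]]
      pairing_comp[OF i i f] ident_left[OF f] by simp
qed

text \<open>The two substitution rules below combine indiscernibility with an arrow out of \<open>X \<times> A\<close>, which plays
  the part of a term with a distinguished variable of sort \<open>A\<close>.\<close>

lemma ext_eq_subst:
  assumes e: "ext_eq P a a'" and a: "a \<in> Hom P Y A" and x: "x \<in> Hom P Y X"
    and u: "u \<in> Hom P (Prod P X A) B" and b: "b \<in> carrier (Fib P B)" and w: "w \<in> carrier (Fib P Y)"
    and wb: "w \<sqsubseteq>\<^bsub>Fib P Y\<^esub> Reidx P (u \<cdot> pairing P x a) b"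
  shows "w \<sqsubseteq>\<^bsub>Fib P Y\<^esub> Reidx P (u \<cdot> pairing P x a') b"
proof -
  have a': "a' \<in> Hom P Y A" by (rule ext_eqD[OF e a])
  have "w \<sqsubseteq>\<^bsub>Fib P Y\<^esub> Reidx P (pairing P x a') (Reidx P u b)"
  proof (rule leibniz[OF delta_is_equality[OF hom_arr(5)[OF a]] x a a' reidx_closed[OF u b] w])
    show "w \<sqsubseteq>\<^bsub>Fib P Y\<^esub> Reidx P (pairing P x a) (Reidx P u b)"
      using wb reidx_comp[OF pairing_hom[OF x a] u b] by simp
    show "w \<sqsubseteq>\<^bsub>Fib P Y\<^esub> Reidx P (pairing P a a') (delta P A)"
      using e ext_eq_iff[OF a a'] w greatest_le by fast
  qed
  then show ?thesis using reidx_comp[OF pairing_hom[OF x a'] u b] by simp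
qed

lemma ext_eq_subst_arr:
  assumes e: "ext_eq P a a'" and a: "a \<in> Hom P Y A" and x: "x \<in> Hom P Y X"
    and h: "h \<in> Hom P X B" and k: "k \<in> Hom P (Prod P X A) B"
    and hk: "ext_eq P (h \<cdot> x) (k \<cdot> pairing P x a)"
  shows "ext_eq P (h \<cdot> x) (k \<cdot> pairing P x a')"
proof -
  have a': "a' \<in> Hom P Y A" by (rule ext_eqD[OF e a])
  note X = hom_arr(5)[OF x] and A = hom_arr(5)[OF a] and B = hom_arr(5)[OF h]
  \<comment> \<open>The predicate in which the substitution takes place is \<open>h(x) = k(x, -)\<close>, the pullback of
    equality on \<open>B\<close> along \<open>u\<close>.\<close>
  define u where "u = pairing P (h \<cdot> Pr1 P X A) k"
  have h1: "h \<cdot> Pr1 P X A \<in> Hom P (Prod P X A) B" using comp_in_hom[OF pr1_hom[OF X A] h] .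
  have u: "u \<in> Hom P (Prod P X A) (Prod P B B)" using pairing_hom[OF h1 k] by (simp add: u_def)
  have ux: "u \<cdot> pairing P x c = pairing P (h \<cdot> x) (k \<cdot> pairing P x c)" if "c \<in> Hom P Y A" for c
    using pairing_comp[OF h1 k pairing_hom[OF x that]] pr1_pairing_comp[OF x that h]
    by (simp add: u_def)
  have hom: "h \<cdot> x \<in> Hom P Y B" "k \<cdot> pairing P x c \<in> Hom P Y B" if "c \<in> Hom P Y A" for c
    by (rule comp_in_hom[OF x h], rule comp_in_hom[OF pairing_hom[OF x that] k])
  have "w \<sqsubseteq>\<^bsub>Fib P Y\<^esub> Reidx P (pairing P (h \<cdot> x) (k \<cdot> pairing P x a')) (delta P B)"
    if w: "w \<in> carrier (Fib P Y)" for w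
  proof -
    have "w \<sqsubseteq>\<^bsub>Fib P Y\<^esub> Reidx P (u \<cdot> pairing P x a) (delta P B)"
      using hk ext_eq_iff[OF hom[OF a]] ux[OF a] w greatest_le by fastforce
    then show ?thesis using ext_eq_subst[OF e a x u delta_closed[OF B] w] ux[OF a'] by simp
  qed
  moreover have "Reidx P (pairing P (h \<cdot> x) (k \<cdot> pairing P x a')) (delta P B) \<in> carrier (Fib P Y)"
    by (rule reidx_closed[OF pairing_hom[OF hom[OF a']] delta_closed[OF B]])
  ultimately show ?thesis using ext_eq_iff[OF hom[OF a']] by (simp add: greatest_def)
qed

lemma ext_eq_sym:
  assumes e: "ext_eq P f g"
  shows "ext_eq P g f"
proof -
  define A B where "A = Dom P f" and "B = Cod P f"
  have f: "f \<in> Hom P A B" using e by (auto simp: ext_eq_def Hom_def A_def B_def)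
  have g: "g \<in> Hom P A B" by (rule ext_eqD[OF e f])
  note B = hom_arr(5)[OF f] and A = hom_arr(4)[OF f]
  note d = delta_closed[OF B]
  \<comment> \<open>Swapping the factors turns equality into the predicate \<open>c = f\<close> of \<open>c\<close>, which holds for \<open>c = f\<close>
    and is transported to \<open>c = g\<close>.\<close>
  define s where "s = pairing P (Pr2 P B B) (Pr1 P B B)"
  have s: "s \<in> Hom P (Prod P B B) (Prod P B B)"
    using pairing_hom[OF pr2_hom[OF B B] pr1_hom[OF B B]] by (simp add: s_def)
  have sx: "s \<cdot> pairing P f c = pairing P c f" if "c \<in> Hom P A B" for c
    using pairing_comp[OF pr2_hom[OF B B] pr1_hom[OF B B] pairing_hom[OF f that]]
      pr1_pairing[OF f that] pr2_pairing[OF f that] by (simp add: s_def)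
  have "w \<sqsubseteq>\<^bsub>Fib P A\<^esub> Reidx P (pairing P g f) (delta P B)" if w: "w \<in> carrier (Fib P A)" for w
    using ext_eq_subst[OF e f f s d w] sx[OF f] sx[OF g] ext_eq_refl[OF f] ext_eq_iff[OF f f] w greatest_le
    by fastforce
  moreover have "Reidx P (pairing P g f) (delta P B) \<in> carrier (Fib P A)"
    using reidx_closed[OF pairing_hom[OF g f] d] .
  ultimately show ?thesis using ext_eq_iff[OF g f] by (simp add: greatest_def)
qed

lemma ext_eq_trans:
  assumes fg: "ext_eq P f g" and gh: "ext_eq P g h"
  shows "ext_eq P f h"
proof -
  define A B where "A = Dom P f" and "B = Cod P f"
  have f: "f \<in> Hom P A B" using fg by (auto simp: ext_eq_def Hom_def A_def B_def)
  have g: "g \<in> Hom P A B" by (rule ext_eqD[OF fg f])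
  have h: "h \<in> Hom P A B" by (rule ext_eqD[OF gh g])
  note B = hom_arr(5)[OF f]
  show ?thesis
    using ext_eq_subst_arr[OF gh g f ident_in_hom[OF B] pr2_hom[OF B B]]
      fg ident_left[OF f] pr2_pairing[OF f g] pr2_pairing[OF f h] by simp
qed

lemma ext_eq_comp:
  assumes ff: "ext_eq P f f'" and f: "f \<in> Hom P A B" and gg: "ext_eq P g g'" and g: "g \<in> Hom P B D"
  shows "ext_eq P (g \<cdot> f) (g' \<cdot> f')"
proof -
  have f': "f' \<in> Hom P A B" by (rule ext_eqD[OF ff f])
  have g': "g' \<in> Hom P B D" by (rule ext_eqD[OF gg g])
  note B = hom_arr(5)[OF f] and D = hom_arr(5)[OF g]
  note gf = comp_in_hom[OF f g] and gf' = comp_in_hom[OF f g']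
  \<comment> \<open>Replacing \<open>g\<close> only needs that reindexing along \<open>f\<close> preserves truth; replacing \<open>f\<close> is a
    substitution in the term \<open>g'\<close>.\<close>
  have "greatest (Fib P A) (Reidx P f (Reidx P (pairing P g g') (delta P D))) (carrier (Fib P A))"
    using reidx_top[OF f] gg ext_eq_iff[OF g g'] by blast
  then have "ext_eq P (g \<cdot> f) (g' \<cdot> f)"
    using reidx_comp[OF f pairing_hom[OF g g'] delta_closed[OF D]] pairing_comp[OF g g' f]
      ext_eq_iff[OF gf gf'] by simp
  moreover have "ext_eq P (g' \<cdot> f) (g' \<cdot> f')"
    using ext_eq_subst_arr[OF ff f f g' comp_in_hom[OF pr2_hom[OF B B] g']]
      pr2_pairing_comp[OF f f g'] pr2_pairing_comp[OF f f' g'] ext_eq_refl[OF gf'] by simp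
  ultimately show ?thesis by (rule ext_eq_trans)
qed

lemma ext_eq_pairing:
  assumes ff: "ext_eq P f f'" and f: "f \<in> Hom P X A" and gg: "ext_eq P g g'" and g: "g \<in> Hom P X B"
  shows "ext_eq P (pairing P f g) (pairing P f' g')"
proof -
  have f': "f' \<in> Hom P X A" by (rule ext_eqD[OF ff f])
  have g': "g' \<in> Hom P X B" by (rule ext_eqD[OF gg g])
  note A = hom_arr(5)[OF f] and B = hom_arr(5)[OF g]
  define Z where "Z = Prod P A B"
  have Z: "Z \<in> Ob P" using prod_ob[OF A B] by (simp add: Z_def)
  have pr: "Pr1 P A B \<in> Hom P Z A" "Pr2 P A B \<in> Hom P Z B"
    using pr1_hom[OF A B] pr2_hom[OF A B] by (simp_all add: Z_def)
  have fg: "pairing P f g \<in> Hom P X Z" and fg': "pairing P f' g \<in> Hom P X Z"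
    using pairing_hom[OF f g] pairing_hom[OF f' g] by (simp_all add: Z_def)
  \<comment> \<open>The components are replaced one at a time: \<open>u\<close> overwrites the first component of a pair, \<open>v\<close>
    the second.\<close>
  define u where "u = pairing P (Pr2 P Z A) (Pr2 P A B \<cdot> Pr1 P Z A)"
  have u12: "Pr2 P Z A \<in> Hom P (Prod P Z A) A" "Pr2 P A B \<cdot> Pr1 P Z A \<in> Hom P (Prod P Z A) B"
    by (rule pr2_hom[OF Z A], rule comp_in_hom[OF pr1_hom[OF Z A] pr(2)])
  have u: "u \<in> Hom P (Prod P Z A) Z" using pairing_hom[OF u12] by (simp add: u_def Z_def)
  have ux: "u \<cdot> pairing P (pairing P f g) c = pairing P c g" if "c \<in> Hom P X A" for c
    using pairing_comp[OF u12 pairing_hom[OF fg that]] pr1_pairing_comp[OF fg that pr(2)]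
      pr2_pairing[OF fg that] pr2_pairing[OF f g] by (simp add: u_def)
  have "ext_eq P (pairing P f g) (pairing P f' g)"
    using ext_eq_subst_arr[OF ff f fg ident_in_hom[OF Z] u] ux[OF f] ux[OF f'] ident_left[OF fg]
      ext_eq_refl[OF fg] by simp
  moreover
  define v where "v = pairing P (Pr1 P A B \<cdot> Pr1 P Z B) (Pr2 P Z B)"
  have v12: "Pr1 P A B \<cdot> Pr1 P Z B \<in> Hom P (Prod P Z B) A" "Pr2 P Z B \<in> Hom P (Prod P Z B) B"
    by (rule comp_in_hom[OF pr1_hom[OF Z B] pr(1)], rule pr2_hom[OF Z B])
  have v: "v \<in> Hom P (Prod P Z B) Z" using pairing_hom[OF v12] by (simp add: v_def Z_def)
  have vx: "v \<cdot> pairing P (pairing P f' g) c = pairing P f' c" if "c \<in> Hom P X B" for c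
    using pairing_comp[OF v12 pairing_hom[OF fg' that]] pr1_pairing_comp[OF fg' that pr(1)]
      pr2_pairing[OF fg' that] pr1_pairing[OF f' g] by (simp add: v_def)
  have "ext_eq P (pairing P f' g) (pairing P f' g')"
    using ext_eq_subst_arr[OF gg g fg' ident_in_hom[OF Z] v] vx[OF g] vx[OF g'] ident_left[OF fg']
      ext_eq_refl[OF fg'] by simp
  ultimately show ?thesis by (rule ext_eq_trans)
qed

text \<open>An arrow into a product is recovered from its components by pairing, and pairing respects internal
  equality. This is the uniqueness part of the universal property in the collapse.\<close>

lemma ext_eq_product_joint_mono:
  assumes Z: "is_product P A B Z p q" and h: "h \<in> Hom P X Z" and k: "k \<in> Hom P X Z"
    and p: "ext_eq P (p \<cdot> h) (p \<cdot> k)" and q: "ext_eq P (q \<cdot> h) (q \<cdot> k)"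
  shows "ext_eq P h k"
proof -
  note D = is_productD[OF Z]
  note A = hom_arr(5)[OF D(2)] and B = hom_arr(5)[OF D(3)]
  obtain i j where ij: "i \<in> Hom P (Prod P A B) Z" "j \<in> Hom P Z (Prod P A B)" "p \<cdot> i = Pr1 P A B"
      "q \<cdot> i = Pr2 P A B" "i \<cdot> j = Ident P Z" "j \<cdot> i = Ident P (Prod P A B)"
    using is_product_unique_iso[OF Z products[OF A B]] .
  note ph = comp_in_hom[OF h D(2)] comp_in_hom[OF h D(3)]
  \<comment> \<open>\<open>Z\<close> need not be the chosen product, hence the comparison isomorphism \<open>i\<close>.\<close>
  have "i \<cdot> pairing P (p \<cdot> l) (q \<cdot> l) = l" if l: "l \<in> Hom P X Z" for l
  proof (rule is_product_joint_mono[OF Z _ l])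
    note pl = comp_in_hom[OF l D(2)] comp_in_hom[OF l D(3)]
    note pr = pairing_hom[OF pl]
    show "i \<cdot> pairing P (p \<cdot> l) (q \<cdot> l) \<in> Hom P X Z" using comp_in_hom[OF pr ij(1)] .
    show "p \<cdot> (i \<cdot> pairing P (p \<cdot> l) (q \<cdot> l)) = p \<cdot> l" "q \<cdot> (i \<cdot> pairing P (p \<cdot> l) (q \<cdot> l)) = q \<cdot> l"
      using comp_assoc[OF pr ij(1) D(2)] comp_assoc[OF pr ij(1) D(3)] pr1_pairing[OF pl] pr2_pairing[OF pl] ij
      by simp_all
  qed
  then show ?thesis
    using ext_eq_comp[OF ext_eq_pairing[OF p ph(1) q ph(2)] pairing_hom[OF ph] ext_eq_refl[OF ij(1)] ij(1)] h k
    by simp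
qed

lemma ext_eq_reidx:
  assumes e: "ext_eq P f f'" and f: "f \<in> Hom P A B" and b: "b \<in> carrier (Fib P B)"
  shows "Reidx P f b = Reidx P f' b"
proof -
  have f': "f' \<in> Hom P A B" by (rule ext_eqD[OF e f])
  note A = hom_arr(4)[OF f] and B = hom_arr(5)[OF f]
  interpret A: finite_meet_poset "Fib P A" by (rule fib[OF A])
  have *: "Reidx P g b \<sqsubseteq>\<^bsub>Fib P A\<^esub> Reidx P g' b"
    if e: "ext_eq P g g'" and g: "g \<in> Hom P A B" and g': "g' \<in> Hom P A B" for g g'
    using ext_eq_subst[OF e g g pr2_hom[OF B B] b reidx_closed[OF g b]]
      pr2_pairing[OF g g] pr2_pairing[OF g g'] reidx_closed[OF g b] by simp
  show ?thesis
    using *[OF e f f'] *[OF ext_eq_sym[OF e] f' f] reidx_closed[OF f b] reidx_closed[OF f' b]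
    by (rule A.le_antisym)
qed

end

section \<open>Elementary doctrines form a 2-category\<close>

context elementary_doctrine_map
begin

sublocale P: elementary_doctrine P by (rule src)
sublocale R: elementary_doctrine R by (rule tgt)

lemma ob_closed: "A \<in> Ob P \<Longrightarrow> FOb F A \<in> Ob R"
  using ob by blast

lemma arr_closed: "f \<in> Arr P \<Longrightarrow> FArr F f \<in> Arr R"
  using arr[OF P.arr_hom] R.hom_arr(1) by blast

lemma el_closed: "\<lbrakk>A \<in> Ob P; x \<in> carrier (Fib P A)\<rbrakk> \<Longrightarrow> FEl F A x \<in> carrier (Fib R (FOb F A))"
  using finite_meet_hom_closed[OF el_hom] .

lemma el_mono:
  "\<lbrakk>A \<in> Ob P; x \<in> carrier (Fib P A); y \<in> carrier (Fib P A); x \<sqsubseteq>\<^bsub>Fib P A\<^esub> y\<rbrakk> \<Longrightarrow>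
    FEl F A x \<sqsubseteq>\<^bsub>Fib R (FOb F A)\<^esub> FEl F A y"
  using finite_meet_hom_mono[OF P.fib R.fib[OF ob_closed] el_hom] .

lemma el_top:
  "\<lbrakk>A \<in> Ob P; greatest (Fib P A) x (carrier (Fib P A))\<rbrakk> \<Longrightarrow>
    greatest (Fib R (FOb F A)) (FEl F A x) (carrier (Fib R (FOb F A)))"
  using finite_meet_hom_top[OF P.fib R.fib[OF ob_closed] el_hom] .

text \<open>Preservation of \<open>\<delta>\<close>, required of a 1-cell for the two projections only, extends to arbitrary pairs
  of arrows by reindexing along their pairing.\<close>

lemma reidx_pairing_delta:
  assumes f: "f \<in> Hom P A B" and g: "g \<in> Hom P A B"
  shows "FEl F A (Reidx P (pairing P f g) (delta P B))
    = Reidx R (pairing R (FArr F f) (FArr F g)) (delta R (FOb F B))"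
proof -
  note B = P.hom_arr(5)[OF f]
  note BB = P.prod_ob[OF B B] and pr = P.pr1_hom[OF B B] P.pr2_hom[OF B B]
  note fg = P.pairing_hom[OF f g]
  have pp: "pairing R (FArr F (Pr1 P B B)) (FArr F (Pr2 P B B)) \<in>
      Hom R (FOb F (Prod P B B)) (Prod R (FOb F B) (FOb F B))"
    using R.pairing_hom arr pr by blast
  have "FEl F A (Reidx P (pairing P f g) (delta P B))
      = Reidx R (FArr F (pairing P f g)) (FEl F (Prod P B B) (delta P B))"
    by (rule el_natural[OF fg P.delta_closed[OF B]])
  also have "\<dots> = Reidx R (pairing R (FArr F (Pr1 P B B)) (FArr F (Pr2 P B B)) \<cdot>\<^bsub>R\<^esub> FArr F (pairing P f g))
      (delta R (FOb F B))"
    using R.reidx_comp[OF arr[OF fg] pp R.delta_closed[OF ob_closed[OF B]]] el_delta[OF B] by simp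
  also have "pairing R (FArr F (Pr1 P B B)) (FArr F (Pr2 P B B)) \<cdot>\<^bsub>R\<^esub> FArr F (pairing P f g)
      = pairing R (FArr F f) (FArr F g)"
    using R.pairing_comp[OF arr[OF pr(1)] arr[OF pr(2)] arr[OF fg]]
      arr_comp[OF fg pr(1)] arr_comp[OF fg pr(2)] P.pr1_pairing[OF f g] P.pr2_pairing[OF f g] by simp
  finally show ?thesis .
qed

text \<open>Internal equality is expressed by the top element and \<open>\<delta>\<close>, both preserved by a 1-cell.\<close>

lemma ext_eq_map:
  assumes e: "ext_eq P f g"
  shows "ext_eq R (FArr F f) (FArr F g)"
proof -
  define A B where "A = Dom P f" and "B = Cod P f"
  have f: "f \<in> Hom P A B" using e by (auto simp: ext_eq_def Hom_def A_def B_def)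
  have g: "g \<in> Hom P A B" by (rule P.ext_eqD[OF e f])
  have "greatest (Fib P A) (Reidx P (pairing P f g) (delta P B)) (carrier (Fib P A))"
    using e P.ext_eq_iff[OF f g] by simp
  then show ?thesis
    using el_top[OF P.hom_arr(4)[OF f], of "Reidx P (pairing P f g) (delta P B)"]
      reidx_pairing_delta[OF f g] R.ext_eq_iff[OF arr[OF f] arr[OF g]]
    by simp
qed

end

text \<open>Cells are compared by their values, because their component functions are extensional.\<close>

lemma elementary_doctrine_map_eqI:
  assumes F: "elementary_doctrine_map F" and G: "elementary_doctrine_map G"
    and src: "Src F = Src G" and tgt: "Tgt F = Tgt G"
    and ob: "\<And>A. A \<in> Ob (Src G) \<Longrightarrow> FOb F A = FOb G A"
    and arr: "\<And>f. f \<in> Arr (Src G) \<Longrightarrow> FArr F f = FArr G f"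
    and el: "\<And>A x. A \<in> Ob (Src G) \<Longrightarrow> x \<in> carrier (Fib (Src G) A) \<Longrightarrow> FEl F A x = FEl G A x"
  shows "F = G"
proof -
  interpret F: elementary_doctrine_map F "Src F" "Tgt F" by (rule F)
  interpret G: elementary_doctrine_map G "Src G" "Tgt G" by (rule G)
  have "FOb F = FOb G"
    using F.ob G.ob ob src by (intro extensionalityI[of _ "Ob (Src G)"]) (auto simp: PiE_def)
  moreover have "FArr F = FArr G"
    using F.arr_ext G.arr_ext arr src by (intro extensionalityI[of _ "Arr (Src G)"]) auto
  moreover have "FEl F = FEl G"
  proof (rule extensionalityI[of _ "Ob (Src G)"])
    fix A assume A: "A \<in> Ob (Src G)"
    then show "FEl F A = FEl G A"
      using F.el_ext_fib[of A] G.el_ext_fib[of A] el src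
      by (intro extensionalityI[of _ "carrier (Fib (Src G) A)"]) auto
  qed (use F.el_ext G.el_ext src in auto)
  ultimately show ?thesis using src tgt by simp
qed

lemma elementary_doctrine_transf_eqI:
  assumes s: "elementary_doctrine_transf s" and t: "elementary_doctrine_transf t"
    and src: "Src2 s = Src2 t" and tgt: "Tgt2 s = Tgt2 t"
    and cpt: "\<And>A. A \<in> Ob (Src (Src2 t)) \<Longrightarrow> Cpt s A = Cpt t A"
  shows "s = t"
proof -
  have "Cpt s = Cpt t"
    using elementary_doctrine_transf.cpt_ext[OF s] elementary_doctrine_transf.cpt_ext[OF t] cpt src
    by (intro extensionalityI[of _ "Ob (Src (Src2 t))"]) auto
  then show ?thesis using src tgt by simp
qed

context elementary_doctrine_transf
begin

sublocale F: elementary_doctrine_map F P R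
  using src2 by (simp_all add: P_def R_def)

sublocale G: elementary_doctrine_map G P R
  using tgt2 parallel by (simp_all add: P_def R_def)

end

text \<open>Identities, units and multiplications are 1-cells for the same reason: they relate doctrines
  with the same objects, fibres and equality predicates and send projections to projections.\<close>

lemma fibrewise_identity_map:
  assumes P: "elementary_doctrine P" and R: "elementary_doctrine R"
    and ob: "Ob R = Ob P" and prod: "Prod R = Prod P" and fib: "Fib R = Fib P"
    and delta: "\<And>A. A \<in> Ob P \<Longrightarrow> delta R A = delta P A"
    and hom: "\<And>f A B. f \<in> Hom P A B \<Longrightarrow> \<phi> f \<in> Hom R A B"
    and ident: "\<And>A. A \<in> Ob P \<Longrightarrow> \<phi> (Ident P A) = Ident R A"
    and comp: "\<And>f g A B D. f \<in> Hom P A B \<Longrightarrow> g \<in> Hom P B D \<Longrightarrow> \<phi> (g \<cdot>\<^bsub>P\<^esub> f) = \<phi> g \<cdot>\<^bsub>R\<^esub> \<phi> f"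
    and pr1: "\<And>A B. A \<in> Ob P \<Longrightarrow> B \<in> Ob P \<Longrightarrow> \<phi> (Pr1 P A B) = Pr1 R A B"
    and pr2: "\<And>A B. A \<in> Ob P \<Longrightarrow> B \<in> Ob P \<Longrightarrow> \<phi> (Pr2 P A B) = Pr2 R A B"
    and reidx: "\<And>f A B x. f \<in> Hom P A B \<Longrightarrow> x \<in> carrier (Fib P B) \<Longrightarrow> Reidx R (\<phi> f) x = Reidx P f x"
  shows "elementary_doctrine_map \<lparr>Src = P, Tgt = R, FOb = \<lambda>A\<in>Ob P. A, FArr = \<lambda>f\<in>Arr P. \<phi> f,
    FEl = \<lambda>A\<in>Ob P. \<lambda>x\<in>carrier (Fib P A). x\<rparr>" (is "elementary_doctrine_map ?F")
proof -
  interpret P: elementary_doctrine P by (rule P)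
  interpret R: elementary_doctrine R by (rule R)
  have cod: "Src ?F = P" "Tgt ?F = R" by simp_all
  have FOb: "FOb ?F A = A" if "A \<in> Ob P" for A using that by simp
  have FArr: "FArr ?F f = \<phi> f" if "f \<in> Hom P A B" for f A B using P.hom_arr(1)[OF that] by simp
  have FEl: "FEl ?F A x = x" if "A \<in> Ob P" "x \<in> carrier (Fib P A)" for A x using that by simp
  show ?thesis
  proof (rule elementary_doctrine_map.intro, unfold cod)
    show "FOb ?F \<in> Ob P \<rightarrow>\<^sub>E Ob R" "FArr ?F \<in> extensional (Arr P)" "FEl ?F \<in> extensional (Ob P)"
      by (simp_all add: ob)
  next
    fix f A B assume f: "f \<in> Hom P A B"
    note A = P.hom_arr(4)[OF f] and B = P.hom_arr(5)[OF f]
    show "FArr ?F f \<in> Hom R (FOb ?F A) (FOb ?F B)"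
      using hom[OF f] by (simp only: FArr[OF f] FOb[OF A] FOb[OF B])
    show "FEl ?F A (Reidx P f x) = Reidx R (FArr ?F f) (FEl ?F B x)" if x: "x \<in> carrier (Fib P B)" for x
      by (simp only: FArr[OF f] FEl[OF B x] FEl[OF A P.reidx_closed[OF f x]] reidx[OF f x])
    show "FArr ?F (g \<cdot>\<^bsub>P\<^esub> f) = FArr ?F g \<cdot>\<^bsub>R\<^esub> FArr ?F f" if g: "g \<in> Hom P B D" for g D
      by (simp only: FArr[OF f] FArr[OF g] FArr[OF P.comp_in_hom[OF f g]] comp[OF f g])
  next
    fix A B Z p q assume A: "A \<in> Ob P" and B: "B \<in> Ob P" and Z: "is_product P A B Z p q"
    note D = is_productD[OF Z]
    have chosen: "is_product R A B (Prod P A B) (\<phi> (Pr1 P A B)) (\<phi> (Pr2 P A B))"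
      if "A \<in> Ob P" "B \<in> Ob P" for A B
      using R.products[of A B] that by (simp add: ob prod pr1 pr2)
    have "is_product R A B Z (\<phi> p) (\<phi> q)"
      by (rule preserves_products_if_preserves_chosen[where Fob = "\<lambda>A. A" and Farr = \<phi>,
            OF P.product_category_axioms R.category_axioms hom ident comp chosen A B Z])
    then show "is_product R (FOb ?F A) (FOb ?F B) (FOb ?F Z) (FArr ?F p) (FArr ?F q)"
      by (simp only: FOb[OF A] FOb[OF B] FOb[OF D(1)] FArr[OF D(2)] FArr[OF D(3)])
  next
    fix A assume A: "A \<in> Ob P"
    show "FArr ?F (Ident P A) = Ident R (FOb ?F A)"
      by (simp only: FOb[OF A] FArr[OF P.ident_in_hom[OF A]] ident[OF A])
    show "FEl ?F A \<in> extensional (carrier (Fib P A))" using A by simp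
    show "finite_meet_hom (Fib P A) (Fib R (FOb ?F A)) (FEl ?F A)"
      using A fib finite_meet_hom_ident finite_meet_hom_cong[OF P.fib[OF A], of "FEl ?F A" "\<lambda>x. x"] by simp
    have "pairing R (Pr1 R A A) (Pr2 R A A) = Ident R (Prod R A A)" using A ob R.pairing_pr by simp
    then have "Reidx R (pairing R (Pr1 R A A) (Pr2 R A A)) (delta R A) = delta R A"
      using A ob R.reidx_ident[OF R.prod_ob R.delta_closed] by simp
    then show "FEl ?F (Prod P A A) (delta P A)
        = Reidx R (pairing R (FArr ?F (Pr1 P A A)) (FArr ?F (Pr2 P A A))) (delta R (FOb ?F A))"
      using FEl[OF P.prod_ob[OF A A] P.delta_closed[OF A]]
      by (simp only: FOb[OF A] FArr[OF P.pr1_hom[OF A A]] FArr[OF P.pr2_hom[OF A A]] pr1[OF A A] pr2[OF A A]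
          delta[OF A])
  qed (rule P R)+
qed

lemma id_map_cod [simp]: "Src (id_map P) = P" "Tgt (id_map P) = P"
  by (simp_all add: id_map_def)

lemma id_map_apply [simp]:
  "A \<in> Ob P \<Longrightarrow> FOb (id_map P) A = A"
  "f \<in> Arr P \<Longrightarrow> FArr (id_map P) f = f"
  "\<lbrakk>A \<in> Ob P; x \<in> carrier (Fib P A)\<rbrakk> \<Longrightarrow> FEl (id_map P) A x = x"
  by (simp_all add: id_map_def)

lemma id_map_map:
  assumes P: "elementary_doctrine P"
  shows "elementary_doctrine_map (id_map P)"
  unfolding id_map_def by (rule fibrewise_identity_map[OF P P]) simp_all

lemma comp_map_cod [simp]: "Src (comp_map G F) = Src F" "Tgt (comp_map G F) = Tgt G"
  by (simp_all add: comp_map_def)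

lemma comp_map_apply [simp]:
  "A \<in> Ob (Src F) \<Longrightarrow> FOb (comp_map G F) A = FOb G (FOb F A)"
  "f \<in> Arr (Src F) \<Longrightarrow> FArr (comp_map G F) f = FArr G (FArr F f)"
  "\<lbrakk>A \<in> Ob (Src F); x \<in> carrier (Fib (Src F) A)\<rbrakk> \<Longrightarrow> FEl (comp_map G F) A x = FEl G (FOb F A) (FEl F A x)"
  by (simp_all add: comp_map_def)

lemma comp_map_map:
  assumes F: "elementary_doctrine_map F" and G: "elementary_doctrine_map G" and FG: "Src G = Tgt F"
  shows "elementary_doctrine_map (comp_map G F)"
proof -
  define P R S where "P = Src F" and "R = Tgt F" and "S = Tgt G"
  interpret F: elementary_doctrine_map F P R using F by (simp_all add: P_def R_def)
  interpret G: elementary_doctrine_map G R S using G FG by (simp_all add: R_def S_def)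
  note P = P_def[symmetric] and S = S_def[symmetric]
  note apply' = comp_map_apply[where F=F and G=G, unfolded P]
  show ?thesis
  proof (rule elementary_doctrine_map.intro, unfold comp_map_cod P S)
    show "FOb (comp_map G F) \<in> Ob P \<rightarrow>\<^sub>E Ob S"
      using F.ob_closed G.ob_closed by (auto simp: comp_map_def P)
    show "FArr (comp_map G F) \<in> extensional (Arr P)" "FEl (comp_map G F) \<in> extensional (Ob P)"
      by (simp_all add: comp_map_def P)
  next
    fix f A B assume f: "f \<in> Hom P A B"
    note * = F.P.hom_arr[OF f]
    show "FArr (comp_map G F) f \<in> Hom S (FOb (comp_map G F) A) (FOb (comp_map G F) B)"
      using * G.arr[OF F.arr[OF f]] by (simp add: apply')
    show "FEl (comp_map G F) A (Reidx P f x) = Reidx S (FArr (comp_map G F) f) (FEl (comp_map G F) B x)"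
      if x: "x \<in> carrier (Fib P B)" for x
      using * x F.P.reidx_closed[OF f x] F.el_natural[OF f x] F.el_closed[OF *(5) x]
        G.el_natural[OF F.arr[OF f]] by (simp add: apply')
    show "FArr (comp_map G F) (g \<cdot>\<^bsub>P\<^esub> f) = FArr (comp_map G F) g \<cdot>\<^bsub>S\<^esub> FArr (comp_map G F) f"
      if g: "g \<in> Hom P B D" for g D
      using * F.P.hom_arr[OF g] F.P.hom_arr[OF F.P.comp_in_hom[OF f g]]
        F.arr_comp[OF f g] G.arr_comp[OF F.arr[OF f] F.arr[OF g]] by (simp add: apply')
  next
    fix A B Z p q assume AB: "A \<in> Ob P" "B \<in> Ob P" and Z: "is_product P A B Z p q"
    note D = is_productD[OF Z]
    show "is_product S (FOb (comp_map G F) A) (FOb (comp_map G F) B) (FOb (comp_map G F) Z)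
        (FArr (comp_map G F) p) (FArr (comp_map G F) q)"
      using G.preserves_products[OF F.ob_closed[OF AB(1)] F.ob_closed[OF AB(2)] F.preserves_products[OF AB Z]]
        AB D(1) F.P.hom_arr(1)[OF D(2)] F.P.hom_arr(1)[OF D(3)]
      by (simp add: apply')
  next
    fix A assume A: "A \<in> Ob P"
    note FA = F.ob_closed[OF A]
    show "FArr (comp_map G F) (Ident P A) = Ident S (FOb (comp_map G F) A)"
      using A F.P.hom_arr(1)[OF F.P.ident_in_hom[OF A]] F.arr_ident[OF A] G.arr_ident[OF FA]
      by (simp add: apply')
    show "FEl (comp_map G F) A \<in> extensional (carrier (Fib P A))" using A by (simp add: comp_map_def P)
    show "finite_meet_hom (Fib P A) (Fib S (FOb (comp_map G F) A)) (FEl (comp_map G F) A)"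
      using A finite_meet_hom_comp[OF F.el_hom[OF A] G.el_hom[OF FA]]
        finite_meet_hom_cong[OF F.P.fib[OF A], of "FEl (comp_map G F) A" "\<lambda>x. FEl G (FOb F A) (FEl F A x)"]
      by (simp add: apply')
    note pr = F.P.pr1_hom[OF A A] F.P.pr2_hom[OF A A]
    note Fpr = F.arr[OF pr(1)] F.arr[OF pr(2)]
    note AA = F.P.prod_ob[OF A A] and d = F.P.delta_closed[OF A]
    have "FEl (comp_map G F) (Prod P A A) (delta P A) = FEl G (FOb F (Prod P A A)) (FEl F (Prod P A A) (delta P A))"
      using AA d by (simp add: apply')
    also have "\<dots> = FEl G (FOb F (Prod P A A))
        (Reidx R (pairing R (FArr F (Pr1 P A A)) (FArr F (Pr2 P A A))) (delta R (FOb F A)))"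
      using F.el_delta[OF A] by simp
    also have "\<dots> = Reidx S (pairing S (FArr G (FArr F (Pr1 P A A))) (FArr G (FArr F (Pr2 P A A))))
        (delta S (FOb G (FOb F A)))"
      by (rule G.reidx_pairing_delta[OF Fpr])
    also have "\<dots> = Reidx S (pairing S (FArr (comp_map G F) (Pr1 P A A)) (FArr (comp_map G F) (Pr2 P A A)))
        (delta S (FOb (comp_map G F) A))"
      using A F.P.hom_arr(1)[OF pr(1)] F.P.hom_arr(1)[OF pr(2)] by (simp add: apply')
    finally show "FEl (comp_map G F) (Prod P A A) (delta P A) = \<dots>" .
  qed (rule F.src G.tgt)+
qed

lemma id_transf_cod [simp]: "Src2 (id_transf F) = F" "Tgt2 (id_transf F) = F"
  by (simp_all add: id_transf_def)

lemma id_transf_apply [simp]: "A \<in> Ob (Src F) \<Longrightarrow> Cpt (id_transf F) A = Ident (Tgt F) (FOb F A)"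
  by (simp add: id_transf_def)

lemma id_transf_transf:
  assumes F: "elementary_doctrine_map F"
  shows "elementary_doctrine_transf (id_transf F)"
proof -
  define P R where "P = Src F" and "R = Tgt F"
  interpret F: elementary_doctrine_map F P R using F by (simp_all add: P_def R_def)
  note P = P_def[symmetric] and R = R_def[symmetric]
  note apply' = id_transf_apply[where F=F, unfolded P R]
  show ?thesis
  proof (rule elementary_doctrine_transf.intro, unfold id_transf_cod P R)
    show "Cpt (id_transf F) \<in> extensional (Ob P)" by (simp add: id_transf_def P)
  next
    fix A assume A: "A \<in> Ob P"
    note FA = F.ob_closed[OF A]
    show "Cpt (id_transf F) A \<in> Hom R (FOb F A) (FOb F A)"
      using A F.R.ident_in_hom[OF FA] by (simp add: apply')
    show "FEl F A x \<sqsubseteq>\<^bsub>Fib R (FOb F A)\<^esub> Reidx R (Cpt (id_transf F) A) (FEl F A x)"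
      if x: "x \<in> carrier (Fib P A)" for x
    proof -
      interpret FA: finite_meet_poset "Fib R (FOb F A)" by (rule F.R.fib[OF FA])
      show ?thesis using A F.el_closed[OF A x] F.R.reidx_ident[OF FA] by (simp add: apply')
    qed
  next
    fix f A B assume f: "f \<in> Hom P A B"
    show "Cpt (id_transf F) B \<cdot>\<^bsub>R\<^esub> FArr F f = FArr F f \<cdot>\<^bsub>R\<^esub> Cpt (id_transf F) A"
      using F.P.hom_arr[OF f] F.R.ident_left[OF F.arr[OF f]] F.R.ident_right[OF F.arr[OF f]]
      by (simp add: apply')
  qed (rule F refl)+
qed

lemma vcomp_transf_cod [simp]:
  "Src2 (vcomp_transf s t) = Src2 t" "Tgt2 (vcomp_transf s t) = Tgt2 s"
  by (simp_all add: vcomp_transf_def)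

lemma vcomp_transf_apply [simp]:
  "A \<in> Ob (Src (Src2 t)) \<Longrightarrow> Cpt (vcomp_transf s t) A = Cpt s A \<cdot>\<^bsub>Tgt (Src2 t)\<^esub> Cpt t A"
  by (simp add: vcomp_transf_def)

lemma vcomp_transf_transf:
  assumes s: "elementary_doctrine_transf s" and t: "elementary_doctrine_transf t"
    and st: "Src2 s = Tgt2 t"
  shows "elementary_doctrine_transf (vcomp_transf s t)"
proof -
  define F G H where "F = Src2 t" and "G = Tgt2 t" and "H = Tgt2 s"
  define P R where "P = Src F" and "R = Tgt F"
  note defs = F_def[symmetric] H_def[symmetric] P_def[symmetric] R_def[symmetric]
  interpret t: elementary_doctrine_transf t F G P R
    using t by (simp_all add: F_def G_def P_def R_def)
  interpret s: elementary_doctrine_transf s G H P R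
    using s st elementary_doctrine_transf.parallel[OF t] by (simp_all add: F_def G_def H_def P_def R_def)
  note apply' = vcomp_transf_apply[where s=s and t=t, unfolded defs]
  show ?thesis
  proof (rule elementary_doctrine_transf.intro, unfold vcomp_transf_cod defs)
    show "Cpt (vcomp_transf s t) \<in> extensional (Ob P)" by (simp add: vcomp_transf_def defs)
  next
    fix A assume A: "A \<in> Ob P"
    note c = t.cpt[OF A] s.cpt[OF A]
    show "Cpt (vcomp_transf s t) A \<in> Hom R (FOb F A) (FOb H A)"
      using A t.F.R.comp_in_hom[OF c] by (simp add: apply')
    fix x assume x: "x \<in> carrier (Fib P A)"
    note el = t.F.el_closed[OF A x] t.G.el_closed[OF A x] s.G.el_closed[OF A x]
    note r = t.F.R.reidx_closed[OF c(1) el(2)] t.F.R.reidx_closed[OF c(2) el(3)]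
    interpret FA: finite_meet_poset "Fib R (FOb F A)" by (rule t.F.R.fib[OF t.F.ob_closed[OF A]])
    have "Reidx R (Cpt t A) (FEl G A x) \<sqsubseteq>\<^bsub>Fib R (FOb F A)\<^esub> Reidx R (Cpt t A) (Reidx R (Cpt s A) (FEl H A x))"
      by (rule t.F.R.reidx_mono[OF c(1) el(2) r(2) s.el_le[OF A x]])
    then have "FEl F A x \<sqsubseteq>\<^bsub>Fib R (FOb F A)\<^esub> Reidx R (Cpt t A) (Reidx R (Cpt s A) (FEl H A x))"
      using FA.le_trans[OF t.el_le[OF A x] _ el(1) r(1) t.F.R.reidx_closed[OF c(1) r(2)]] by simp
    then show "FEl F A x \<sqsubseteq>\<^bsub>Fib R (FOb F A)\<^esub> Reidx R (Cpt (vcomp_transf s t) A) (FEl H A x)"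
      using A t.F.R.reidx_comp[OF c el(3)] by (simp add: apply')
  next
    fix f A B assume f: "f \<in> Hom P A B"
    note A = t.F.P.hom_arr(4)[OF f] and B = t.F.P.hom_arr(5)[OF f]
    note tc = t.cpt[OF A] t.cpt[OF B] and sc = s.cpt[OF A] s.cpt[OF B]
    note Ff = t.F.arr[OF f] and Gf = t.G.arr[OF f] and Hf = s.G.arr[OF f]
    have "(Cpt s B \<cdot>\<^bsub>R\<^esub> Cpt t B) \<cdot>\<^bsub>R\<^esub> FArr F f = Cpt s B \<cdot>\<^bsub>R\<^esub> (FArr G f \<cdot>\<^bsub>R\<^esub> Cpt t A)"
      using t.F.R.comp_assoc[OF Ff tc(2) sc(2)] t.natural[OF f] by simp
    also have "\<dots> = FArr H f \<cdot>\<^bsub>R\<^esub> (Cpt s A \<cdot>\<^bsub>R\<^esub> Cpt t A)"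
      using t.F.R.comp_assoc[OF tc(1) Gf sc(2)] t.F.R.comp_assoc[OF tc(1) sc(1) Hf] s.natural[OF f] by simp
    finally show "Cpt (vcomp_transf s t) B \<cdot>\<^bsub>R\<^esub> FArr F f = FArr H f \<cdot>\<^bsub>R\<^esub> Cpt (vcomp_transf s t) A"
      using A B by (simp add: apply')
  qed (rule t.src2 s.tgt2 s.parallel)+
qed

lemma hcomp_transf_cod [simp]:
  "Src2 (hcomp_transf s t) = comp_map (Src2 s) (Src2 t)"
  "Tgt2 (hcomp_transf s t) = comp_map (Tgt2 s) (Tgt2 t)"
  by (simp_all add: hcomp_transf_def)

lemma hcomp_transf_apply [simp]:
  "A \<in> Ob (Src (Src2 t)) \<Longrightarrow> Cpt (hcomp_transf s t) A =
    Cpt s (FOb (Tgt2 t) A) \<cdot>\<^bsub>Tgt (Src2 s)\<^esub> FArr (Src2 s) (Cpt t A)"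
  by (simp add: hcomp_transf_def)

lemma hcomp_transf_transf:
  assumes s: "elementary_doctrine_transf s" and t: "elementary_doctrine_transf t"
    and st: "Src (Src2 s) = Tgt (Src2 t)"
  shows "elementary_doctrine_transf (hcomp_transf s t)"
proof -
  define F G F' G' where "F = Src2 t" and "G = Tgt2 t" and "F' = Src2 s" and "G' = Tgt2 s"
  define P R S where "P = Src F" and "R = Tgt F" and "S = Tgt F'"
  note defs = F_def[symmetric] G_def[symmetric] F'_def[symmetric] G'_def[symmetric]
    P_def[symmetric] R_def[symmetric] S_def[symmetric]
  interpret t: elementary_doctrine_transf t F G P R
    using t by (simp_all add: F_def G_def P_def R_def)
  interpret s: elementary_doctrine_transf s F' G' R S
    using s st by (simp_all add: F_def F'_def G'_def P_def R_def S_def)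
  note apply' = hcomp_transf_apply[where s=s and t=t, unfolded defs]
    comp_map_apply[where F=F and G=F', unfolded defs]
    comp_map_apply[where F=G and G=G', unfolded t.parallel]
  show ?thesis
  proof (rule elementary_doctrine_transf.intro, unfold hcomp_transf_cod comp_map_cod defs)
    show "Cpt (hcomp_transf s t) \<in> extensional (Ob P)" by (simp add: hcomp_transf_def defs)
    show "elementary_doctrine_map (comp_map F' F)"
      by (rule comp_map_map[OF t.src2 s.src2]) (simp add: R_def[symmetric] s.P_def[symmetric])
    show "elementary_doctrine_map (comp_map G' G)"
      by (rule comp_map_map[OF t.tgt2 s.tgt2]) (simp add: t.parallel s.parallel)
    show "Src G = P" "Tgt G' = S" by (rule t.parallel s.parallel)+
  next
    fix A assume A: "A \<in> Ob P"
    note FA = t.F.ob_closed[OF A] and GA = t.G.ob_closed[OF A]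
    note tA = t.cpt[OF A]
    note c = s.F.arr[OF tA] s.cpt[OF GA]
    show "Cpt (hcomp_transf s t) A \<in> Hom S (FOb (comp_map F' F) A) (FOb (comp_map G' G) A)"
      using A s.F.R.comp_in_hom[OF c] by (simp add: apply')
    fix x assume x: "x \<in> carrier (Fib P A)"
    note Fx = t.F.el_closed[OF A x] and Gx = t.G.el_closed[OF A x]
    note el = s.F.el_closed[OF FA Fx] s.F.el_closed[OF GA Gx] s.G.el_closed[OF GA Gx]
    note r = s.F.R.reidx_closed[OF c(1) el(2)] s.F.R.reidx_closed[OF c(2) el(3)]
    interpret FA: finite_meet_poset "Fib S (FOb F' (FOb F A))"
      by (rule s.F.R.fib[OF s.F.ob_closed[OF FA]])
    have "FEl F' (FOb F A) (FEl F A x) \<sqsubseteq>\<^bsub>Fib S (FOb F' (FOb F A))\<^esub>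
        FEl F' (FOb F A) (Reidx R (Cpt t A) (FEl G A x))"
      by (rule s.F.el_mono[OF FA Fx t.F.R.reidx_closed[OF tA Gx] t.el_le[OF A x]])
    then have "FEl F' (FOb F A) (FEl F A x) \<sqsubseteq>\<^bsub>Fib S (FOb F' (FOb F A))\<^esub>
        Reidx S (FArr F' (Cpt t A)) (FEl F' (FOb G A) (FEl G A x))"
      using s.F.el_natural[OF tA Gx] by simp
    moreover have "Reidx S (FArr F' (Cpt t A)) (FEl F' (FOb G A) (FEl G A x)) \<sqsubseteq>\<^bsub>Fib S (FOb F' (FOb F A))\<^esub>
        Reidx S (FArr F' (Cpt t A)) (Reidx S (Cpt s (FOb G A)) (FEl G' (FOb G A) (FEl G A x)))"
      by (rule s.F.R.reidx_mono[OF c(1) el(2) r(2) s.el_le[OF GA Gx]])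
    ultimately have "FEl F' (FOb F A) (FEl F A x) \<sqsubseteq>\<^bsub>Fib S (FOb F' (FOb F A))\<^esub>
        Reidx S (FArr F' (Cpt t A)) (Reidx S (Cpt s (FOb G A)) (FEl G' (FOb G A) (FEl G A x)))"
      by (rule FA.le_trans[OF _ _ el(1) r(1) s.F.R.reidx_closed[OF c(1) r(2)]])
    then show "FEl (comp_map F' F) A x \<sqsubseteq>\<^bsub>Fib S (FOb (comp_map F' F) A)\<^esub>
        Reidx S (Cpt (hcomp_transf s t) A) (FEl (comp_map G' G) A x)"
      using A x s.F.R.reidx_comp[OF c el(3)] by (simp add: apply')
  next
    fix f A B assume f: "f \<in> Hom P A B"
    note A = t.F.P.hom_arr(4)[OF f] and B = t.F.P.hom_arr(5)[OF f] and farr = t.F.P.hom_arr(1)[OF f]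
    note tA = t.cpt[OF A] and tB = t.cpt[OF B]
    note Ff = t.F.arr[OF f] and Gf = t.G.arr[OF f]
    note sA = s.cpt[OF t.G.ob_closed[OF A]] and sB = s.cpt[OF t.G.ob_closed[OF B]]
    have "(Cpt s (FOb G B) \<cdot>\<^bsub>S\<^esub> FArr F' (Cpt t B)) \<cdot>\<^bsub>S\<^esub> FArr F' (FArr F f)
        = Cpt s (FOb G B) \<cdot>\<^bsub>S\<^esub> FArr F' (FArr G f \<cdot>\<^bsub>R\<^esub> Cpt t A)"
      using s.F.R.comp_assoc[OF s.F.arr[OF Ff] s.F.arr[OF tB] sB] s.F.arr_comp[OF Ff tB] t.natural[OF f]
      by simp
    also have "\<dots> = (FArr G' (FArr G f) \<cdot>\<^bsub>S\<^esub> Cpt s (FOb G A)) \<cdot>\<^bsub>S\<^esub> FArr F' (Cpt t A)"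
      using s.F.arr_comp[OF tA Gf] s.F.R.comp_assoc[OF s.F.arr[OF tA] s.F.arr[OF Gf] sB] s.natural[OF Gf]
      by simp
    also have "\<dots> = FArr G' (FArr G f) \<cdot>\<^bsub>S\<^esub> (Cpt s (FOb G A) \<cdot>\<^bsub>S\<^esub> FArr F' (Cpt t A))"
      using s.F.R.comp_assoc[OF s.F.arr[OF tA] sA s.G.arr[OF Gf]] by simp
    finally show "Cpt (hcomp_transf s t) B \<cdot>\<^bsub>S\<^esub> FArr (comp_map F' F) f
        = FArr (comp_map G' G) f \<cdot>\<^bsub>S\<^esub> Cpt (hcomp_transf s t) A"
      using A B farr by (simp add: apply')
  qed
qed

lemma comp_map_assoc:
  assumes F: "elementary_doctrine_map F" and G: "elementary_doctrine_map G" and H: "elementary_doctrine_map H"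
    and FG: "Src G = Tgt F" and GH: "Src H = Tgt G"
  shows "comp_map H (comp_map G F) = comp_map (comp_map H G) F"
proof -
  interpret F: elementary_doctrine_map F "Src F" "Tgt F" by (rule F)
  show ?thesis
    by (rule elementary_doctrine_map_eqI)
      (simp_all add: comp_map_map F G H FG GH F.ob_closed F.arr_closed F.el_closed)
qed

lemma comp_map_id_left:
  assumes F: "elementary_doctrine_map F"
  shows "comp_map (id_map (Tgt F)) F = F"
proof -
  interpret F: elementary_doctrine_map F "Src F" "Tgt F" by (rule F)
  show ?thesis
    by (rule elementary_doctrine_map_eqI)
      (simp_all add: comp_map_map id_map_map F F.tgt F.ob_closed F.arr_closed F.el_closed)
qed

lemma comp_map_id_right:
  assumes F: "elementary_doctrine_map F"
  shows "comp_map F (id_map (Src F)) = F"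
proof -
  interpret F: elementary_doctrine_map F "Src F" "Tgt F" by (rule F)
  show ?thesis
    by (rule elementary_doctrine_map_eqI) (simp_all add: comp_map_map id_map_map F F.src)
qed

lemma vcomp_transf_assoc:
  assumes a: "elementary_doctrine_transf a" and b: "elementary_doctrine_transf b"
    and c: "elementary_doctrine_transf c" and ab: "Src2 b = Tgt2 a" and bc: "Src2 c = Tgt2 b"
  shows "vcomp_transf c (vcomp_transf b a) = vcomp_transf (vcomp_transf c b) a"
proof -
  interpret a: elementary_doctrine_transf a "Src2 a" "Tgt2 a" "Src (Src2 a)" "Tgt (Src2 a)" by (rule a)
  interpret b: elementary_doctrine_transf b "Src2 b" "Tgt2 b" "Src (Src2 b)" "Tgt (Src2 b)" by (rule b)
  interpret c: elementary_doctrine_transf c "Src2 c" "Tgt2 c" "Src (Src2 c)" "Tgt (Src2 c)" by (rule c)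
  show ?thesis
  proof (rule elementary_doctrine_transf_eqI)
    fix A assume "A \<in> Ob (Src (Src2 (vcomp_transf (vcomp_transf c b) a)))"
    then have A: "A \<in> Ob (Src (Src2 a))" by simp
    have "Cpt b A \<in> Hom (Tgt (Src2 a)) (FOb (Tgt2 a) A) (FOb (Tgt2 b) A)"
      "Cpt c A \<in> Hom (Tgt (Src2 a)) (FOb (Tgt2 b) A) (FOb (Tgt2 c) A)"
      using b.cpt[of A] c.cpt[of A] A ab bc a.parallel b.parallel by auto
    from a.F.R.comp_assoc[OF a.cpt[OF A] this]
    show "Cpt (vcomp_transf c (vcomp_transf b a)) A = Cpt (vcomp_transf (vcomp_transf c b) a) A"
      using A ab a.parallel by simp
  qed (simp_all add: vcomp_transf_transf a b c ab bc)
qed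

lemma vcomp_transf_id_left:
  assumes a: "elementary_doctrine_transf a"
  shows "vcomp_transf (id_transf (Tgt2 a)) a = a"
proof -
  interpret a: elementary_doctrine_transf a "Src2 a" "Tgt2 a" "Src (Src2 a)" "Tgt (Src2 a)" by (rule a)
  show ?thesis
    by (rule elementary_doctrine_transf_eqI)
      (simp_all add: vcomp_transf_transf id_transf_transf a a.tgt2 a.parallel a.F.R.ident_left[OF a.cpt])
qed

lemma vcomp_transf_id_right:
  assumes a: "elementary_doctrine_transf a"
  shows "vcomp_transf a (id_transf (Src2 a)) = a"
proof -
  interpret a: elementary_doctrine_transf a "Src2 a" "Tgt2 a" "Src (Src2 a)" "Tgt (Src2 a)" by (rule a)
  show ?thesis
    by (rule elementary_doctrine_transf_eqI)
      (simp_all add: vcomp_transf_transf id_transf_transf a a.src2 a.F.R.ident_right[OF a.cpt])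
qed

lemma hcomp_transf_assoc:
  assumes a: "elementary_doctrine_transf a" and b: "elementary_doctrine_transf b"
    and c: "elementary_doctrine_transf c"
    and ab: "Src (Src2 b) = Tgt (Src2 a)" and bc: "Src (Src2 c) = Tgt (Src2 b)"
  shows "hcomp_transf c (hcomp_transf b a) = hcomp_transf (hcomp_transf c b) a"
proof -
  interpret a: elementary_doctrine_transf a "Src2 a" "Tgt2 a" "Src (Src2 a)" "Tgt (Src2 a)" by (rule a)
  interpret b: elementary_doctrine_transf b "Src2 b" "Tgt2 b" "Src (Src2 b)" "Tgt (Src2 b)" by (rule b)
  interpret c: elementary_doctrine_transf c "Src2 c" "Tgt2 c" "Src (Src2 c)" "Tgt (Src2 c)" by (rule c)
  show ?thesis
  proof (rule elementary_doctrine_transf_eqI)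
    fix A assume "A \<in> Ob (Src (Src2 (hcomp_transf (hcomp_transf c b) a)))"
    then have A: "A \<in> Ob (Src (Src2 a))" by simp
    note aA = a.cpt[OF A] and GA = a.G.ob_closed[OF A]
    have GA': "FOb (Tgt2 a) A \<in> Ob (Src (Src2 b))" using GA ab by simp
    note bA = b.cpt[OF GA']
    have Fa: "FArr (Src2 b) (Cpt a A) \<in>
        Hom (Tgt (Src2 b)) (FOb (Src2 b) (FOb (Src2 a) A)) (FOb (Src2 b) (FOb (Tgt2 a) A))"
      by (rule b.F.arr) (use aA ab in simp)
    have cF: "FArr (Src2 c) f \<in> Hom (Tgt (Src2 c)) (FOb (Src2 c) X) (FOb (Src2 c) Y)"
      "FArr (Src2 c) (g \<cdot>\<^bsub>Tgt (Src2 b)\<^esub> f) = FArr (Src2 c) g \<cdot>\<^bsub>Tgt (Src2 c)\<^esub> FArr (Src2 c) f"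
      if "f \<in> Hom (Tgt (Src2 b)) X Y" "g \<in> Hom (Tgt (Src2 b)) Y Z" for f g X Y Z
      using c.F.arr[of f X Y] c.F.arr_comp[of f X Y g Z] that bc by simp_all
    have cA: "Cpt c (FOb (Tgt2 b) (FOb (Tgt2 a) A)) \<in> Hom (Tgt (Src2 c))
        (FOb (Src2 c) (FOb (Tgt2 b) (FOb (Tgt2 a) A))) (FOb (Tgt2 c) (FOb (Tgt2 b) (FOb (Tgt2 a) A)))"
      by (rule c.cpt) (use b.G.ob_closed[OF GA'] bc in simp)
    have cb: "FArr (Src2 c) (Cpt b (FOb (Tgt2 a) A)) \<in> Hom (Tgt (Src2 c))
        (FOb (Src2 c) (FOb (Src2 b) (FOb (Tgt2 a) A))) (FOb (Src2 c) (FOb (Tgt2 b) (FOb (Tgt2 a) A)))"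
      by (rule c.F.arr) (use bA bc in simp)
    show "Cpt (hcomp_transf c (hcomp_transf b a)) A = Cpt (hcomp_transf (hcomp_transf c b) a) A"
      using A GA' a.F.P.hom_arr(1) aA a.F.R.hom_arr(1)[OF aA] ab bc a.parallel b.parallel
        cF(2)[OF Fa bA] c.F.R.comp_assoc[OF cF(1)[OF Fa bA] cb cA]
      by simp
  qed (use a.parallel b.parallel in \<open>simp_all add: hcomp_transf_transf a b c ab bc
    comp_map_assoc a.src2 b.src2 c.src2 a.tgt2 b.tgt2 c.tgt2 c.parallel\<close>)
qed

lemma hcomp_transf_id_left:
  assumes a: "elementary_doctrine_transf a"
  shows "hcomp_transf (id_transf (id_map (Tgt (Src2 a)))) a = a"
proof -
  interpret a: elementary_doctrine_transf a "Src2 a" "Tgt2 a" "Src (Src2 a)" "Tgt (Src2 a)" by (rule a)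
  have [simp]: "comp_map (id_map (Tgt (Src2 a))) (Tgt2 a) = Tgt2 a"
    using comp_map_id_left[OF a.tgt2] a.parallel by simp
  show ?thesis
  proof (rule elementary_doctrine_transf_eqI)
    fix A assume A: "A \<in> Ob (Src (Src2 a))"
    show "Cpt (hcomp_transf (id_transf (id_map (Tgt (Src2 a)))) a) A = Cpt a A"
      using A a.G.ob_closed[OF A] a.F.R.hom_arr(1)[OF a.cpt[OF A]] a.F.R.ident_left[OF a.cpt[OF A]]
      by simp
  qed (simp_all add: hcomp_transf_transf id_transf_transf id_map_map a a.F.tgt comp_map_id_left a.src2)
qed

lemma hcomp_transf_id_right:
  assumes a: "elementary_doctrine_transf a"
  shows "hcomp_transf a (id_transf (id_map (Src (Src2 a)))) = a"
proof -
  interpret a: elementary_doctrine_transf a "Src2 a" "Tgt2 a" "Src (Src2 a)" "Tgt (Src2 a)" by (rule a)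
  have [simp]: "comp_map (Tgt2 a) (id_map (Src (Src2 a))) = Tgt2 a"
    using comp_map_id_right[OF a.tgt2] a.parallel by simp
  show ?thesis
  proof (rule elementary_doctrine_transf_eqI)
    fix A assume A: "A \<in> Ob (Src (Src2 a))"
    show "Cpt (hcomp_transf a (id_transf (id_map (Src (Src2 a))))) A = Cpt a A"
      using A a.F.arr_ident[OF A] a.F.P.hom_arr(1)[OF a.F.P.ident_in_hom[OF A]]
        a.F.R.ident_right[OF a.cpt[OF A]]
      by simp
  qed (simp_all add: hcomp_transf_transf id_transf_transf id_map_map a a.F.src comp_map_id_right a.src2)
qed

lemma hcomp_id_transf:
  assumes F: "elementary_doctrine_map F" and G: "elementary_doctrine_map G" and FG: "Src G = Tgt F"
  shows "hcomp_transf (id_transf G) (id_transf F) = id_transf (comp_map G F)"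
proof -
  interpret F: elementary_doctrine_map F "Src F" "Tgt F" by (rule F)
  interpret G: elementary_doctrine_map G "Src G" "Tgt G" by (rule G)
  show ?thesis
  proof (rule elementary_doctrine_transf_eqI)
    fix A assume "A \<in> Ob (Src (Src2 (id_transf (comp_map G F))))"
    then have A: "A \<in> Ob (Src F)" by simp
    then have FA: "FOb F A \<in> Ob (Src G)" using F.ob_closed FG by simp
    show "Cpt (hcomp_transf (id_transf G) (id_transf F)) A = Cpt (id_transf (comp_map G F)) A"
      using A FA FG G.arr_ident[OF FA] G.R.ident_left[OF G.R.ident_in_hom[OF G.ob_closed[OF FA]]] by simp
  qed (simp_all add: hcomp_transf_transf id_transf_transf F G FG comp_map_map)
qed

lemma whisker_left_apply:
  assumes a: "elementary_doctrine_transf a" and H: "elementary_doctrine_map H"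
    and aH: "Src H = Tgt (Src2 a)" and A: "A \<in> Ob (Src (Src2 a))"
  shows "Cpt (hcomp_transf (id_transf H) a) A = FArr H (Cpt a A)"
proof -
  interpret a: elementary_doctrine_transf a "Src2 a" "Tgt2 a" "Src (Src2 a)" "Tgt (Src2 a)" by (rule a)
  interpret H: elementary_doctrine_map H "Src H" "Tgt H" by (rule H)
  have c: "Cpt a A \<in> Hom (Src H) (FOb (Src2 a) A) (FOb (Tgt2 a) A)" using a.cpt[OF A] aH by simp
  show ?thesis using A aH a.G.ob_closed[OF A] H.R.ident_left[OF H.arr[OF c]] by simp
qed

lemma whisker_right_apply:
  assumes a: "elementary_doctrine_transf a" and H: "elementary_doctrine_map H"
    and aH: "Tgt H = Src (Src2 a)" and A: "A \<in> Ob (Src H)"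
  shows "Cpt (hcomp_transf a (id_transf H)) A = Cpt a (FOb H A)"
proof -
  interpret a: elementary_doctrine_transf a "Src2 a" "Tgt2 a" "Src (Src2 a)" "Tgt (Src2 a)" by (rule a)
  interpret H: elementary_doctrine_map H "Src H" "Tgt H" by (rule H)
  have HA: "FOb H A \<in> Ob (Src (Src2 a))" using H.ob_closed[OF A] aH by simp
  show ?thesis using A aH a.F.arr_ident[OF HA] a.F.R.ident_right[OF a.cpt[OF HA]] by simp
qed

lemma transf_interchange:
  assumes a: "elementary_doctrine_transf a" and a': "elementary_doctrine_transf a'"
    and b: "elementary_doctrine_transf b" and b': "elementary_doctrine_transf b'"
    and aa: "Src2 a' = Tgt2 a" and bb: "Src2 b' = Tgt2 b" and ab: "Src (Src2 b) = Tgt (Src2 a)"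
  shows "hcomp_transf (vcomp_transf b' b) (vcomp_transf a' a)
    = vcomp_transf (hcomp_transf b' a') (hcomp_transf b a)"
proof -
  define F G H F' G' H' where "F = Src2 a" and "G = Tgt2 a" and "H = Tgt2 a'"
    and "F' = Src2 b" and "G' = Tgt2 b" and "H' = Tgt2 b'"
  define P R S where "P = Src F" and "R = Tgt F" and "S = Tgt F'"
  note defs = F_def G_def H_def F'_def G'_def H'_def P_def R_def S_def
  note pa = elementary_doctrine_transf.parallel[OF a] and pb = elementary_doctrine_transf.parallel[OF b]
  interpret a: elementary_doctrine_transf a F G P R using a by (simp_all add: defs)
  interpret a': elementary_doctrine_transf a' G H P R using a' aa pa by (simp_all add: defs)
  interpret b: elementary_doctrine_transf b F' G' R S using b ab by (simp_all add: defs)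
  interpret b': elementary_doctrine_transf b' G' H' R S using b' bb pb ab by (simp_all add: defs)
  have cods: "Src2 a = F" "Tgt2 a = G" "Src2 a' = G" "Tgt2 a' = H" "Src2 b = F'" "Tgt2 b = G'"
    "Src2 b' = G'" "Tgt2 b' = H'" "Src F = P" "Tgt F = R" "Src F' = R" "Tgt F' = S"
    "Src G = P" "Tgt G = R" "Src H = P" "Tgt H = R" "Src G' = R" "Tgt G' = S" "Src H' = R" "Tgt H' = S"
    using a.parallel a'.parallel b.parallel b'.parallel aa bb ab by (simp_all add: defs)
  show ?thesis
  proof (rule elementary_doctrine_transf_eqI)
    fix A assume "A \<in> Ob (Src (Src2 (vcomp_transf (hcomp_transf b' a') (hcomp_transf b a))))"
    then have A: "A \<in> Ob P" by (simp add: cods)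
    note aA = a.cpt[OF A] and aA' = a'.cpt[OF A] and GA = a.G.ob_closed[OF A] and HA = a'.G.ob_closed[OF A]
    note bG = b.cpt[OF GA] and bH = b.cpt[OF HA] and bH' = b'.cpt[OF HA]
    note Fa = b.F.arr[OF aA] and Fa' = b.F.arr[OF aA'] and Ga' = b.G.arr[OF aA']
    let ?c = "Comp S"
    have "?c (?c (Cpt b' (FOb H A)) (Cpt b (FOb H A))) (FArr F' (Comp R (Cpt a' A) (Cpt a A)))
        = ?c (Cpt b' (FOb H A)) (?c (?c (Cpt b (FOb H A)) (FArr F' (Cpt a' A))) (FArr F' (Cpt a A)))"
      using b.F.arr_comp[OF aA aA'] b.F.R.comp_assoc[OF b.F.R.comp_in_hom[OF Fa Fa'] bH bH']
        b.F.R.comp_assoc[OF Fa Fa' bH] by simp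
    also have "\<dots> = ?c (Cpt b' (FOb H A)) (?c (?c (FArr G' (Cpt a' A)) (Cpt b (FOb G A))) (FArr F' (Cpt a A)))"
      using b.natural[OF aA'] by simp
    also have "\<dots> = ?c (?c (Cpt b' (FOb H A)) (FArr G' (Cpt a' A))) (?c (Cpt b (FOb G A)) (FArr F' (Cpt a A)))"
      using b.F.R.comp_assoc[OF Fa bG Ga'] b.F.R.comp_assoc[OF b.F.R.comp_in_hom[OF Fa bG] Ga' bH'] by simp
    finally show "Cpt (hcomp_transf (vcomp_transf b' b) (vcomp_transf a' a)) A
        = Cpt (vcomp_transf (hcomp_transf b' a') (hcomp_transf b a)) A"
      using A GA HA by (simp add: cods)
  qed (simp_all add: hcomp_transf_transf vcomp_transf_transf a b a' b' cods)
qed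

lemma ED_sel [simp]:
  "src1 (ED small) = Src" "tgt1 (ED small) = Tgt" "src2 (ED small) = Src2" "tgt2 (ED small) = Tgt2"
  "id1 (ED small) = id_map" "comp1 (ED small) = comp_map" "id2 (ED small) = id_transf"
  "vcomp (ED small) = vcomp_transf" "hcomp (ED small) = hcomp_transf"
  by (simp_all add: ED_def Let_def)

lemma ED_cells:
  "P \<in> cells0 (ED small) \<longleftrightarrow> elementary_doctrine P \<and> locally_small small P"
  "F \<in> cells1 (ED small) \<longleftrightarrow>
    elementary_doctrine_map F \<and> locally_small small (Src F) \<and> locally_small small (Tgt F)"
  "t \<in> cells2 (ED small) \<longleftrightarrow> elementary_doctrine_transf t \<and>
    locally_small small (Src (Src2 t)) \<and> locally_small small (Tgt (Src2 t))"
  using elementary_doctrine_map.src[of F] elementary_doctrine_map.tgt[of F]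
    elementary_doctrine_transf.src2[of t] elementary_doctrine_transf.tgt2[of t]
    elementary_doctrine_map.src[of "Src2 t"] elementary_doctrine_map.tgt[of "Src2 t"]
    elementary_doctrine_transf.parallel[of t]
  by (auto simp: ED_def Let_def)

lemma two_category_ED: "two_category (ED small)"
  by (unfold_locales, unfold ED_cells ED_sel)
    (simp_all add: elementary_doctrine_map.src elementary_doctrine_map.tgt id_map_map comp_map_map
      comp_map_assoc comp_map_id_left comp_map_id_right
      elementary_doctrine_transf.src2 elementary_doctrine_transf.tgt2 elementary_doctrine_transf.parallel
      id_transf_transf vcomp_transf_transf vcomp_transf_assoc vcomp_transf_id_left vcomp_transf_id_right
      hcomp_transf_transf hcomp_transf_assoc hcomp_transf_id_left hcomp_transf_id_right
      hcomp_id_transf transf_interchange)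

section \<open>The extensional collapse\<close>

text \<open>Reindexing in the collapse agrees with the original one on the carriers of the fibres only, so
  adjunctions have to be transferred up to agreement on carriers.\<close>

lemma left_adjoint_cong:
  assumes "left_adjoint L M l u"
    and "\<And>x. x \<in> carrier L \<Longrightarrow> l' x = l x" "\<And>y. y \<in> carrier M \<Longrightarrow> u' y = u y"
  shows "left_adjoint L M l' u'"
  using assms unfolding left_adjoint_def galois_connection_def galois_connection_axioms_def connection_def
  by (auto simp: Pi_def)

locale collapse = elementary_doctrine P + set_coding small code
  for P :: "('o, 'a, 'e) doctrine" (structure) and small :: "'a set \<Rightarrow> bool" and code :: "'a set \<Rightarrow> 'a" +
  assumes small_homs: "locally_small small P"
begin

abbreviation cls where "cls \<equiv> ext_class code P"
abbreviation Q where "Q \<equiv> Td0 code P"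

text \<open>Each class lies in a hom-set, which is small; this is where injectivity of the coding applies.\<close>

lemma cls_eq_iff:
  assumes f: "f \<in> Hom P A B" and g: "g \<in> Hom P A' B'"
  shows "cls f = cls g \<longleftrightarrow> ext_eq P f g"
proof
  have class_small: "{h'. ext_eq P h' h' \<and> ext_eq P h h'} \<in> {S. small S}" if h: "h \<in> Hom P A B" for h A B
  proof -
    have "{h'. ext_eq P h' h' \<and> ext_eq P h h'} \<subseteq> Hom P A B" using ext_eqD h by blast
    moreover have "small (Hom P A B)" using small_homs hom_arr[OF h] by (simp add: locally_small_def)
    ultimately show ?thesis using small_subset by blast
  qed
  assume "cls f = cls g"
  then have "{h. ext_eq P h h \<and> ext_eq P f h} = {h. ext_eq P h h \<and> ext_eq P g h}"
    unfolding ext_class_def by (rule inj_onD[OF code_inj _ class_small[OF f] class_small[OF g]])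
  then show "ext_eq P f g" using ext_eq_refl[OF g] by blast
next
  assume fg: "ext_eq P f g"
  then have "ext_eq P f h \<longleftrightarrow> ext_eq P g h" for h using ext_eq_trans ext_eq_sym by blast
  then show "cls f = cls g" by (simp add: ext_class_def)
qed

lemma ext_eq_rep_cls:
  assumes f: "f \<in> Hom P A B"
  shows "ext_eq P f (ext_rep code P (cls f))"
proof -
  have "ext_eq P (ext_rep code P (cls f)) (ext_rep code P (cls f)) \<and> cls (ext_rep code P (cls f)) = cls f"
    unfolding ext_rep_def by (rule someI[of _ f]) (simp add: ext_eq_refl[OF f])
  then have "ext_rep code P (cls f) \<in> Arr P" "cls f = cls (ext_rep code P (cls f))"
    by (auto simp: ext_eq_def)
  then show ?thesis using cls_eq_iff[OF f arr_hom] by blast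
qed

lemma rep_cls_hom: "f \<in> Hom P A B \<Longrightarrow> ext_rep code P (cls f) \<in> Hom P A B"
  using ext_eqD[OF ext_eq_rep_cls] .

lemma cls_rep_cls: "f \<in> Hom P A B \<Longrightarrow> cls (ext_rep code P (cls f)) = cls f"
  using cls_eq_iff[OF rep_cls_hom, of f A B f A B] ext_eq_sym[OF ext_eq_rep_cls] by blast

lemma Td0_sel [simp]:
  "Ob Q = Ob P" "Ident Q A = cls (Ident P A)" "Prod Q = Prod P" "Fib Q = Fib P"
  "Pr1 Q A B = cls (Pr1 P A B)" "Pr2 Q A B = cls (Pr2 P A B)"
  by (simp_all add: Td0_def)

lemma Arr_Td0: "Arr Q = ext_arrows code P"
  by (simp add: Td0_def)

lemma ext_arrows_eq: "ext_arrows code P = cls ` Arr P"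
proof -
  have "{f. ext_eq P f f} = Arr P" using ext_eq_refl[OF arr_hom] by (auto simp: ext_eq_def)
  then show ?thesis by (simp add: ext_arrows_def)
qed

lemma cls_hom:
  assumes f: "f \<in> Hom P A B"
  shows "cls f \<in> Hom Q A B"
  using hom_arr[OF f] hom_arr[OF rep_cls_hom[OF f]] by (simp add: Hom_def Arr_Td0 ext_arrows_eq) (simp add: Td0_def)

lemma hom_Td0E:
  assumes u: "u \<in> Hom Q A B"
  obtains f where "f \<in> Hom P A B" "u = cls f"
proof -
  obtain f where f: "f \<in> Arr P" "u = cls f" using u by (auto simp: Hom_def Arr_Td0 ext_arrows_eq)
  have "Dom P f = A" "Cod P f = B" using cls_hom[OF arr_hom[OF f(1)]] u f(2) by (auto simp: Hom_def)
  then show thesis using that[of f] f by (simp add: Hom_def)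
qed

lemma arr_Td0E:
  assumes "u \<in> Arr Q"
  obtains f where "f \<in> Arr P" "u = cls f"
  using assms that unfolding Arr_Td0 ext_arrows_eq by blast

lemma comp_cls:
  assumes f: "f \<in> Hom P A B" and g: "g \<in> Hom P B D"
  shows "cls g \<cdot>\<^bsub>Q\<^esub> cls f = cls (g \<cdot> f)"
proof -
  have "ext_eq P (g \<cdot> f) (ext_rep code P (cls g) \<cdot> ext_rep code P (cls f))"
    by (rule ext_eq_comp[OF ext_eq_rep_cls[OF f] f ext_eq_rep_cls[OF g] g])
  then have "cls (g \<cdot> f) = cls (ext_rep code P (cls g) \<cdot> ext_rep code P (cls f))"
    using cls_eq_iff[OF comp_in_hom[OF f g] comp_in_hom[OF rep_cls_hom[OF f] rep_cls_hom[OF g]]] by simp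
  then show ?thesis by (simp add: Td0_def)
qed

lemma reidx_cls:
  assumes f: "f \<in> Hom P A B" and x: "x \<in> carrier (Fib P B)"
  shows "Reidx Q (cls f) x = Reidx P f x"
  using ext_eq_reidx[OF ext_eq_rep_cls[OF f] f x] by (simp add: Td0_def)

lemma category_Td0: "category Q"
proof (rule category.intro)
  fix u assume "u \<in> Arr Q"
  then obtain f where f: "f \<in> Arr P" "u = cls f" by (rule arr_Td0E)
  show "Dom Q u \<in> Ob Q" "Cod Q u \<in> Ob Q"
    using cls_hom[OF arr_hom[OF f(1)]] hom_arr(4,5)[OF arr_hom[OF f(1)]] f(2) by (auto simp: Hom_def)
next
  fix A assume "A \<in> Ob Q"
  then show "Ident Q A \<in> Hom Q A A" using cls_hom[OF ident_in_hom] by simp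
next
  fix u v A B D assume "u \<in> Hom Q A B" "v \<in> Hom Q B D"
  then show "v \<cdot>\<^bsub>Q\<^esub> u \<in> Hom Q A D"
    using comp_cls cls_hom[OF comp_in_hom] by (elim hom_Td0E) simp
next
  fix u v w A B D E assume "u \<in> Hom Q A B" "v \<in> Hom Q B D" "w \<in> Hom Q D E"
  then obtain f g h where f: "f \<in> Hom P A B" "u = cls f" and g: "g \<in> Hom P B D" "v = cls g"
    and h: "h \<in> Hom P D E" "w = cls h"
    by (elim hom_Td0E)
  show "w \<cdot>\<^bsub>Q\<^esub> (v \<cdot>\<^bsub>Q\<^esub> u) = (w \<cdot>\<^bsub>Q\<^esub> v) \<cdot>\<^bsub>Q\<^esub> u"
    using comp_cls[OF f(1) g(1)] comp_cls[OF g(1) h(1)] comp_cls[OF comp_in_hom[OF f(1) g(1)] h(1)]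
      comp_cls[OF f(1) comp_in_hom[OF g(1) h(1)]] comp_assoc[OF f(1) g(1) h(1)] f g h by simp
next
  fix u A B assume "u \<in> Hom Q A B"
  then obtain f where f: "f \<in> Hom P A B" "u = cls f" by (rule hom_Td0E)
  note A = hom_arr(4)[OF f(1)] and B = hom_arr(5)[OF f(1)]
  show "Ident Q B \<cdot>\<^bsub>Q\<^esub> u = u" "u \<cdot>\<^bsub>Q\<^esub> Ident Q A = u"
    using comp_cls[OF f(1) ident_in_hom[OF B]] comp_cls[OF ident_in_hom[OF A] f(1)]
      ident_left[OF f(1)] ident_right[OF f(1)] f by simp_all
qed

text \<open>A product of \<open>P\<close> stays a product: mediating arrows are inherited, and uniqueness up to internal
  equality holds because internally equal components force internally equal pairs.\<close>

lemma is_product_cls: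
  assumes Z: "is_product P A B Z p q"
  shows "is_product Q A B Z (cls p) (cls q)"
  unfolding is_product_def
proof (intro conjI ballI)
  note D = is_productD[OF Z]
  show "Z \<in> Ob Q" "cls p \<in> Hom Q Z A" "cls q \<in> Hom Q Z B" using D cls_hom by simp_all
  fix X u v assume X: "X \<in> Ob Q" and "u \<in> Hom Q X A" "v \<in> Hom Q X B"
  then obtain f g where f: "f \<in> Hom P X A" "u = cls f" and g: "g \<in> Hom P X B" "v = cls g"
    by (elim hom_Td0E)
  obtain h where h: "h \<in> Hom P X Z" "p \<cdot> h = f" "q \<cdot> h = g"
    using is_product_lift[OF Z _ f(1) g(1)] X by auto
  show "\<exists>!w. w \<in> Hom Q X Z \<and> cls p \<cdot>\<^bsub>Q\<^esub> w = u \<and> cls q \<cdot>\<^bsub>Q\<^esub> w = v"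
  proof (rule ex1I[of _ "cls h"], intro conjI)
    show "cls h \<in> Hom Q X Z" "cls p \<cdot>\<^bsub>Q\<^esub> cls h = u" "cls q \<cdot>\<^bsub>Q\<^esub> cls h = v"
      using cls_hom[OF h(1)] comp_cls[OF h(1) D(2)] comp_cls[OF h(1) D(3)] h f g by simp_all
  next
    fix w assume w: "w \<in> Hom Q X Z \<and> cls p \<cdot>\<^bsub>Q\<^esub> w = u \<and> cls q \<cdot>\<^bsub>Q\<^esub> w = v"
    then obtain k where k: "k \<in> Hom P X Z" "w = cls k" using hom_Td0E by blast
    note hom = comp_in_hom[OF k(1) D(2)] comp_in_hom[OF k(1) D(3)]
    have "cls (p \<cdot> k) = cls f" "cls (q \<cdot> k) = cls g"
      using w k comp_cls[OF k(1) D(2)] comp_cls[OF k(1) D(3)] f g by simp_all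
    then have "ext_eq P (p \<cdot> k) (p \<cdot> h)" "ext_eq P (q \<cdot> k) (q \<cdot> h)"
      using cls_eq_iff[OF hom(1) f(1)] cls_eq_iff[OF hom(2) g(1)] h by simp_all
    then have "ext_eq P k h" by (rule ext_eq_product_joint_mono[OF Z k(1) h(1)])
    then show "w = cls h" using cls_eq_iff[OF k(1) h(1)] k by simp
  qed
qed

lemma product_category_Td0: "product_category Q"
  by (rule product_category.intro[OF category_Td0 product_category_axioms.intro]) (simp add: is_product_cls[OF products])

lemma pairing_cls:
  assumes f: "f \<in> Hom P X A" and g: "g \<in> Hom P X B"
  shows "pairing Q (cls f) (cls g) = cls (pairing P f g)"
proof -
  interpret Q: product_category Q by (rule product_category_Td0)
  note A = hom_arr(5)[OF f] and B = hom_arr(5)[OF g]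
  show ?thesis
    by (rule Q.pairing_eqI[of A B _ X])
      (use A B cls_hom[OF pairing_hom[OF f g]] comp_cls[OF pairing_hom[OF f g] pr1_hom[OF A B]]
        comp_cls[OF pairing_hom[OF f g] pr2_hom[OF A B]] pr1_pairing[OF f g] pr2_pairing[OF f g] in simp_all)
qed

lemma doctrine_Td0: "doctrine Q"
proof (rule doctrine.intro[OF product_category_Td0 doctrine_axioms.intro])
  show "finite_meet_poset (Fib Q A)" if "A \<in> Ob Q" for A using that fib by simp
  show "Reidx Q (Ident Q A) x = x" if "A \<in> Ob Q" "x \<in> carrier (Fib Q A)" for A x
    using that reidx_cls[OF ident_in_hom] reidx_ident by simp
next
  fix u A B assume u: "u \<in> Hom Q A B"
  obtain f where f: "f \<in> Hom P A B" "u = cls f" using hom_Td0E[OF u] .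
  show "finite_meet_hom (Fib Q B) (Fib Q A) (Reidx Q u)"
    using reidx_hom[OF rep_cls_hom[OF f(1)]] f(2) by (simp add: Td0_def)
  fix v D x assume v: "v \<in> Hom Q B D" and x: "x \<in> carrier (Fib Q D)"
  obtain g where g: "g \<in> Hom P B D" "v = cls g" using hom_Td0E[OF v] .
  have x: "x \<in> carrier (Fib P D)" using x by simp
  show "Reidx Q (v \<cdot>\<^bsub>Q\<^esub> u) x = Reidx Q u (Reidx Q v x)"
    using comp_cls[OF f(1) g(1)] reidx_cls[OF comp_in_hom[OF f(1) g(1)] x] reidx_cls[OF g(1) x]
      reidx_cls[OF f(1) reidx_closed[OF g(1) x]] reidx_comp[OF f(1) g(1) x] f g by simp
qed

text \<open>The conditions on \<open>\<delta>\<close> only involve reindexing along pairings of projections and identities,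
  which are computed by the same arrows in the collapse.\<close>

lemma is_equality_Td0:
  assumes d: "is_equality P A d" and A: "A \<in> Ob P"
  shows "is_equality Q A d"
  unfolding is_equality_def
proof (intro conjI ballI)
  have dc: "d \<in> carrier (Fib P (Prod P A A))" using d by (simp add: is_equality_def)
  then show "d \<in> carrier (Fib Q (Prod Q A A))" by simp
  note i = ident_in_hom[OF A]
  have "left_adjoint (Fib P A) (Fib P (Prod P A A))
      (\<lambda>x. Reidx P (Pr1 P A A) x \<sqinter>\<^bsub>Fib P (Prod P A A)\<^esub> d)
      (Reidx P (pairing P (Ident P A) (Ident P A)))"
    using d by (simp add: is_equality_def)
  then show "left_adjoint (Fib Q A) (Fib Q (Prod Q A A))
      (\<lambda>x. Reidx Q (Pr1 Q A A) x \<sqinter>\<^bsub>Fib Q (Prod Q A A)\<^esub> d)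
      (Reidx Q (pairing Q (Ident Q A) (Ident Q A)))"
    unfolding Td0_sel pairing_cls[OF i i]
    by (rule left_adjoint_cong) (simp_all add: reidx_cls[OF pr1_hom[OF A A]] reidx_cls[OF pairing_hom[OF i i]])
next
  have dc: "d \<in> carrier (Fib P (Prod P A A))" using d by (simp add: is_equality_def)
  fix X assume "X \<in> Ob Q"
  then have X: "X \<in> Ob P" by simp
  define XA where "XA = Prod P X A"
  have XA: "XA \<in> Ob P" using prod_ob[OF X A] by (simp add: XA_def)
  have prXA: "Pr1 P X A \<in> Hom P XA X" "Pr2 P X A \<in> Hom P XA A"
    using pr1_hom[OF X A] pr2_hom[OF X A] by (simp_all add: XA_def)
  note pr = pr1_hom[OF XA A] pr2_hom[OF XA A]
  note p1 = comp_in_hom[OF pr(1) prXA(1)] and p2 = comp_in_hom[OF pr(1) prXA(2)]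
  note e1 = pairing_hom[OF prXA, folded XA_def] and p12 = pairing_hom[OF p1 p2, folded XA_def]
    and p23 = pairing_hom[OF p2 pr(2)]
  note e = pairing_hom[OF e1 prXA(2)]
  have "left_adjoint (Fib P XA) (Fib P (Prod P XA A))
      (\<lambda>x. Reidx P (pairing P (Pr1 P X A \<cdot> Pr1 P XA A) (Pr2 P X A \<cdot> Pr1 P XA A)) x \<sqinter>\<^bsub>Fib P (Prod P XA A)\<^esub>
        Reidx P (pairing P (Pr2 P X A \<cdot> Pr1 P XA A) (Pr2 P XA A)) d)
      (Reidx P (pairing P (pairing P (Pr1 P X A) (Pr2 P X A)) (Pr2 P X A)))"
    using d X by (simp add: is_equality_def Let_def XA_def)
  then show "let XA = Prod Q X A; XAA = Prod Q XA A;
          p1 = Pr1 Q X A \<cdot>\<^bsub>Q\<^esub> Pr1 Q XA A; p2 = Pr2 Q X A \<cdot>\<^bsub>Q\<^esub> Pr1 Q XA A; p3 = Pr2 Q XA A;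
          e = pairing Q (pairing Q (Pr1 Q X A) (Pr2 Q X A)) (Pr2 Q X A)
      in left_adjoint (Fib Q XA) (Fib Q XAA)
          (\<lambda>x. Reidx Q (pairing Q p1 p2) x \<sqinter>\<^bsub>Fib Q XAA\<^esub> Reidx Q (pairing Q p2 p3) d)
          (Reidx Q e)"
    unfolding Let_def Td0_sel XA_def[symmetric] comp_cls[OF pr(1) prXA(1)] comp_cls[OF pr(1) prXA(2)]
      pairing_cls[OF p1 p2] pairing_cls[OF p2 pr(2)] pairing_cls[OF prXA] pairing_cls[OF e1 prXA(2)]
    by (rule left_adjoint_cong) (simp_all add: reidx_cls[OF p12] reidx_cls[OF p23 dc] reidx_cls[OF e])
qed

lemma elementary_doctrine_Td0: "elementary_doctrine Q"
proof (rule elementary_doctrine.intro[OF doctrine_Td0 elementary_doctrine_axioms.intro])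
  show "\<exists>d. is_equality Q A d" if "A \<in> Ob Q" for A
    using that is_equality_Td0[OF delta_is_equality] by auto
qed

lemma delta_Td0: "A \<in> Ob P \<Longrightarrow> delta Q A = delta P A"
  using doctrine.is_equality_unique[OF doctrine_Td0, of A]
    elementary_doctrine.delta_is_equality[OF elementary_doctrine_Td0, of A]
    is_equality_Td0[OF delta_is_equality, of A] by simp

lemma locally_small_Td0: "locally_small small Q"
proof -
  have "Hom Q A B \<subseteq> cls ` Hom P A B" for A B by (blast elim: hom_Td0E)
  then show ?thesis
    using small_homs small_image small_subset unfolding locally_small_def Td0_sel by meson
qed

lemma collapse_Td0: "collapse Q small code"
  using elementary_doctrine_Td0 locally_small_Td0 set_coding_axioms
  by (simp add: collapse_def collapse_axioms_def)

text \<open>In the collapse, internally equal arrows are equal, so collapsing again only replaces each arrow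
  by its singleton class. This is the reason for idempotency.\<close>

lemma ext_eq_Td0_iff: "ext_eq Q u v \<longleftrightarrow> u \<in> Arr Q \<and> u = v"
proof -
  interpret Q: elementary_doctrine Q by (rule elementary_doctrine_Td0)
  have "u = v" if uv: "ext_eq Q u v"
  proof -
    have "u \<in> Arr Q" using uv by (simp add: ext_eq_def)
    note u = Q.arr_hom[OF this]
    obtain f where f: "f \<in> Hom P (Dom Q u) (Cod Q u)" "u = cls f" using hom_Td0E[OF u] .
    obtain g where g: "g \<in> Hom P (Dom Q u) (Cod Q u)" "v = cls g" using hom_Td0E[OF Q.ext_eqD[OF uv u]] .
    note B = hom_arr(5)[OF f(1)]
    have "Reidx Q (pairing Q u v) (delta Q (Cod Q u)) = Reidx P (pairing P f g) (delta P (Cod Q u))"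
      using pairing_cls[OF f(1) g(1)] reidx_cls[OF pairing_hom[OF f(1) g(1)] delta_closed[OF B]]
        delta_Td0[OF B] f(2) g(2) by simp
    then have "ext_eq P f g"
      using uv Q.ext_eq_iff[OF u Q.ext_eqD[OF uv u]] ext_eq_iff[OF f(1) g(1)] by simp
    then show ?thesis using cls_eq_iff[OF f(1) g(1)] f g by simp
  qed
  moreover have "ext_eq Q u u" if "u \<in> Arr Q" using Q.ext_eq_refl[OF Q.arr_hom[OF that]] .
  ultimately show ?thesis by (auto simp: ext_eq_def)
qed

lemma rep_cls_Td0:
  assumes u: "u \<in> Arr Q"
  shows "ext_rep code Q (ext_class code Q u) = u"
proof -
  interpret Q: collapse Q small code by (rule collapse_Td0)
  show ?thesis using Q.ext_eq_rep_cls[OF Q.arr_hom[OF u]] by (simp add: ext_eq_Td0_iff)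
qed

end

section \<open>The 2-functor\<close>

lemma Td1_cod [simp]: "Src (Td1 code F) = Td0 code (Src F)" "Tgt (Td1 code F) = Td0 code (Tgt F)"
  and Td1_FOb [simp]: "FOb (Td1 code F) = FOb F" and Td1_FEl [simp]: "FEl (Td1 code F) = FEl F"
  by (simp_all add: Td1_def)

lemma Td2_cod [simp]: "Src2 (Td2 code t) = Td1 code (Src2 t)" "Tgt2 (Td2 code t) = Td1 code (Tgt2 t)"
  by (simp_all add: Td2_def)

lemma Td2_apply [simp]:
  "A \<in> Ob (Src (Src2 t)) \<Longrightarrow> Cpt (Td2 code t) A = ext_class code (Tgt (Src2 t)) (Cpt t A)"
  by (simp add: Td2_def)

lemma Td_unit_cod [simp]: "Src (Td_unit code P) = P" "Tgt (Td_unit code P) = Td0 code P"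
  and Td_unit_apply [simp]: "A \<in> Ob P \<Longrightarrow> FOb (Td_unit code P) A = A"
    "f \<in> Arr P \<Longrightarrow> FArr (Td_unit code P) f = ext_class code P f"
    "\<lbrakk>A \<in> Ob P; x \<in> carrier (Fib P A)\<rbrakk> \<Longrightarrow> FEl (Td_unit code P) A x = x"
  by (simp_all add: Td_unit_def)

lemma Td_mult_cod [simp]: "Src (Td_mult code P) = Td0 code (Td0 code P)" "Tgt (Td_mult code P) = Td0 code P"
  and Td_mult_FOb [simp]: "A \<in> Ob P \<Longrightarrow> FOb (Td_mult code P) A = A"
  and Td_mult_FEl [simp]: "\<lbrakk>A \<in> Ob P; x \<in> carrier (Fib P A)\<rbrakk> \<Longrightarrow> FEl (Td_mult code P) A x = x"
  by (simp_all add: Td_mult_def)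

context set_coding
begin

lemma collapse_cell: "P \<in> cells0 (ED small) \<Longrightarrow> collapse P small code"
  using set_coding_axioms by (simp add: ED_cells collapse_def collapse_axioms_def)

lemma Td0_cell:
  assumes P: "P \<in> cells0 (ED small)"
  shows "Td0 code P \<in> cells0 (ED small)"
  using collapse.elementary_doctrine_Td0[OF collapse_cell[OF P]] collapse.locally_small_Td0[OF collapse_cell[OF P]]
  by (simp add: ED_cells)

lemma cell1_cod:
  "F \<in> cells1 (ED small) \<Longrightarrow> Src F \<in> cells0 (ED small)" "F \<in> cells1 (ED small) \<Longrightarrow> Tgt F \<in> cells0 (ED small)"
  by (simp_all add: ED_cells elementary_doctrine_map.src elementary_doctrine_map.tgt)

lemma cell2_cod:
  "t \<in> cells2 (ED small) \<Longrightarrow> Src2 t \<in> cells1 (ED small)" "t \<in> cells2 (ED small) \<Longrightarrow> Tgt2 t \<in> cells1 (ED small)"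
  by (simp_all add: ED_cells elementary_doctrine_transf.src2 elementary_doctrine_transf.tgt2
      elementary_doctrine_transf.parallel)

text \<open>The value on a class is independent of the representative, because 1-cells preserve internal
  equality.\<close>

lemma Td1_apply:
  assumes F: "F \<in> cells1 (ED small)" and f: "f \<in> Arr (Src F)"
  shows "FArr (Td1 code F) (ext_class code (Src F) f) = ext_class code (Tgt F) (FArr F f)"
proof -
  interpret P: collapse "Src F" small code by (rule collapse_cell[OF cell1_cod(1)[OF F]])
  interpret R: collapse "Tgt F" small code by (rule collapse_cell[OF cell1_cod(2)[OF F]])
  interpret F: elementary_doctrine_map F "Src F" "Tgt F" using F by (simp add: ED_cells)
  note f' = P.arr_hom[OF f]
  have "ext_eq (Tgt F) (FArr F f) (FArr F (ext_rep code (Src F) (P.cls f)))"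
    by (rule F.ext_eq_map[OF P.ext_eq_rep_cls[OF f']])
  then have "R.cls (FArr F f) = R.cls (FArr F (ext_rep code (Src F) (P.cls f)))"
    using R.cls_eq_iff[OF F.arr[OF f'] F.arr[OF P.rep_cls_hom[OF f']]] by simp
  then show ?thesis using f by (simp add: Td1_def P.ext_arrows_eq)
qed

lemma Td1_cell:
  assumes F: "F \<in> cells1 (ED small)"
  shows "Td1 code F \<in> cells1 (ED small)"
proof -
  define P R where "P = Src F" and "R = Tgt F"
  note defs = P_def[symmetric] R_def[symmetric]
  interpret P: collapse P small code using collapse_cell[OF cell1_cod(1)[OF F]] by (simp add: P_def)
  interpret R: collapse R small code using collapse_cell[OF cell1_cod(2)[OF F]] by (simp add: R_def)
  interpret F: elementary_doctrine_map F P R using F by (simp_all add: ED_cells P_def R_def)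
  have appl: "FArr (Td1 code F) (P.cls f) = R.cls (FArr F f)" if "f \<in> Hom P A B" for f A B
    using Td1_apply[OF F, of f] P.hom_arr(1)[OF that] by (simp add: defs)
  have hom: "FArr (Td1 code F) u \<in> Hom R.Q (FOb F A) (FOb F B)" if u: "u \<in> Hom P.Q A B" for u A B
    using u R.cls_hom[OF F.arr] appl by (elim P.hom_Td0E) simp
  have ident: "FArr (Td1 code F) (Ident P.Q A) = Ident R.Q (FOb F A)" if "A \<in> Ob P.Q" for A
    using that appl[OF P.ident_in_hom] F.arr_ident by simp
  have comp: "FArr (Td1 code F) (v \<cdot>\<^bsub>P.Q\<^esub> u) = FArr (Td1 code F) v \<cdot>\<^bsub>R.Q\<^esub> FArr (Td1 code F) u"
    if u: "u \<in> Hom P.Q A B" and v: "v \<in> Hom P.Q B D" for u v A B D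
  proof -
    obtain f where f: "f \<in> Hom P A B" "u = P.cls f" using P.hom_Td0E[OF u] .
    obtain g where g: "g \<in> Hom P B D" "v = P.cls g" using P.hom_Td0E[OF v] .
    show ?thesis
      using P.comp_cls[OF f(1) g(1)] appl[OF P.comp_in_hom[OF f(1) g(1)]] appl[OF f(1)] appl[OF g(1)]
        F.arr_comp[OF f(1) g(1)] R.comp_cls[OF F.arr[OF f(1)] F.arr[OF g(1)]] f(2) g(2) by simp
  qed
  have chosen: "is_product R.Q (FOb F A) (FOb F B) (FOb F (Prod P.Q A B))
      (FArr (Td1 code F) (Pr1 P.Q A B)) (FArr (Td1 code F) (Pr2 P.Q A B))"
    if "A \<in> Ob P.Q" "B \<in> Ob P.Q" for A B
  proof -
    have A: "A \<in> Ob P" and B: "B \<in> Ob P" using that by simp_all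
    show ?thesis
      using R.is_product_cls[OF F.preserves_products[OF A B P.products[OF A B]]]
        appl[OF P.pr1_hom[OF A B]] appl[OF P.pr2_hom[OF A B]] by simp
  qed
  have "elementary_doctrine_map (Td1 code F)"
  proof (rule elementary_doctrine_map.intro, unfold Td1_cod Td1_FOb Td1_FEl defs)
    show "elementary_doctrine P.Q" "elementary_doctrine R.Q"
      by (rule P.elementary_doctrine_Td0 R.elementary_doctrine_Td0)+
    show "FArr (Td1 code F) \<in> extensional (Arr P.Q)" by (simp add: Td1_def P.Arr_Td0 defs)
    show "FOb F \<in> Ob P.Q \<rightarrow>\<^sub>E Ob R.Q" "FEl F \<in> extensional (Ob P.Q)" using F.ob F.el_ext by simp_all
  next
    fix u A B x assume u: "u \<in> Hom P.Q A B" and x: "x \<in> carrier (Fib P.Q B)"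
    obtain f where f: "f \<in> Hom P A B" "u = P.cls f" using P.hom_Td0E[OF u] .
    have x: "x \<in> carrier (Fib P B)" using x by simp
    show "FEl F A (Reidx P.Q u x) = Reidx R.Q (FArr (Td1 code F) u) (FEl F B x)"
      using P.reidx_cls[OF f(1) x] R.reidx_cls[OF F.arr[OF f(1)] F.el_closed[OF P.hom_arr(5)[OF f(1)] x]]
        F.el_natural[OF f(1) x] appl[OF f(1)] f(2) by simp
  next
    fix A B Z p q assume A: "A \<in> Ob P.Q" and B: "B \<in> Ob P.Q" and Z: "is_product P.Q A B Z p q"
    show "is_product R.Q (FOb F A) (FOb F B) (FOb F Z) (FArr (Td1 code F) p) (FArr (Td1 code F) q)"
      by (rule preserves_products_if_preserves_chosen[where Fob = "FOb F" and Farr = "FArr (Td1 code F)",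
            OF P.product_category_Td0 R.category_Td0 hom ident comp chosen A B Z])
  next
    fix A assume "A \<in> Ob P.Q"
    then have A: "A \<in> Ob P" by simp
    show "FEl F A \<in> extensional (carrier (Fib P.Q A))" using F.el_ext_fib[OF A] by simp
    show "finite_meet_hom (Fib P.Q A) (Fib R.Q (FOb F A)) (FEl F A)" using F.el_hom[OF A] by simp
    note pr = P.pr1_hom[OF A A] P.pr2_hom[OF A A]
    note FA = F.ob_closed[OF A]
    show "FEl F (Prod P.Q A A) (delta P.Q A) = Reidx R.Q (pairing R.Q (FArr (Td1 code F) (Pr1 P.Q A A))
        (FArr (Td1 code F) (Pr2 P.Q A A))) (delta R.Q (FOb F A))"
      using F.el_delta[OF A] P.delta_Td0[OF A] R.delta_Td0[OF FA] appl[OF pr(1)] appl[OF pr(2)]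
        R.pairing_cls[OF F.arr[OF pr(1)] F.arr[OF pr(2)]]
        R.reidx_cls[OF R.pairing_hom[OF F.arr[OF pr(1)] F.arr[OF pr(2)]] R.delta_closed[OF FA]] by simp
  qed (use hom ident comp in blast)+
  then show ?thesis
    using Td0_cell[OF cell1_cod(1)[OF F]] Td0_cell[OF cell1_cod(2)[OF F]] by (simp add: ED_cells)
qed

text \<open>Every arrow of a collapse is a class, so equations between 1-cells out of a collapse can be checked on
  the arrows of the original doctrine.\<close>

lemma cell1_eqI:
  assumes P: "P \<in> cells0 (ED small)" and F: "F \<in> cells1 (ED small)" and G: "G \<in> cells1 (ED small)"
    and src: "Src F = Td0 code P" "Src G = Td0 code P" and tgt: "Tgt F = Tgt G"
    and ob: "\<And>A. A \<in> Ob P \<Longrightarrow> FOb F A = FOb G A"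
    and arr: "\<And>f. f \<in> Arr P \<Longrightarrow> FArr F (ext_class code P f) = FArr G (ext_class code P f)"
    and el: "\<And>A x. A \<in> Ob P \<Longrightarrow> x \<in> carrier (Fib P A) \<Longrightarrow> FEl F A x = FEl G A x"
  shows "F = G"
proof -
  interpret P: collapse P small code by (rule collapse_cell[OF P])
  show ?thesis
  proof (rule elementary_doctrine_map_eqI)
    fix u assume "u \<in> Arr (Src G)"
    then show "FArr F u = FArr G u" using arr src by (auto elim: P.arr_Td0E)
  qed (use assms in \<open>simp_all add: ED_cells\<close>)
qed

lemma comp_cell:
  "\<lbrakk>F \<in> cells1 (ED small); G \<in> cells1 (ED small); Src G = Tgt F\<rbrakk> \<Longrightarrow> comp_map G F \<in> cells1 (ED small)"
  by (simp add: ED_cells comp_map_map)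

lemma id_cell: "P \<in> cells0 (ED small) \<Longrightarrow> id_map P \<in> cells1 (ED small)"
  by (simp add: ED_cells id_map_map)

lemma cls_arr:
  assumes "P \<in> cells0 (ED small)" "f \<in> Arr P"
  shows "ext_class code P f \<in> Arr (Td0 code P)"
proof -
  interpret P: collapse P small code by (rule collapse_cell[OF assms(1)])
  show ?thesis using assms(2) by (simp add: P.Arr_Td0 P.ext_arrows_eq)
qed

lemma Ob_Td0 [simp]: "Ob (Td0 code P) = Ob P" and Fib_Td0 [simp]: "Fib (Td0 code P) = Fib P"
  by (simp_all add: Td0_def)

lemma Td1_id:
  assumes P: "P \<in> cells0 (ED small)"
  shows "Td1 code (id_map P) = id_map (Td0 code P)"
  by (rule cell1_eqI[OF P Td1_cell[OF id_cell[OF P]] id_cell[OF Td0_cell[OF P]]])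
    (use Td1_apply[OF id_cell[OF P]] cls_arr[OF P] in simp_all)

lemma Td1_comp:
  assumes F: "F \<in> cells1 (ED small)" and G: "G \<in> cells1 (ED small)" and FG: "Src G = Tgt F"
  shows "Td1 code (comp_map G F) = comp_map (Td1 code G) (Td1 code F)"
proof -
  interpret F: elementary_doctrine_map F "Src F" "Tgt F" using F by (simp add: ED_cells)
  note P = cell1_cod(1)[OF F]
  show ?thesis
    by (rule cell1_eqI[OF P Td1_cell[OF comp_cell[OF F G FG]] comp_cell[OF Td1_cell[OF F] Td1_cell[OF G]]])
      (use Td1_apply[OF comp_cell[OF F G FG]] Td1_apply[OF F] Td1_apply[OF G] cls_arr[OF P] FG F.arr_closed
        in simp_all)
qed

lemma Td2_cell:
  assumes t: "t \<in> cells2 (ED small)"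
  shows "Td2 code t \<in> cells2 (ED small)"
proof -
  define F G where "F = Src2 t" and "G = Tgt2 t"
  define P R where "P = Src F" and "R = Tgt F"
  note defs = F_def[symmetric] G_def[symmetric] P_def[symmetric] R_def[symmetric]
  have F: "F \<in> cells1 (ED small)" and G: "G \<in> cells1 (ED small)" using cell2_cod[OF t] by (simp_all add: defs)
  have TF: "elementary_doctrine_map (Td1 code F)" and TG: "elementary_doctrine_map (Td1 code G)"
    using Td1_cell[OF F] Td1_cell[OF G] by (simp_all add: ED_cells)
  note P = cell1_cod(1)[OF F, folded P_def] and R = cell1_cod(2)[OF F, folded R_def]
  interpret P: collapse P small code by (rule collapse_cell[OF P])
  interpret R: collapse R small code by (rule collapse_cell[OF R])
  interpret t: elementary_doctrine_transf t F G P R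
    using t by (simp_all add: ED_cells F_def G_def P_def R_def)
  have appl: "Cpt (Td2 code t) A = R.cls (Cpt t A)" if "A \<in> Ob P" for A using that by (simp add: defs)
  have "elementary_doctrine_transf (Td2 code t)"
  proof (rule elementary_doctrine_transf.intro, unfold Td2_cod Td1_cod Td1_FOb Td1_FEl defs)
    show "Cpt (Td2 code t) \<in> extensional (Ob P.Q)" by (simp add: Td2_def defs)
    show "Td0 code (Src G) = P.Q" "Td0 code (Tgt G) = R.Q" by (simp_all add: t.parallel)
  next
    fix A assume "A \<in> Ob P.Q"
    then have A: "A \<in> Ob P" by simp
    show "Cpt (Td2 code t) A \<in> Hom R.Q (FOb F A) (FOb G A)"
      using R.cls_hom[OF t.cpt[OF A]] by (simp add: appl[OF A])
    fix x assume "x \<in> carrier (Fib P.Q A)"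
    then have x: "x \<in> carrier (Fib P A)" by simp
    show "FEl F A x \<sqsubseteq>\<^bsub>Fib R.Q (FOb F A)\<^esub> Reidx R.Q (Cpt (Td2 code t) A) (FEl G A x)"
      using t.el_le[OF A x] R.reidx_cls[OF t.cpt[OF A] t.G.el_closed[OF A x]] by (simp add: appl[OF A])
  next
    fix u A B assume u: "u \<in> Hom P.Q A B"
    obtain f where f: "f \<in> Hom P A B" "u = P.cls f" using P.hom_Td0E[OF u] .
    note A = P.hom_arr(4)[OF f(1)] and B = P.hom_arr(5)[OF f(1)]
    have "FArr (Td1 code F) u = R.cls (FArr F f)" "FArr (Td1 code G) u = R.cls (FArr G f)"
      using Td1_apply[OF F, of f] Td1_apply[OF G, of f] P.hom_arr(1)[OF f(1)] f(2)
      by (simp_all add: defs t.parallel)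
    then show "Cpt (Td2 code t) B \<cdot>\<^bsub>R.Q\<^esub> FArr (Td1 code F) u = FArr (Td1 code G) u \<cdot>\<^bsub>R.Q\<^esub> Cpt (Td2 code t) A"
      using R.comp_cls[OF t.F.arr[OF f(1)] t.cpt[OF B]] R.comp_cls[OF t.cpt[OF A] t.G.arr[OF f(1)]]
        t.natural[OF f(1)] by (simp add: appl[OF A] appl[OF B])
  qed (rule TF TG)+
  then show ?thesis using Td0_cell[OF P] Td0_cell[OF R] by (simp add: ED_cells defs)
qed

lemma cell2_eqI:
  assumes "s \<in> cells2 (ED small)" "t \<in> cells2 (ED small)" "Src2 s = Src2 t" "Tgt2 s = Tgt2 t"
    and "\<And>A. A \<in> Ob (Src (Src2 t)) \<Longrightarrow> Cpt s A = Cpt t A"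
  shows "s = t"
  using assms by (intro elementary_doctrine_transf_eqI) (simp_all add: ED_cells)

lemma Td2_id:
  assumes F: "F \<in> cells1 (ED small)"
  shows "Td2 code (id_transf F) = id_transf (Td1 code F)"
proof -
  interpret K: two_category "ED small" by (rule two_category_ED)
  have "FOb F A \<in> Ob (Tgt F)" if "A \<in> Ob (Src F)" for A
    using F elementary_doctrine_map.ob_closed[of F] that by (simp add: ED_cells)
  then show ?thesis
    using K.id2[OF F] K.id2[OF Td1_cell[OF F]]
    by (intro cell2_eqI Td2_cell) (simp_all add: Td0_def)
qed

lemma Td2_vcomp:
  assumes a: "a \<in> cells2 (ED small)" and b: "b \<in> cells2 (ED small)" and ab: "Src2 b = Tgt2 a"
  shows "Td2 code (vcomp_transf b a) = vcomp_transf (Td2 code b) (Td2 code a)"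
proof -
  interpret K: two_category "ED small" by (rule two_category_ED)
  interpret a: elementary_doctrine_transf a "Src2 a" "Tgt2 a" "Src (Src2 a)" "Tgt (Src2 a)"
    using a by (simp add: ED_cells)
  interpret b: elementary_doctrine_transf b "Src2 b" "Tgt2 b" "Src (Src2 b)" "Tgt (Src2 b)"
    using b by (simp add: ED_cells)
  interpret R: collapse "Tgt (Src2 a)" small code by (rule collapse_cell[OF cell1_cod(2)[OF cell2_cod(1)[OF a]]])
  show ?thesis
  proof (rule cell2_eqI)
    show "Td2 code (vcomp_transf b a) \<in> cells2 (ED small)" using K.vcomp[OF a b] ab Td2_cell by simp
    show "vcomp_transf (Td2 code b) (Td2 code a) \<in> cells2 (ED small)"
      using K.vcomp[OF Td2_cell[OF a] Td2_cell[OF b]] ab by simp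
    fix A assume "A \<in> Ob (Src (Src2 (vcomp_transf (Td2 code b) (Td2 code a))))"
    then have A: "A \<in> Ob (Src (Src2 a))" by simp
    have "Cpt b A \<in> Hom (Tgt (Src2 a)) (FOb (Tgt2 a) A) (FOb (Tgt2 b) A)"
      using b.cpt[of A] A ab a.parallel by simp
    then show "Cpt (Td2 code (vcomp_transf b a)) A = Cpt (vcomp_transf (Td2 code b) (Td2 code a)) A"
      using R.comp_cls[OF a.cpt[OF A]] A ab a.parallel by simp
  qed simp_all
qed

lemma Td2_hcomp:
  assumes a: "a \<in> cells2 (ED small)" and b: "b \<in> cells2 (ED small)" and ab: "Src (Src2 b) = Tgt (Src2 a)"
  shows "Td2 code (hcomp_transf b a) = hcomp_transf (Td2 code b) (Td2 code a)"
proof -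
  interpret K: two_category "ED small" by (rule two_category_ED)
  interpret a: elementary_doctrine_transf a "Src2 a" "Tgt2 a" "Src (Src2 a)" "Tgt (Src2 a)"
    using a by (simp add: ED_cells)
  interpret b: elementary_doctrine_transf b "Src2 b" "Tgt2 b" "Src (Src2 b)" "Tgt (Src2 b)"
    using b by (simp add: ED_cells)
  interpret S: collapse "Tgt (Src2 b)" small code by (rule collapse_cell[OF cell1_cod(2)[OF cell2_cod(1)[OF b]]])
  note a1 = cell2_cod[OF a] and b1 = cell2_cod[OF b]
  show ?thesis
  proof (rule cell2_eqI)
    show "Td2 code (hcomp_transf b a) \<in> cells2 (ED small)" using K.hcomp[OF a b] ab Td2_cell by simp
    show "hcomp_transf (Td2 code b) (Td2 code a) \<in> cells2 (ED small)"
      using K.hcomp[OF Td2_cell[OF a] Td2_cell[OF b]] ab by simp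
    show "Src2 (Td2 code (hcomp_transf b a)) = Src2 (hcomp_transf (Td2 code b) (Td2 code a))"
      using Td1_comp[OF a1(1) b1(1)] ab by simp
    show "Tgt2 (Td2 code (hcomp_transf b a)) = Tgt2 (hcomp_transf (Td2 code b) (Td2 code a))"
      using Td1_comp[OF a1(2) b1(2)] ab a.parallel b.parallel by simp
    fix A assume "A \<in> Ob (Src (Src2 (hcomp_transf (Td2 code b) (Td2 code a))))"
    then have A: "A \<in> Ob (Src (Src2 a))" by simp
    have GA: "FOb (Tgt2 a) A \<in> Ob (Src (Src2 b))" using a.G.ob_closed[OF A] ab by simp
    have aA: "Cpt a A \<in> Hom (Src (Src2 b)) (FOb (Src2 a) A) (FOb (Tgt2 a) A)" using a.cpt[OF A] ab by simp
    show "Cpt (Td2 code (hcomp_transf b a)) A = Cpt (hcomp_transf (Td2 code b) (Td2 code a)) A"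
      using S.comp_cls[OF b.F.arr[OF aA] b.cpt[OF GA]] Td1_apply[OF b1(1) b.F.P.hom_arr(1)[OF aA]] A GA ab
      by simp
  qed
qed

lemma two_functor_Td: "two_functor (ED small) (ED small) (endo (Td code))"
  by (rule two_functor.intro[OF two_category_ED two_category_ED two_functor_axioms.intro])
    (simp_all add: Td_def Td0_cell Td1_cell Td2_cell Td1_id Td1_comp Td2_id Td2_vcomp Td2_hcomp)

section \<open>Unit and multiplication\<close>

lemma Td_unit_cell:
  assumes P: "P \<in> cells0 (ED small)"
  shows "Td_unit code P \<in> cells1 (ED small)"
proof -
  interpret P: collapse P small code by (rule collapse_cell[OF P])
  have "elementary_doctrine_map (Td_unit code P)"
    unfolding Td_unit_def
    by (rule fibrewise_identity_map[OF P.elementary_doctrine_axioms P.elementary_doctrine_Td0])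
      (simp_all add: P.delta_Td0 P.cls_hom P.comp_cls P.reidx_cls)
  then show ?thesis using P P.locally_small_Td0 by (simp add: ED_cells)
qed

text \<open>The class of \<open>u\<close> in the second collapse is a singleton, so choosing a representative returns \<open>u\<close>.\<close>

lemma Td_mult_apply:
  assumes P: "P \<in> cells0 (ED small)" and u: "u \<in> Arr (Td0 code P)"
  shows "FArr (Td_mult code P) (ext_class code (Td0 code P) u) = u"
proof -
  interpret P: collapse P small code by (rule collapse_cell[OF P])
  interpret Q: collapse P.Q small code by (rule P.collapse_Td0)
  obtain f where f: "f \<in> Arr P" "u = P.cls f" using u by (rule P.arr_Td0E)
  show ?thesis
    using u P.cls_rep_cls[OF P.arr_hom[OF f(1)]] f(2)
    by (simp add: Td_mult_def Q.ext_arrows_eq P.rep_cls_Td0)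
qed

lemma Td_mult_cell:
  assumes P: "P \<in> cells0 (ED small)"
  shows "Td_mult code P \<in> cells1 (ED small)"
proof -
  interpret P: collapse P small code by (rule collapse_cell[OF P])
  interpret Q: collapse P.Q small code by (rule P.collapse_Td0)
  have mult: "ext_class code P (ext_rep code P (ext_rep code P.Q (Q.cls u))) = u" if "u \<in> Hom P.Q A B" for u A B
    using Td_mult_apply[OF P, of u] Q.hom_arr(1)[OF that] by (simp add: Td_mult_def Q.ext_arrows_eq)
  have "Td_mult code P = \<lparr>Src = Q.Q, Tgt = P.Q, FOb = \<lambda>A\<in>Ob Q.Q. A,
      FArr = \<lambda>u\<in>Arr Q.Q. P.cls (ext_rep code P (ext_rep code P.Q u)),
      FEl = \<lambda>A\<in>Ob Q.Q. \<lambda>x\<in>carrier (Fib Q.Q A). x\<rparr>"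
    by (simp add: Td_mult_def Q.Arr_Td0)
  moreover have "elementary_doctrine_map \<dots>"
  proof (rule fibrewise_identity_map[OF Q.elementary_doctrine_Td0 P.elementary_doctrine_Td0])
    fix w A B assume "w \<in> Hom Q.Q A B"
    then obtain u where u: "u \<in> Hom P.Q A B" "w = Q.cls u" by (rule Q.hom_Td0E)
    show "P.cls (ext_rep code P (ext_rep code P.Q w)) \<in> Hom P.Q A B" using u mult by simp
    show "Reidx P.Q (P.cls (ext_rep code P (ext_rep code P.Q w))) x = Reidx Q.Q w x"
      if "x \<in> carrier (Fib Q.Q B)" for x
      using u mult[OF u(1)] Q.reidx_cls[OF u(1)] that by simp
    fix z D assume "z \<in> Hom Q.Q B D"
    then obtain v where v: "v \<in> Hom P.Q B D" "z = Q.cls v" by (rule Q.hom_Td0E)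
    show "P.cls (ext_rep code P (ext_rep code P.Q (z \<cdot>\<^bsub>Q.Q\<^esub> w))) =
        P.cls (ext_rep code P (ext_rep code P.Q z)) \<cdot>\<^bsub>P.Q\<^esub> P.cls (ext_rep code P (ext_rep code P.Q w))"
      using u v mult[OF u(1)] mult[OF v(1)] Q.comp_cls[OF u(1) v(1)] mult[OF Q.comp_in_hom[OF u(1) v(1)]] by simp
  next
    fix A assume "A \<in> Ob Q.Q"
    then show "P.cls (ext_rep code P (ext_rep code P.Q (Ident Q.Q A))) = Ident P.Q A"
      using mult[OF Q.ident_in_hom] by simp
  next
    fix A B assume "A \<in> Ob Q.Q" "B \<in> Ob Q.Q"
    then show "P.cls (ext_rep code P (ext_rep code P.Q (Pr1 Q.Q A B))) = Pr1 P.Q A B"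
        "P.cls (ext_rep code P (ext_rep code P.Q (Pr2 Q.Q A B))) = Pr2 P.Q A B"
      using mult[OF Q.pr1_hom, of A B] mult[OF Q.pr2_hom, of A B] by simp_all
  qed (simp_all add: Q.delta_Td0)
  ultimately show ?thesis using P.locally_small_Td0 Q.locally_small_Td0 by (simp add: ED_cells)
qed

lemma unit_natural1:
  assumes F: "F \<in> cells1 (ED small)"
  shows "comp_map (Td_unit code (Tgt F)) F = comp_map (Td1 code F) (Td_unit code (Src F))"
proof -
  interpret F: elementary_doctrine_map F "Src F" "Tgt F" using F by (simp add: ED_cells)
  note cells = F Td1_cell[OF F] Td_unit_cell[OF cell1_cod(1)[OF F]] Td_unit_cell[OF cell1_cod(2)[OF F]]
  show ?thesis
    by (rule elementary_doctrine_map_eqI)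
      (use cells in \<open>simp_all add: ED_cells comp_map_map F.ob_closed F.arr_closed F.el_closed Td1_apply[OF F]\<close>)
qed

lemma mult_natural1:
  assumes F: "F \<in> cells1 (ED small)"
  shows "comp_map (Td_mult code (Tgt F)) (Td1 code (Td1 code F)) = comp_map (Td1 code F) (Td_mult code (Src F))"
proof -
  interpret F: elementary_doctrine_map F "Src F" "Tgt F" using F by (simp add: ED_cells)
  note TF = Td1_cell[OF F]
  interpret TF: elementary_doctrine_map "Td1 code F" "Td0 code (Src F)" "Td0 code (Tgt F)"
    using TF by (simp_all add: ED_cells)
  note P = cell1_cod(1)[OF F] and R = cell1_cod(2)[OF F]
  note TP = Td0_cell[OF P]
  show ?thesis
    by (rule cell1_eqI[OF TP comp_cell[OF Td1_cell[OF TF] Td_mult_cell[OF R]] comp_cell[OF Td_mult_cell[OF P] TF]])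
      (simp_all add: F.ob_closed F.el_closed cls_arr[OF TP] Td1_apply[OF TF, simplified]
        Td_mult_apply[OF P] Td_mult_apply[OF R] TF.arr_closed)
qed

lemma unit_natural2:
  assumes a: "a \<in> cells2 (ED small)"
  shows "hcomp_transf (id_transf (Td_unit code (Tgt (Src2 a)))) a
    = hcomp_transf (Td2 code a) (id_transf (Td_unit code (Src (Src2 a))))"
proof -
  interpret K: two_category "ED small" by (rule two_category_ED)
  interpret a: elementary_doctrine_transf a "Src2 a" "Tgt2 a" "Src (Src2 a)" "Tgt (Src2 a)"
    using a by (simp add: ED_cells)
  note F = cell2_cod(1)[OF a] and G = cell2_cod(2)[OF a] and Ta = Td2_cell[OF a]
  note uP = Td_unit_cell[OF cell1_cod(1)[OF F]] and uR = Td_unit_cell[OF cell1_cod(2)[OF F]]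
  note iP = K.id2[OF uP, simplified] and iR = K.id2[OF uR, simplified]
  show ?thesis
  proof (rule cell2_eqI)
    show "hcomp_transf (id_transf (Td_unit code (Tgt (Src2 a)))) a \<in> cells2 (ED small)"
      using K.hcomp[OF a, of "id_transf (Td_unit code (Tgt (Src2 a)))"] iR by simp
    show "hcomp_transf (Td2 code a) (id_transf (Td_unit code (Src (Src2 a)))) \<in> cells2 (ED small)"
      using K.hcomp[OF _ Ta, of "id_transf (Td_unit code (Src (Src2 a)))"] iP by simp
    fix A assume "A \<in> Ob (Src (Src2 (hcomp_transf (Td2 code a) (id_transf (Td_unit code (Src (Src2 a)))))))"
    then have A: "A \<in> Ob (Src (Src2 a))" by simp
    show "Cpt (hcomp_transf (id_transf (Td_unit code (Tgt (Src2 a)))) a) A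
        = Cpt (hcomp_transf (Td2 code a) (id_transf (Td_unit code (Src (Src2 a))))) A"
      using whisker_left_apply[of a "Td_unit code (Tgt (Src2 a))" A]
        whisker_right_apply[of "Td2 code a" "Td_unit code (Src (Src2 a))" A]
        a uP uR Ta A a.F.R.hom_arr(1)[OF a.cpt[OF A]] by (simp add: ED_cells del: hcomp_transf_apply)
  qed (use unit_natural1[OF F] unit_natural1[OF G] a.parallel in simp_all)
qed

lemma mult_natural2:
  assumes a: "a \<in> cells2 (ED small)"
  shows "hcomp_transf (id_transf (Td_mult code (Tgt (Src2 a)))) (Td2 code (Td2 code a))
    = hcomp_transf (Td2 code a) (id_transf (Td_mult code (Src (Src2 a))))"
proof -
  interpret K: two_category "ED small" by (rule two_category_ED)
  interpret a: elementary_doctrine_transf a "Src2 a" "Tgt2 a" "Src (Src2 a)" "Tgt (Src2 a)"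
    using a by (simp add: ED_cells)
  note F = cell2_cod(1)[OF a] and G = cell2_cod(2)[OF a] and Ta = Td2_cell[OF a]
  note R = cell1_cod(2)[OF F] and TTa = Td2_cell[OF Ta]
  note mP = Td_mult_cell[OF cell1_cod(1)[OF F]] and mR = Td_mult_cell[OF R]
  note iP = K.id2[OF mP, simplified] and iR = K.id2[OF mR, simplified]
  show ?thesis
  proof (rule cell2_eqI)
    show "hcomp_transf (id_transf (Td_mult code (Tgt (Src2 a)))) (Td2 code (Td2 code a)) \<in> cells2 (ED small)"
      using K.hcomp[OF TTa, of "id_transf (Td_mult code (Tgt (Src2 a)))"] iR by simp
    show "hcomp_transf (Td2 code a) (id_transf (Td_mult code (Src (Src2 a)))) \<in> cells2 (ED small)"
      using K.hcomp[OF _ Ta, of "id_transf (Td_mult code (Src (Src2 a)))"] iP by simp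
    fix A assume "A \<in> Ob (Src (Src2 (hcomp_transf (Td2 code a) (id_transf (Td_mult code (Src (Src2 a)))))))"
    then have A: "A \<in> Ob (Src (Src2 a))" by simp
    show "Cpt (hcomp_transf (id_transf (Td_mult code (Tgt (Src2 a)))) (Td2 code (Td2 code a))) A
        = Cpt (hcomp_transf (Td2 code a) (id_transf (Td_mult code (Src (Src2 a))))) A"
      using whisker_left_apply[of "Td2 code (Td2 code a)" "Td_mult code (Tgt (Src2 a))" A]
        whisker_right_apply[of "Td2 code a" "Td_mult code (Src (Src2 a))" A]
        Td_mult_apply[OF R cls_arr[OF R a.F.R.hom_arr(1)[OF a.cpt[OF A]]]]
        TTa mP mR Ta A by (simp add: ED_cells del: hcomp_transf_apply)
  qed (use mult_natural1[OF F] mult_natural1[OF G] a.parallel in simp_all)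
qed

lemma mult_unit_left:
  assumes P: "P \<in> cells0 (ED small)"
  shows "comp_map (Td_mult code P) (Td_unit code (Td0 code P)) = id_map (Td0 code P)"
proof -
  note TP = Td0_cell[OF P]
  show ?thesis
    by (rule cell1_eqI[OF P comp_cell[OF Td_unit_cell[OF TP] Td_mult_cell[OF P]] id_cell[OF TP]])
      (simp_all add: cls_arr[OF P] Td_mult_apply[OF P])
qed

lemma mult_unit_right:
  assumes P: "P \<in> cells0 (ED small)"
  shows "comp_map (Td_mult code P) (Td1 code (Td_unit code P)) = id_map (Td0 code P)"
  by (rule cell1_eqI[OF P comp_cell[OF Td1_cell[OF Td_unit_cell[OF P]] Td_mult_cell[OF P]]
        id_cell[OF Td0_cell[OF P]]])
    (simp_all add: cls_arr[OF P] Td_mult_apply[OF P] Td1_apply[OF Td_unit_cell[OF P], simplified])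

lemma mult_assoc:
  assumes P: "P \<in> cells0 (ED small)"
  shows "comp_map (Td_mult code P) (Td1 code (Td_mult code P)) = comp_map (Td_mult code P) (Td_mult code (Td0 code P))"
proof -
  note TP = Td0_cell[OF P]
  note TTP = Td0_cell[OF TP]
  note m = Td_mult_cell[OF P]
  interpret m: elementary_doctrine_map "Td_mult code P" "Td0 code (Td0 code P)" "Td0 code P"
    using m by (simp_all add: ED_cells)
  show ?thesis
    by (rule cell1_eqI[OF TTP comp_cell[OF Td1_cell[OF m] m] comp_cell[OF Td_mult_cell[OF TP] m]])
      (simp_all add: cls_arr[OF TTP] Td_mult_apply[OF P] Td_mult_apply[OF TP] Td1_apply[OF m, simplified] m.arr_closed)
qed

text \<open>Every arrow of the double collapse is the class of exactly one arrow of the collapse.\<close>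

lemma unit_mult:
  assumes P: "P \<in> cells0 (ED small)"
  shows "comp_map (Td_unit code (Td0 code P)) (Td_mult code P) = id_map (Td0 code (Td0 code P))"
proof -
  note TP = Td0_cell[OF P]
  show ?thesis
    by (rule cell1_eqI[OF TP comp_cell[OF Td_mult_cell[OF P] Td_unit_cell[OF TP]] id_cell[OF Td0_cell[OF TP]]])
      (simp_all add: cls_arr[OF TP] Td_mult_apply[OF P])
qed

end

section \<open>Pseudo-idempotency\<close>

lemma invertible_id2:
  assumes K: "two_category K" and f: "f \<in> cells1 K"
  shows "invertible_2cell K (id2 K f)"
  using two_category.id2[OF K f] two_category.vcomp_id_left[OF K, of "id2 K f"]
  unfolding invertible_2cell_def by auto

lemma equivalence_1cell_if_isomorphism:
  assumes K: "two_category K" and f: "f \<in> cells1 K" and g: "g \<in> cells1 K"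
    and src: "src1 K g = tgt1 K f" and tgt: "tgt1 K g = src1 K f"
    and gf: "comp1 K g f = id1 K (src1 K f)" and fg: "comp1 K f g = id1 K (tgt1 K f)"
  shows "equivalence_1cell K f"
proof -
  interpret K: two_category K by (rule K)
  have "\<exists>a. invertible_2cell K a \<and> src2 K a = id1 K A \<and> tgt2 K a = id1 K A" if "A \<in> cells0 K" for A
    using invertible_id2[OF K] K.id2 K.id1[OF that] by blast
  then show ?thesis
    using f g src tgt gf fg K.src1_closed[OF f] K.tgt1_closed[OF f] unfolding equivalence_1cell_def by auto
qed

lemma two_functor_comp:
  assumes "two_functor K L F" "two_functor L M G"
  shows "two_functor K M (comp_two_functor G F)"
proof -
  interpret F: two_functor K L F by fact
  interpret G: two_functor L M G by fact
  show ?thesis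
    by unfold_locales (simp_all add: comp_two_functor_def F.on0 F.on1 F.on2 G.on0 G.on1 G.on2
        F.on_id1 G.on_id1 F.on_comp1 G.on_comp1 F.on_id2 G.on_id2 F.on_vcomp G.on_vcomp F.on_hcomp G.on_hcomp F.K.src2_closed)
qed

lemma two_functor_id: "two_category K \<Longrightarrow> two_functor K K id_two_functor"
  by (simp add: two_functor_def two_functor_axioms_def id_two_functor_def)

theorem theorem5p7:
  fixes small :: "'a set \<Rightarrow> bool" and code :: "'a set \<Rightarrow> 'a"
  assumes "set_coding small code"
  shows "pseudo_idempotent_two_monad
    (ED small :: (('o, 'a, 'e) doctrine, ('o, 'a, 'e) doctrine_map, ('o, 'a, 'e) doctrine_transf) two_category)
    (Td code)"
proof -
  interpret set_coding small code by (rule assms)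
  let ?K = "ED small :: (('o, 'a, 'e) doctrine, ('o, 'a, 'e) doctrine_map, ('o, 'a, 'e) doctrine_transf) two_category"
  let ?T = "endo (Td code) :: (('o, 'a, 'e) doctrine, ('o, 'a, 'e) doctrine_map, ('o, 'a, 'e) doctrine_transf,
    ('o, 'a, 'e) doctrine, ('o, 'a, 'e) doctrine_map, ('o, 'a, 'e) doctrine_transf) two_functor"
  have K: "two_category ?K" by (rule two_category_ED)
  have T: "two_functor ?K ?K ?T" by (rule two_functor_Td)
  have sel: "on0 ?T = Td0 code" "on1 ?T = Td1 code" "on2 ?T = Td2 code"
    "mult (Td code) = Td_mult code" "unit (Td code) = Td_unit code"
    by (simp_all add: Td_def)
  have "two_natural_transformation ?K ?K (comp_two_functor ?T ?T) ?T (mult (Td code))"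
    by (rule two_natural_transformation.intro[OF two_functor_comp[OF T T] T two_natural_transformation_axioms.intro])
      (simp_all add: comp_two_functor_def sel Td_mult_cell mult_natural1 mult_natural2)
  moreover have "two_natural_transformation ?K ?K id_two_functor ?T (unit (Td code))"
    by (rule two_natural_transformation.intro[OF two_functor_id[OF K] T two_natural_transformation_axioms.intro])
      (simp_all add: id_two_functor_def sel Td_unit_cell unit_natural1 unit_natural2)
  ultimately have "two_monad ?K (Td code)"
    by (intro two_monad.intro T two_monad_axioms.intro)
      (simp_all add: sel mult_assoc mult_unit_left mult_unit_right)
  moreover have "equivalence_1cell ?K (mult (Td code) P)" if P: "P \<in> cells0 ?K" for P
    by (rule equivalence_1cell_if_isomorphism[OF K _ Td_unit_cell[OF Td0_cell[OF P]]])
      (simp_all add: sel Td_mult_cell[OF P] unit_mult[OF P] mult_unit_left[OF P])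
  ultimately show ?thesis
    by (intro pseudo_idempotent_two_monad.intro pseudo_idempotent_two_monad_axioms.intro)
qed

end
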